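(* Let $\mathcal{B}$ be a unital $\mathrm{C}^*$-algebra and let $\eta:\mathcal{B}\to\mathcal{B}$ be a linear map such that $\eta-\mathrm{id}$ is completely positive. Then there exist a $\mathcal{B}$-valued probability space $(\mathcal{A},E)$ and an operator $V\in\mathcal{A}$ such that $$V b_1 V^* b_2 V = V b_1\,\eta(b_2)\quad\text{for all } b_1,b_2\in\mathcal{B},\qquad E[V b V^*]=b\quad\text{for all } b\in\mathcal{B}.$$
   Context: A $\mathcal{B}$-valued probability space is a pair $(\mathcal{A},E)$ where $\mathcal{A}$ is a unital $\mathrm{C}^*$-algebra, $\mathcal{B}\subseteq\mathcal{A}$ is a unital inclusion (injective unital $*$-homomorphism), and $E:\mathcal{A}\to\mathcal{B}$ is a conditional expectation: $E|_{\mathcal{B}}=\mathrm{id}_{\mathcal{B}}$, $E[b_1ab_2]=b_1E[a]b_2$ for $a\in\mathcal{A}$ and $b_1,b_2\in\mathcal{B}$, and $E$ is completely positive. *)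

theory Defs
  imports "HOL-Algebra.Algebra" "HOL-Algebra.Algebraic_Closure_Type" Complex_Main
begin

record 'a cstar = "(complex, 'a) module" +
  star :: "'a \<Rightarrow> 'a" (\<open>_\<^sup>\<star>\<index>\<close> [1000] 999)
  cnorm :: "'a \<Rightarrow> real" (\<open>\<parallel>_\<parallel>\<index>\<close>)

text \<open>
  Unital C*-algebras. As for the rings of \<^theory>\<open>HOL-Algebra.Ring\<close>, the zero algebra is
  admitted. Completeness is with respect to the metric \<open>\<parallel>x \<ominus> y\<parallel>\<close>; it is written out
  since the norm of a record is unspecified off the carrier, so that this metric does not
  satisfy the axioms of the locale \<open>Metric_space\<close>.
\<close>

locale cstar_algebra =
  ring A + scalars: module "ring_of_type_algebra :: complex ring" A
  for A :: "('a, 'm) cstar_scheme" (structure) +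
  assumes smult_mult_left:
      "\<lbrakk>x \<in> carrier A; y \<in> carrier A\<rbrakk> \<Longrightarrow> (c \<odot> x) \<otimes> y = c \<odot> (x \<otimes> y)"
    and smult_mult_right:
      "\<lbrakk>x \<in> carrier A; y \<in> carrier A\<rbrakk> \<Longrightarrow> x \<otimes> (c \<odot> y) = c \<odot> (x \<otimes> y)"
    and star_closed: "x \<in> carrier A \<Longrightarrow> x\<^sup>\<star> \<in> carrier A"
    and star_star: "x \<in> carrier A \<Longrightarrow> (x\<^sup>\<star>)\<^sup>\<star> = x"
    and star_add: "\<lbrakk>x \<in> carrier A; y \<in> carrier A\<rbrakk> \<Longrightarrow> (x \<oplus> y)\<^sup>\<star> = x\<^sup>\<star> \<oplus> y\<^sup>\<star>"
    and star_smult: "x \<in> carrier A \<Longrightarrow> (c \<odot> x)\<^sup>\<star> = cnj c \<odot> x\<^sup>\<star>"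
    and star_mult: "\<lbrakk>x \<in> carrier A; y \<in> carrier A\<rbrakk> \<Longrightarrow> (x \<otimes> y)\<^sup>\<star> = y\<^sup>\<star> \<otimes> x\<^sup>\<star>"
    and norm_nonneg: "x \<in> carrier A \<Longrightarrow> 0 \<le> \<parallel>x\<parallel>"
    and norm_eq_zero: "x \<in> carrier A \<Longrightarrow> \<parallel>x\<parallel> = 0 \<longleftrightarrow> x = \<zero>"
    and norm_triangle: "\<lbrakk>x \<in> carrier A; y \<in> carrier A\<rbrakk> \<Longrightarrow> \<parallel>x \<oplus> y\<parallel> \<le> \<parallel>x\<parallel> + \<parallel>y\<parallel>"
    and norm_smult: "x \<in> carrier A \<Longrightarrow> \<parallel>c \<odot> x\<parallel> = cmod c * \<parallel>x\<parallel>"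
    and norm_mult: "\<lbrakk>x \<in> carrier A; y \<in> carrier A\<rbrakk> \<Longrightarrow> \<parallel>x \<otimes> y\<parallel> \<le> \<parallel>x\<parallel> * \<parallel>y\<parallel>"
    and cstar_identity: "x \<in> carrier A \<Longrightarrow> \<parallel>x\<^sup>\<star> \<otimes> x\<parallel> = \<parallel>x\<parallel>\<^sup>2"
    and complete:
      "\<lbrakk>\<And>n::nat. s n \<in> carrier A; \<forall>\<epsilon>>0. \<exists>N. \<forall>m\<ge>N. \<forall>n\<ge>N. \<parallel>s m \<ominus> s n\<parallel> < \<epsilon>\<rbrakk>
        \<Longrightarrow> \<exists>l\<in>carrier A. (\<lambda>n. \<parallel>s n \<ominus> l\<parallel>) \<longlonglongrightarrow> 0"

definition linear_map ::
  "('a, 'm) cstar_scheme \<Rightarrow> ('b, 'n) cstar_scheme \<Rightarrow> ('a \<Rightarrow> 'b) \<Rightarrow> bool" where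
  "linear_map A B f \<longleftrightarrow>
     f \<in> carrier A \<rightarrow> carrier B \<and>
     (\<forall>x\<in>carrier A. \<forall>y\<in>carrier A. f (x \<oplus>\<^bsub>A\<^esub> y) = f x \<oplus>\<^bsub>B\<^esub> f y) \<and>
     (\<forall>c. \<forall>x\<in>carrier A. f (c \<odot>\<^bsub>A\<^esub> x) = c \<odot>\<^bsub>B\<^esub> f x)"

text \<open>
  An \<open>n \<times> n\<close> matrix over \<open>A\<close> is a function of two indices of which only the values at
  indices below \<open>n\<close> matter. A matrix is positive, as an element of the C*-algebra
  \<open>M\<^sub>n(A)\<close>, if it is of the form \<open>T* T\<close> with \<open>T\<close> in \<open>M\<^sub>n(A)\<close>.
\<close>

definition mat_over :: "('a, 'm) cstar_scheme \<Rightarrow> nat \<Rightarrow> (nat \<Rightarrow> nat \<Rightarrow> 'a) \<Rightarrow> bool" where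
  "mat_over A n T \<longleftrightarrow> (\<forall>i<n. \<forall>j<n. T i j \<in> carrier A)"

definition mat_positive :: "('a, 'm) cstar_scheme \<Rightarrow> nat \<Rightarrow> (nat \<Rightarrow> nat \<Rightarrow> 'a) \<Rightarrow> bool" where
  "mat_positive A n M \<longleftrightarrow>
     (\<exists>T. mat_over A n T \<and>
        (\<forall>i<n. \<forall>j<n. M i j = (\<Oplus>\<^bsub>A\<^esub>k\<in>{..<n}. (T k i)\<^sup>\<star>\<^bsub>A\<^esub> \<otimes>\<^bsub>A\<^esub> T k j)))"

definition completely_positive ::
  "('a, 'm) cstar_scheme \<Rightarrow> ('b, 'n) cstar_scheme \<Rightarrow> ('a \<Rightarrow> 'b) \<Rightarrow> bool" where
  "completely_positive A B f \<longleftrightarrow>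
     linear_map A B f \<and>
     (\<forall>n M. mat_positive A n M \<longrightarrow> mat_positive B n (\<lambda>i j. f (M i j)))"

text \<open>Unitality is part of \<^const>\<open>ring_hom\<close>.\<close>

definition unital_star_hom ::
  "('b, 'n) cstar_scheme \<Rightarrow> ('a, 'm) cstar_scheme \<Rightarrow> ('b \<Rightarrow> 'a) \<Rightarrow> bool" where
  "unital_star_hom B A f \<longleftrightarrow>
     linear_map B A f \<and> f \<in> ring_hom B A \<and> (\<forall>b\<in>carrier B. f (b\<^sup>\<star>\<^bsub>B\<^esub>) = (f b)\<^sup>\<star>\<^bsub>A\<^esub>)"

text \<open>
  A \<open>B\<close>-valued probability space \<open>(A, E)\<close>, with the inclusion of \<open>B\<close> into \<open>A\<close> made
  explicit as the map \<open>\<iota>\<close>.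
\<close>

locale valued_prob_space =
  A: cstar_algebra A + B: cstar_algebra B
  for B :: "('b, 'n) cstar_scheme" and A :: "('a, 'm) cstar_scheme"
    and \<iota> :: "'b \<Rightarrow> 'a" and E :: "'a \<Rightarrow> 'b" +
  assumes inclusion_hom: "unital_star_hom B A \<iota>"
    and inclusion_inj: "inj_on \<iota> (carrier B)"
    and E_inclusion: "b \<in> carrier B \<Longrightarrow> E (\<iota> b) = b"
    and E_bimodule:
      "\<lbrakk>a \<in> carrier A; b\<^sub>1 \<in> carrier B; b\<^sub>2 \<in> carrier B\<rbrakk>
        \<Longrightarrow> E (\<iota> b\<^sub>1 \<otimes>\<^bsub>A\<^esub> a \<otimes>\<^bsub>A\<^esub> \<iota> b\<^sub>2) = b\<^sub>1 \<otimes>\<^bsub>B\<^esub> E a \<otimes>\<^bsub>B\<^esub> b\<^sub>2"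
    and E_completely_positive: "completely_positive A B E"

text \<open>
  HOL has no existential quantifier over types, so a statement asserting the existence of a
  C*-algebra has to name a type for its elements. For algebras built from a C*-algebra with
  elements in \<open>'b\<close>, we use the type of self-maps of \<open>'b \<times> ('b \<Rightarrow> 'b)\<close>: it has room for the
  operators on a right module of the form \<open>B \<oplus> H\<close> with the elements of \<open>H\<close> represented
  by functions from \<open>B\<close> to \<open>B\<close>.
\<close>

type_synonym 'b op = "'b \<times> ('b \<Rightarrow> 'b) \<Rightarrow> 'b \<times> ('b \<Rightarrow> 'b)"

end

theory Submission
  imports Defs
begin

text \<open>
  Since \<open>\<theta> = \<eta> - id\<close> is completely positive, \<open>\<langle>b \<otimes> c, b' \<otimes> c'\<rangle> = c* \<theta>(b* b') c'\<close> defines a Hilbert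
  \<open>B\<close>-module \<open>B \<otimes>\<^sub>\<theta> B\<close>. In \<open>K = B \<oplus> (B \<otimes>\<^sub>\<theta> B)\<close>, on which \<open>B\<close> acts from the left, put
  \<open>\<Omega> = (1, 0)\<close> and \<open>v = (1, 1 \<otimes> 1)\<close>, so that \<open>\<langle>v, b v\<rangle> = b + \<theta>(b) = \<eta>(b)\<close> and \<open>\<langle>\<Omega>, v\<rangle> = 1\<close>.
  Then \<open>A\<close> is the C*-algebra of adjointable operators on \<open>K\<close>, \<open>E[T] = \<langle>\<Omega>, T \<Omega>\<rangle>\<close>, and
  \<open>V x = v \<langle>\<Omega>, x\<rangle>\<close>: as \<open>\<langle>\<Omega>, \<sqdot>\<rangle>\<close> commutes with \<open>B\<close>, the relation \<open>V b V* c V = V b \<eta>(c)\<close> is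
  \<open>\<langle>v, c v\<rangle> = \<eta>(c)\<close>, and \<open>E[V b V*] = b\<close> since \<open>V* \<Omega> = \<Omega>\<close>.
\<close>

section \<open>Elementary facts on C*-algebras\<close>

text \<open>The summand \<open>B\<close> of \<open>K\<close> does double duty: it carries the
  identity part of \<open>\<eta>\<close>, and its unit is the vector that defines \<open>E\<close>.
  Three obstacles shape the work. First, no spectra or functional calculus are used: positivity of a
  self-adjoint \<open>a\<close> is the norm condition ||t - a|| <= t, square roots come from an
  iteration, and positivity of \<open>x* x\<close> is derived from these two. Second, the form on
  formal sums of tensors is degenerate and incomplete, whereas \<open>A\<close> must be a complete
  algebra with a definite norm. Both defects are repaired at once by replacing a vector with the
  functional that it induces and taking norm limits of functionals. Third, complete positivity of
  \<open>E\<close> asks for matrices \<open>T* T\<close> with entries of \<open>T\<close> in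
  \<open>B\<close>, but compressing by the unit vector only gives a sum of Gram matrices of vectors
  of \<open>K\<close>. A Gram matrix acts as a positive operator on the Hilbert module of n-tuples
  over \<open>B\<close>, and its square root there has entries in \<open>B\<close>. Operators on
  Hilbert modules are therefore studied in general and used twice, for \<open>K\<close> and for the
  n-tuples.\<close>

context cstar_algebra
begin

lemma smult_in_carrier [simp, intro]: "x \<in> carrier A \<Longrightarrow> c \<odot> x \<in> carrier A"
  using scalars.smult_closed[of c x] by (simp add: ring_of_type_algebra_def)

lemma smult_add_left: "x \<in> carrier A \<Longrightarrow> (c + d) \<odot> x = c \<odot> x \<oplus> d \<odot> x"
  using scalars.smult_l_distr[of c d x] by (simp add: ring_of_type_algebra_def)

lemma smult_add_right:
  "\<lbrakk>x \<in> carrier A; y \<in> carrier A\<rbrakk> \<Longrightarrow> c \<odot> (x \<oplus> y) = c \<odot> x \<oplus> c \<odot> y"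
  using scalars.smult_r_distr[of c x y] by (simp add: ring_of_type_algebra_def)

lemma smult_smult: "x \<in> carrier A \<Longrightarrow> c \<odot> (d \<odot> x) = (c * d) \<odot> x"
  using scalars.smult_assoc1[of c d x] by (simp add: ring_of_type_algebra_def)

lemma one_smult [simp]: "x \<in> carrier A \<Longrightarrow> 1 \<odot> x = x"
  using scalars.smult_one[of x] by (simp add: ring_of_type_algebra_def)

lemma zero_smult [simp]: "x \<in> carrier A \<Longrightarrow> 0 \<odot> x = \<zero>"
  using scalars.smult_l_null[of x] by (simp add: ring_of_type_algebra_def)

lemma smult_zero [simp]: "c \<odot> \<zero> = \<zero>"
  using scalars.smult_r_null[of c] by (simp add: ring_of_type_algebra_def)

lemma neg_smult: "x \<in> carrier A \<Longrightarrow> (- c) \<odot> x = \<ominus> (c \<odot> x)"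
  by (metis add.inv_equality add.right_inverse add.commute smult_add_left smult_in_carrier zero_smult)

lemma a_inv_smult: "x \<in> carrier A \<Longrightarrow> c \<odot> (\<ominus> x) = \<ominus> (c \<odot> x)"
  by (metis a_inv_closed add.inv_equality l_neg smult_add_right smult_in_carrier smult_zero)

lemma a_inv_eq: "x \<in> carrier A \<Longrightarrow> \<ominus> x = (- 1) \<odot> x"
  by (simp add: neg_smult)

lemma smult_diff_right:
  "\<lbrakk>x \<in> carrier A; y \<in> carrier A\<rbrakk> \<Longrightarrow> c \<odot> (x \<ominus> y) = c \<odot> x \<ominus> c \<odot> y"
  by (simp add: a_minus_def smult_add_right a_inv_smult)

declare star_closed [simp, intro] star_star [simp]

lemma star_zero [simp]: "\<zero>\<^sup>\<star> = \<zero>"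
  by (metis complex_cnj_zero star_closed star_smult zero_closed zero_smult)

lemma star_one [simp]: "\<one>\<^sup>\<star> = \<one>"
  by (metis one_closed r_one star_closed star_mult star_star l_one)

lemma star_a_inv: "x \<in> carrier A \<Longrightarrow> (\<ominus> x)\<^sup>\<star> = \<ominus> x\<^sup>\<star>"
  by (simp add: a_inv_eq star_smult)

lemma star_diff: "\<lbrakk>x \<in> carrier A; y \<in> carrier A\<rbrakk> \<Longrightarrow> (x \<ominus> y)\<^sup>\<star> = x\<^sup>\<star> \<ominus> y\<^sup>\<star>"
  by (simp add: a_minus_def star_add star_a_inv)

lemma norm_zero [simp]: "\<parallel>\<zero>\<parallel> = 0"
  by (simp add: norm_eq_zero)

lemma norm_a_inv [simp]: "x \<in> carrier A \<Longrightarrow> \<parallel>\<ominus> x\<parallel> = \<parallel>x\<parallel>"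
  by (simp add: a_inv_eq norm_smult)

lemma norm_diff_le: "\<lbrakk>x \<in> carrier A; y \<in> carrier A\<rbrakk> \<Longrightarrow> \<parallel>x \<ominus> y\<parallel> \<le> \<parallel>x\<parallel> + \<parallel>y\<parallel>"
  using norm_triangle[of x "\<ominus> y"] by (simp add: a_minus_def)

lemma a_inv_diff: "\<lbrakk>x \<in> carrier A; y \<in> carrier A\<rbrakk> \<Longrightarrow> \<ominus> (x \<ominus> y) = y \<ominus> x"
  by algebra

lemma norm_diff_commute: "\<lbrakk>x \<in> carrier A; y \<in> carrier A\<rbrakk> \<Longrightarrow> \<parallel>x \<ominus> y\<parallel> = \<parallel>y \<ominus> x\<parallel>"
  by (metis a_inv_diff minus_closed norm_a_inv)

lemma diff_diff_add:
  "\<lbrakk>x \<in> carrier A; y \<in> carrier A; z \<in> carrier A\<rbrakk> \<Longrightarrow> (x \<ominus> y) \<oplus> (y \<ominus> z) = x \<ominus> z"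
  by algebra

lemma diff_eq_zero: "\<lbrakk>x \<in> carrier A; y \<in> carrier A\<rbrakk> \<Longrightarrow> x \<ominus> y = \<zero> \<longleftrightarrow> x = y"
  by (metis a_minus_def add.inv_closed add.inv_comm add.inv_equality minus_minus r_neg)

lemma norm_diff_triangle:
  "\<lbrakk>x \<in> carrier A; y \<in> carrier A; z \<in> carrier A\<rbrakk> \<Longrightarrow> \<parallel>x \<ominus> z\<parallel> \<le> \<parallel>x \<ominus> y\<parallel> + \<parallel>y \<ominus> z\<parallel>"
  using norm_triangle[of "x \<ominus> y" "y \<ominus> z"] by (simp add: diff_diff_add)

lemma norm_le_diff: "\<lbrakk>x \<in> carrier A; y \<in> carrier A\<rbrakk> \<Longrightarrow> \<parallel>x\<parallel> \<le> \<parallel>x \<ominus> y\<parallel> + \<parallel>y\<parallel>"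
  using norm_diff_triangle[of x y \<zero>] by (simp add: a_minus_def)

lemma norm_star [simp]: assumes [simp]: "x \<in> carrier A" shows "\<parallel>x\<^sup>\<star>\<parallel> = \<parallel>x\<parallel>"
proof -
  have le: "\<parallel>y\<parallel> \<le> \<parallel>y\<^sup>\<star>\<parallel>" if [simp]: "y \<in> carrier A" for y
  proof (cases "\<parallel>y\<parallel> = 0")
    case True then show ?thesis by (simp add: norm_nonneg)
  next
    case False
    have "\<parallel>y\<parallel> * \<parallel>y\<parallel> \<le> \<parallel>y\<^sup>\<star>\<parallel> * \<parallel>y\<parallel>"
      using cstar_identity[of y] norm_mult[of "y\<^sup>\<star>" y] by (simp add: power2_eq_square)
    then show ?thesis using False norm_nonneg[of y] by auto
  qed
  show ?thesis using le[of x] le[of "x\<^sup>\<star>"] by simp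
qed

text \<open>The C*-identity only says that the norm of the unit is 0 or 1; the value 0 occurs in the
  zero algebra, hence the inequality.\<close>

lemma norm_one_le: "\<parallel>\<one>\<parallel> \<le> 1"
proof -
  have "\<parallel>\<one>\<parallel> * \<parallel>\<one>\<parallel> = \<parallel>\<one>\<parallel>"
    using cstar_identity[of \<one>] by (simp add: power2_eq_square)
  then show ?thesis by (metis mult_cancel_right1 order_refl zero_le_one)
qed

lemma norm_smult_one_le: "0 \<le> t \<Longrightarrow> \<parallel>of_real t \<odot> \<one>\<parallel> \<le> t"
  using mult_left_mono[OF norm_one_le, of t] by (simp add: norm_smult)

text \<open>The standard way below to pass identities to limits: an error bound proportional to the
  precision suffices, with any factor that does not depend on it.\<close>

lemma eq_of_norm_le:
  assumes "x \<in> carrier A" "y \<in> carrier A" and "\<And>\<epsilon>. 0 < \<epsilon> \<Longrightarrow> \<parallel>x \<ominus> y\<parallel> \<le> C * \<epsilon>"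
  shows "x = y"
proof -
  have "\<parallel>x \<ominus> y\<parallel> \<le> 0"
  proof (rule field_le_epsilon)
    fix e :: real assume "0 < e"
    then have "0 < e / (\<bar>C\<bar> + 1)" by simp
    from assms(3)[OF this] have "\<parallel>x \<ominus> y\<parallel> \<le> C / (\<bar>C\<bar> + 1) * e" by simp
    also have "\<dots> \<le> 1 * e" using \<open>0 < e\<close> by (intro mult_right_mono) (auto simp: divide_le_eq)
    finally show "\<parallel>x \<ominus> y\<parallel> \<le> 0 + e" by simp
  qed
  then show ?thesis using assms norm_nonneg[of "x \<ominus> y"] by (simp add: norm_eq_zero diff_eq_zero)
qed

end

section \<open>Limits and square roots\<close>

context cstar_algebra
begin

text \<open>Membership in the carrier is part of convergence, so that one assumption yields all side
  conditions of the limit rules.\<close>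

definition conv :: "(nat \<Rightarrow> 'a) \<Rightarrow> 'a \<Rightarrow> bool" where
  "conv s l \<longleftrightarrow> (\<forall>n. s n \<in> carrier A) \<and> l \<in> carrier A \<and> (\<lambda>n. \<parallel>s n \<ominus> l\<parallel>) \<longlonglongrightarrow> 0"

lemma convI:
  assumes "\<And>n. s n \<in> carrier A" "l \<in> carrier A"
    and "\<And>n. \<parallel>s n \<ominus> l\<parallel> \<le> f n" and "f \<longlonglongrightarrow> 0"
  shows "conv s l"
  unfolding conv_def
proof (intro conjI)
  show "(\<lambda>n. \<parallel>s n \<ominus> l\<parallel>) \<longlonglongrightarrow> 0"
    by (rule real_tendsto_sandwich[OF _ _ tendsto_const assms(4)])
      (use assms in \<open>auto intro!: always_eventually norm_nonneg\<close>)
qed (use assms in auto)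

lemma conv_carrier: "conv s l \<Longrightarrow> s n \<in> carrier A" "conv s l \<Longrightarrow> l \<in> carrier A"
  by (auto simp: conv_def)

lemma conv_norm: "conv s l \<Longrightarrow> (\<lambda>n. \<parallel>s n \<ominus> l\<parallel>) \<longlonglongrightarrow> 0"
  by (auto simp: conv_def)

lemma conv_unique: assumes "conv s l" "conv s m" shows "l = m"
proof -
  note [simp, intro] = assms[THEN conv_carrier(1)] assms[THEN conv_carrier(2)]
  have "\<parallel>l \<ominus> m\<parallel> \<le> 0 + 0"
  proof (rule LIMSEQ_le_const)
    show "(\<lambda>n. \<parallel>s n \<ominus> l\<parallel> + \<parallel>s n \<ominus> m\<parallel>) \<longlonglongrightarrow> 0 + 0"
      by (intro tendsto_add conv_norm assms)
    have "\<parallel>l \<ominus> m\<parallel> \<le> \<parallel>s n \<ominus> l\<parallel> + \<parallel>s n \<ominus> m\<parallel>" for n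
      using norm_diff_triangle[of l "s n" m] norm_diff_commute[of l "s n"] by simp
    then show "\<exists>N. \<forall>n\<ge>N. \<parallel>l \<ominus> m\<parallel> \<le> \<parallel>s n \<ominus> l\<parallel> + \<parallel>s n \<ominus> m\<parallel>" by blast
  qed
  then show ?thesis using norm_nonneg[of "l \<ominus> m"] by (simp add: norm_eq_zero diff_eq_zero)
qed

lemma conv_star: "conv s l \<Longrightarrow> conv (\<lambda>n. (s n)\<^sup>\<star>) (l\<^sup>\<star>)"
  by (auto simp: conv_def simp flip: star_diff)

lemma conv_add: assumes "conv s l" "conv t m" shows "conv (\<lambda>n. s n \<oplus> t n) (l \<oplus> m)"
proof (rule convI)
  note [simp, intro] = assms[THEN conv_carrier(1)] assms[THEN conv_carrier(2)]
  show "(\<lambda>n. \<parallel>s n \<ominus> l\<parallel> + \<parallel>t n \<ominus> m\<parallel>) \<longlonglongrightarrow> 0"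
    using tendsto_add[OF assms[THEN conv_norm]] by simp
  fix n
  have c: "s n \<in> carrier A" "t n \<in> carrier A" "l \<in> carrier A" "m \<in> carrier A" by auto
  have "(s n \<oplus> t n) \<ominus> (l \<oplus> m) = (s n \<ominus> l) \<oplus> (t n \<ominus> m)" using c by algebra
  then show "\<parallel>(s n \<oplus> t n) \<ominus> (l \<oplus> m)\<parallel> \<le> \<parallel>s n \<ominus> l\<parallel> + \<parallel>t n \<ominus> m\<parallel>"
    by (simp add: norm_triangle)
qed (use assms in \<open>auto simp: conv_def\<close>)

lemma conv_mult: assumes "conv s l" "conv t m" shows "conv (\<lambda>n. s n \<otimes> t n) (l \<otimes> m)"
proof (rule convI)
  note [simp, intro] = assms[THEN conv_carrier(1)] assms[THEN conv_carrier(2)]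
  let ?f = "\<lambda>n. \<parallel>s n \<ominus> l\<parallel> * \<parallel>t n \<ominus> m\<parallel> + (\<parallel>l\<parallel> * \<parallel>t n \<ominus> m\<parallel> + \<parallel>s n \<ominus> l\<parallel> * \<parallel>m\<parallel>)"
  have "?f \<longlonglongrightarrow> 0 * 0 + (\<parallel>l\<parallel> * 0 + 0 * \<parallel>m\<parallel>)"
    by (intro tendsto_intros conv_norm assms)
  then show "?f \<longlonglongrightarrow> 0" by simp
  fix n
  have c: "s n \<in> carrier A" "t n \<in> carrier A" "l \<in> carrier A" "m \<in> carrier A" by auto
  have "s n \<otimes> t n \<ominus> l \<otimes> m =
      (s n \<ominus> l) \<otimes> (t n \<ominus> m) \<oplus> (l \<otimes> (t n \<ominus> m) \<oplus> (s n \<ominus> l) \<otimes> m)" using c by algebra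
  then have "\<parallel>s n \<otimes> t n \<ominus> l \<otimes> m\<parallel> \<le>
      \<parallel>(s n \<ominus> l) \<otimes> (t n \<ominus> m)\<parallel> + (\<parallel>l \<otimes> (t n \<ominus> m)\<parallel> + \<parallel>(s n \<ominus> l) \<otimes> m\<parallel>)"
    using norm_triangle[of "(s n \<ominus> l) \<otimes> (t n \<ominus> m)" "l \<otimes> (t n \<ominus> m) \<oplus> (s n \<ominus> l) \<otimes> m"]
      norm_triangle[of "l \<otimes> (t n \<ominus> m)" "(s n \<ominus> l) \<otimes> m"] by simp
  also have "\<dots> \<le> ?f n" by (intro add_mono norm_mult) auto
  finally show "\<parallel>s n \<otimes> t n \<ominus> l \<otimes> m\<parallel> \<le> ?f n" .
qed (use assms in \<open>auto simp: conv_def\<close>)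

lemma conv_const: "l \<in> carrier A \<Longrightarrow> conv (\<lambda>n. l) l"
  by (simp add: conv_def a_minus_def r_neg)

lemma conv_Suc: "conv s l \<Longrightarrow> conv (\<lambda>n. s (Suc n)) l"
  unfolding conv_def using LIMSEQ_Suc by blast

lemma conv_norm_le:
  assumes "conv s l" and "\<And>n. \<parallel>s n\<parallel> \<le> C" shows "\<parallel>l\<parallel> \<le> C"
proof (rule LIMSEQ_le_const)
  note [simp, intro] = assms(1)[THEN conv_carrier(1)] assms(1)[THEN conv_carrier(2)]
  show "(\<lambda>n. \<parallel>s n \<ominus> l\<parallel> + C) \<longlonglongrightarrow> C"
    using tendsto_add[OF conv_norm[OF assms(1)] tendsto_const[of C]] by simp
  have "\<parallel>l\<parallel> \<le> \<parallel>s n \<ominus> l\<parallel> + C" for n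
    using norm_le_diff[of l "s n"] assms(2)[of n] norm_diff_commute[of l "s n"] by simp
  then show "\<exists>N. \<forall>n\<ge>N. \<parallel>l\<parallel> \<le> \<parallel>s n \<ominus> l\<parallel> + C" by blast
qed

text \<open>The iteration \<open>w \<mapsto> (x + w\<^sup>2) / 2\<close>, whose limit \<open>w\<close> satisfies \<open>(1 - w)\<^sup>2 = 1 - x\<close>, is
  dominated by the scalar one with \<open>x = 1\<close>, also on the boundary \<open>\<parallel>x\<parallel> = 1\<close>.\<close>

lemma one_minus_sqrt:
  assumes x [simp]: "x \<in> carrier A" and sa: "x\<^sup>\<star> = x" and n: "\<parallel>x\<parallel> \<le> 1"
  obtains w where "w \<in> carrier A" "w\<^sup>\<star> = w" "\<parallel>w\<parallel> \<le> 1" "w \<oplus> w = x \<oplus> w \<otimes> w"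
    "\<And>z. z \<in> carrier A \<Longrightarrow> z \<otimes> x = x \<otimes> z \<Longrightarrow> z \<otimes> w = w \<otimes> z"
proof -
  define s where "s = rec_nat \<zero> (\<lambda>_ w. (1/2) \<odot> (x \<oplus> w \<otimes> w))"
  define v where "v = rec_nat (0::real) (\<lambda>_ v. (1 + v\<^sup>2) / 2)"
  have s0 [simp]: "s 0 = \<zero>" and sS: "s (Suc n) = (1/2) \<odot> (x \<oplus> s n \<otimes> s n)" for n
    by (simp_all add: s_def)
  have v0 [simp]: "v 0 = 0" and vS: "v (Suc n) = (1 + (v n)\<^sup>2) / 2" for n
    by (simp_all add: v_def)
  have sc [simp, intro]: "s n \<in> carrier A" for n by (induction n) (simp_all add: sS)
  have ss: "(s n)\<^sup>\<star> = s n" for n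
    by (induction n) (simp_all add: sS star_smult star_add star_mult sa)
  have v1: "0 \<le> v n \<and> v n \<le> 1" for n
    by (induction n) (auto simp: vS power_le_one)
  have sv: "\<parallel>s n\<parallel> \<le> v n" for n
  proof (induction n)
    case (Suc n)
    have "\<parallel>x \<oplus> s n \<otimes> s n\<parallel> \<le> \<parallel>x\<parallel> + \<parallel>s n\<parallel> * \<parallel>s n\<parallel>"
      using norm_triangle[of x "s n \<otimes> s n"] norm_mult[of "s n" "s n"] by simp
    also have "\<dots> \<le> 1 + v n * v n"
      using n Suc v1[of n] norm_nonneg[of "s n"] by (intro add_mono mult_mono) auto
    finally show ?case by (simp add: sS vS norm_smult power2_eq_square)
  qed simp
  \<comment> \<open>Since the norm of \<open>x\<close> may equal 1, no geometric rate is available.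
    Instead the increments of \<open>s\<close> are dominated by those of \<open>v\<close>; they
    telescope, and \<open>v\<close> is Cauchy because it increases and is bounded by 1.\<close>
  have dS: "\<parallel>s (Suc n) \<ominus> s n\<parallel> \<le> v (Suc n) - v n" for n
  proof (induction n)
    case 0 then show ?case using n by (simp add: sS vS a_minus_def norm_smult)
  next
    case (Suc n)
    let ?a = "s (Suc n)" and ?b = "s n"
    have c: "?a \<in> carrier A" "?b \<in> carrier A" by auto
    have "(x \<oplus> ?a \<otimes> ?a) \<ominus> (x \<oplus> ?b \<otimes> ?b) = ?a \<otimes> (?a \<ominus> ?b) \<oplus> (?a \<ominus> ?b) \<otimes> ?b"
      using c x by algebra
    then have "s (Suc (Suc n)) \<ominus> ?a = (1/2) \<odot> (?a \<otimes> (?a \<ominus> ?b) \<oplus> (?a \<ominus> ?b) \<otimes> ?b)"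
      using arg_cong2[OF sS[of "Suc n"] sS[of n], of "\<lambda>x y. x \<ominus> y"] c
      by (simp only: smult_diff_right[symmetric] a_closed m_closed x)
    then have "\<parallel>s (Suc (Suc n)) \<ominus> ?a\<parallel> = 1/2 * \<parallel>?a \<otimes> (?a \<ominus> ?b) \<oplus> (?a \<ominus> ?b) \<otimes> ?b\<parallel>"
      by (simp add: norm_smult)
    also have "\<dots> \<le> 1/2 * (\<parallel>?a\<parallel> * \<parallel>?a \<ominus> ?b\<parallel> + \<parallel>?a \<ominus> ?b\<parallel> * \<parallel>?b\<parallel>)"
      using norm_triangle[of "?a \<otimes> (?a \<ominus> ?b)" "(?a \<ominus> ?b) \<otimes> ?b"]
        norm_mult[of ?a "?a \<ominus> ?b"] norm_mult[of "?a \<ominus> ?b" ?b] by simp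
    also have "\<dots> \<le> 1/2 * (v (Suc n) * (v (Suc n) - v n) + (v (Suc n) - v n) * v n)"
      using Suc sv[of n] sv[of "Suc n"] v1[of n] v1[of "Suc n"]
        norm_nonneg[of ?a] norm_nonneg[of ?b] norm_nonneg[of "?a \<ominus> ?b"]
      by (intro mult_left_mono add_mono mult_mono) auto
    also have "\<dots> = 1/2 * ((v (Suc n))\<^sup>2 - (v n)\<^sup>2)"
      by (simp add: power2_eq_square algebra_simps)
    also have "\<dots> = v (Suc (Suc n)) - v (Suc n)"
      unfolding vS[of "Suc n"] by (subst (3) vS) (simp add: field_simps)
    finally show ?case .
  qed
  have d: "\<parallel>s (m + k) \<ominus> s m\<parallel> \<le> v (m + k) - v m" for m k
  proof (induction k)
    case (Suc k) then show ?case
      using norm_diff_triangle[of "s (Suc (m + k))" "s (m + k)" "s m"] dS[of "m + k"] by simp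
  qed (simp add: a_minus_def r_neg)
  have "v n \<le> v (Suc n)" for n
    using order_trans[OF norm_nonneg dS[of n]] by simp
  then have "incseq v" by (rule incseq_SucI)
  then obtain L where "v \<longlonglongrightarrow> L" by (rule incseq_convergent[of v 1]) (use v1 in auto)
  then have "Cauchy v" by (rule LIMSEQ_imp_Cauchy)
  have "\<exists>l\<in>carrier A. (\<lambda>n. \<parallel>s n \<ominus> l\<parallel>) \<longlonglongrightarrow> 0"
  proof (rule complete)
    show "\<forall>\<epsilon>>0. \<exists>N. \<forall>m\<ge>N. \<forall>n\<ge>N. \<parallel>s m \<ominus> s n\<parallel> < \<epsilon>"
    proof (intro allI impI)
      fix e :: real assume "0 < e"
      then obtain N where N: "\<And>m n. m \<ge> N \<Longrightarrow> n \<ge> N \<Longrightarrow> dist (v m) (v n) < e"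
        using metric_CauchyD[OF \<open>Cauchy v\<close>, of e] by blast
      have *: "\<parallel>s m \<ominus> s n\<parallel> < e" if "n \<le> m" "N \<le> n" for m n
        using d[of n "m - n"] N[of m n] that by (auto simp: dist_real_def)
      then have "\<parallel>s m \<ominus> s n\<parallel> < e" if "N \<le> n" "N \<le> m" for m n
        using that *[of n m] *[of m n] norm_diff_commute[of "s m" "s n"]
        by (cases "n \<le> m") auto
      then show "\<exists>N. \<forall>m\<ge>N. \<forall>n\<ge>N. \<parallel>s m \<ominus> s n\<parallel> < e" by blast
    qed
  qed auto
  then obtain l where "conv s l" by (auto simp: conv_def)
  note cl = this and l [simp, intro] = this[THEN conv_carrier(2)]
  show ?thesis
  proof
    show "l \<in> carrier A" by simp
    show "l\<^sup>\<star> = l" by (rule conv_unique[OF conv_star[OF cl, unfolded ss] cl])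
    have "\<parallel>s n\<parallel> \<le> 1" for n using sv[of n] v1[of n] by linarith
    then show "\<parallel>l\<parallel> \<le> 1" by (rule conv_norm_le[OF cl])
    have "s (Suc n) \<oplus> s (Suc n) = x \<oplus> s n \<otimes> s n" for n
      unfolding sS using smult_add_left[of "x \<oplus> s n \<otimes> s n" "1/2" "1/2"] by simp
    then have "conv (\<lambda>n. x \<oplus> s n \<otimes> s n) (l \<oplus> l)"
      using conv_add[OF conv_Suc[OF cl] conv_Suc[OF cl]] by simp
    then show "l \<oplus> l = x \<oplus> l \<otimes> l"
      by (rule conv_unique) (rule conv_add[OF conv_const[OF x] conv_mult[OF cl cl]])
    fix z assume z [simp]: "z \<in> carrier A" and zx: "z \<otimes> x = x \<otimes> z"
    \<comment> \<open>Every iterate is a polynomial in \<open>x\<close>, so whatever commutes with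
      \<open>x\<close> commutes with all of them.\<close>
    have "z \<otimes> s n = s n \<otimes> z" for n
    proof (induction n)
      case (Suc n)
      have "z \<otimes> (s n \<otimes> s n) = (z \<otimes> s n) \<otimes> s n" by (simp add: m_assoc)
      also have "\<dots> = s n \<otimes> (z \<otimes> s n)" by (simp add: Suc m_assoc)
      also have "\<dots> = s n \<otimes> s n \<otimes> z" by (simp add: Suc m_assoc)
      finally have "z \<otimes> (s n \<otimes> s n) = s n \<otimes> s n \<otimes> z" .
      then show ?case
        by (simp add: sS smult_mult_left smult_mult_right l_distr r_distr zx)
    qed simp
    then have "conv (\<lambda>n. s n \<otimes> z) (z \<otimes> l)"
      using conv_mult[OF conv_const[OF z] cl] by simp
    then show "z \<otimes> l = l \<otimes> z"
      by (rule conv_unique) (rule conv_mult[OF cl conv_const[OF z]])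
  qed
qed

end

section \<open>Positive elements\<close>

context cstar_algebra
begin

text \<open>Unlike its commutative counterpart, the set of rewrite rules that the library provides
  to the method \<open>algebra\<close> for rings lacks the law \<open>x 1 = x\<close>.\<close>

lemmas [algebra ring "ring.zero A" "add A" "a_inv A" "a_minus A" "one A" "monoid.mult A"] = r_one

definition scal :: "real \<Rightarrow> 'a" where
  "scal t = of_real t \<odot> \<one>"

text \<open>For self-adjoint \<open>a\<close> the condition says that the spectrum lies in [0, 2t].
  In this form 1 - a/t has norm at most 1, as the square root iteration requires, and sums are
  immediate because the bounds add.\<close>

definition pos :: "'a \<Rightarrow> bool" where
  "pos a \<longleftrightarrow> a \<in> carrier A \<and> a\<^sup>\<star> = a \<and> (\<exists>t\<ge>0. \<parallel>scal t \<ominus> a\<parallel> \<le> t)"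

lemma pos_carrier [simp, intro]: "pos a \<Longrightarrow> a \<in> carrier A"
  by (simp add: pos_def)

lemma pos_star: "pos a \<Longrightarrow> a\<^sup>\<star> = a"
  by (simp add: pos_def)

lemma scal_carrier [simp, intro]: "scal t \<in> carrier A"
  by (simp add: scal_def)

lemma star_scal [simp]: "(scal t)\<^sup>\<star> = scal t"
  by (simp add: scal_def star_smult)

lemma scal_mult: "x \<in> carrier A \<Longrightarrow> scal t \<otimes> x = of_real t \<odot> x"
  and mult_scal: "x \<in> carrier A \<Longrightarrow> x \<otimes> scal t = of_real t \<odot> x"
  by (simp_all add: scal_def smult_mult_left smult_mult_right)

lemma scal_add: "scal (s + t) = scal s \<oplus> scal t"
  by (simp add: scal_def smult_add_left)

lemma scal_0 [simp]: "scal 0 = \<zero>" and scal_1 [simp]: "scal 1 = \<one>"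
  by (simp_all add: scal_def)

lemma smult_scal: "of_real s \<odot> scal t = scal (s * t)"
  by (simp add: scal_def smult_smult)

lemma norm_scal_le: "0 \<le> t \<Longrightarrow> \<parallel>scal t\<parallel> \<le> t"
  by (simp add: scal_def norm_smult_one_le)

text \<open>The element \<open>x\<close> = 1 - a/t has norm at most 1, so
  \<open>one_minus_sqrt\<close> provides \<open>w\<close> with \<open>(1 - w)\<^sup>2 = a/t\<close>,
  and \<open>h\<close> is the multiple of 1 - w by the root of t. It is positive because
  \<open>w\<close> has norm at most 1. The commutation clause later makes square roots of commuting
  elements commute.\<close>

lemma pos_sqrt:
  assumes "pos a"
  obtains h where "pos h" "h \<otimes> h = a"
    "\<And>z. z \<in> carrier A \<Longrightarrow> z \<otimes> a = a \<otimes> z \<Longrightarrow> z \<otimes> h = h \<otimes> z"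
proof -
  have [simp]: "a \<in> carrier A" and sa: "a\<^sup>\<star> = a" using assms by (auto simp: pos_def)
  obtain t where t: "0 \<le> t" "\<parallel>scal t \<ominus> a\<parallel> \<le> t" using assms by (auto simp: pos_def)
  show ?thesis
  proof (cases "t = 0")
    case True
    then have "a = \<zero>"
      using t norm_nonneg[of a] by (simp add: a_minus_def norm_eq_zero)
    moreover have "pos \<zero>" by (auto simp: pos_def a_minus_def intro: exI[of _ 0])
    ultimately show ?thesis by (intro that[of \<zero>]) auto
  next
    case False
    with t have t0: "0 < t" by simp
    define x where "x = of_real (1/t) \<odot> (scal t \<ominus> a)"
    have x [simp]: "x \<in> carrier A" by (simp add: x_def)
    have sx: "x\<^sup>\<star> = x" by (simp add: x_def star_smult star_diff sa)
    have nx: "\<parallel>x\<parallel> \<le> 1" using t t0 by (simp add: x_def norm_smult norm_divide)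
    have tx: "of_real t \<odot> x = scal t \<ominus> a" using t0 by (simp add: x_def smult_smult)
    obtain w where w [simp]: "w \<in> carrier A" and sw: "w\<^sup>\<star> = w" and nw: "\<parallel>w\<parallel> \<le> 1"
      and ww: "w \<oplus> w = x \<oplus> w \<otimes> w"
      and comm: "\<And>z. z \<in> carrier A \<Longrightarrow> z \<otimes> x = x \<otimes> z \<Longrightarrow> z \<otimes> w = w \<otimes> z"
      using one_minus_sqrt[OF x sx nx] by metis
    define h where "h = of_real (sqrt t) \<odot> (\<one> \<ominus> w)"
    have h [simp]: "h \<in> carrier A" by (simp add: h_def)
    have c: "w \<in> carrier A" "x \<in> carrier A" "w \<otimes> w \<in> carrier A" by auto
    have "(\<one> \<ominus> w) \<otimes> (\<one> \<ominus> w) = \<one> \<ominus> (w \<oplus> w) \<oplus> w \<otimes> w" using c(1) by algebra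
    also have "\<dots> = \<one> \<ominus> x" unfolding ww using c(2,3) by algebra
    finally have "h \<otimes> h = of_real t \<odot> (\<one> \<ominus> x)"
      using t0 by (simp add: h_def smult_mult_left smult_mult_right smult_smult flip: of_real_mult)
    also have "\<dots> = scal t \<ominus> (scal t \<ominus> a)"
      by (simp add: smult_diff_right tx) (simp add: scal_def)
    also have "\<dots> = a" using scal_carrier[of t] \<open>a \<in> carrier A\<close> by algebra
    finally have hh: "h \<otimes> h = a" .
    have sh: "h\<^sup>\<star> = h" by (simp add: h_def star_smult star_diff sw)
    have "scal (sqrt t) \<ominus> h = of_real (sqrt t) \<odot> (\<one> \<ominus> (\<one> \<ominus> w))"
      by (simp add: h_def scal_def smult_diff_right)
    also have "\<one> \<ominus> (\<one> \<ominus> w) = w" using c(1) by algebra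
    finally have "\<parallel>scal (sqrt t) \<ominus> h\<parallel> \<le> sqrt t"
      using nw t0 by (simp add: norm_smult)
    then have "pos h" using sh t0 by (auto simp: pos_def intro!: exI[of _ "sqrt t"])
    moreover have "z \<otimes> h = h \<otimes> z" if z [simp]: "z \<in> carrier A" and "z \<otimes> a = a \<otimes> z" for z
    proof -
      have "z \<otimes> x = x \<otimes> z"
        using that by (simp add: x_def a_minus_def smult_mult_left smult_mult_right l_distr r_distr
          l_minus r_minus scal_mult mult_scal)
      from comm[OF z this] show ?thesis
        by (simp add: h_def a_minus_def smult_mult_left smult_mult_right l_distr r_distr
          l_minus r_minus)
    qed
    ultimately show ?thesis using that hh by blast
  qed
qed

text \<open>As \<open>h\<close> and \<open>k\<close> commute, u = h + i k satisfies
  \<open>u* u = h\<^sup>2 + k\<^sup>2\<close>, so the C*-identity bounds the norm of u by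
  \<open>r\<close>; and \<open>k\<close> is the imaginary part of u. This replaces the spectral
  comparison of \<open>k\<^sup>2\<close> with \<open>h\<^sup>2 + k\<^sup>2\<close>.\<close>

lemma norm_le_of_square_sum:
  assumes [simp]: "h \<in> carrier A" "k \<in> carrier A" and "h\<^sup>\<star> = h" "k\<^sup>\<star> = k"
    and hk: "h \<otimes> k = k \<otimes> h" and r: "0 \<le> r" "\<parallel>h \<otimes> h \<oplus> k \<otimes> k\<parallel> \<le> r\<^sup>2"
  shows "\<parallel>k\<parallel> \<le> r"
proof -
  define u where "u = h \<oplus> \<i> \<odot> k"
  have [simp]: "u \<in> carrier A" by (simp add: u_def)
  have us: "u\<^sup>\<star> = h \<ominus> \<i> \<odot> k"
    by (simp add: u_def star_add star_smult assms neg_smult a_minus_def)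
  have c: "h \<in> carrier A" "\<i> \<odot> k \<in> carrier A" by auto
  have "u\<^sup>\<star> \<otimes> u = h \<otimes> h \<oplus> (h \<otimes> (\<i> \<odot> k) \<ominus> (\<i> \<odot> k) \<otimes> h) \<ominus> (\<i> \<odot> k) \<otimes> (\<i> \<odot> k)"
    unfolding us unfolding u_def using c by algebra
  also have "\<dots> = h \<otimes> h \<oplus> k \<otimes> k"
    by (simp add: smult_mult_left smult_mult_right hk smult_smult a_minus_def r_neg neg_smult)
  finally have "\<parallel>u\<parallel>\<^sup>2 \<le> r\<^sup>2" using r cstar_identity[of u] by simp
  then have "\<parallel>u\<parallel> \<le> r" using r(1) by (rule power2_le_imp_le)
  have "u \<ominus> u\<^sup>\<star> = \<i> \<odot> k \<oplus> \<i> \<odot> k" unfolding us unfolding u_def using c by algebra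
  also have "\<dots> = (2 * \<i>) \<odot> k" by (simp flip: smult_add_left)
  finally have "2 * \<parallel>k\<parallel> = \<parallel>u \<ominus> u\<^sup>\<star>\<parallel>" by (simp add: norm_smult Real_Vector_Spaces.norm_mult)
  also have "\<dots> \<le> 2 * r" using norm_diff_le[of u "u\<^sup>\<star>"] \<open>\<parallel>u\<parallel> \<le> r\<close> by simp
  finally show ?thesis by simp
qed

lemma norm_self_adjoint_square:
  "\<lbrakk>h \<in> carrier A; h\<^sup>\<star> = h\<rbrakk> \<Longrightarrow> \<parallel>h \<otimes> h\<parallel> = \<parallel>h\<parallel>\<^sup>2"
  using cstar_identity[of h] by simp

text \<open>The iteration applied to \<open>h\<^sup>2\<close> writes \<open>1 - h\<^sup>2\<close> as
  the square of k = 1 - w, where k commutes with \<open>h\<close>. Then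
  \<open>h\<^sup>2 + k\<^sup>2 = 1\<close>, and the preceding lemma bounds k.\<close>

lemma norm_one_minus_square_le:
  assumes [simp]: "h \<in> carrier A" and sh: "h\<^sup>\<star> = h" and n: "\<parallel>h\<parallel> \<le> 1"
  shows "\<parallel>\<one> \<ominus> h \<otimes> h\<parallel> \<le> 1"
proof -
  have nx: "\<parallel>h \<otimes> h\<parallel> \<le> 1"
    using n norm_nonneg[of h] by (simp add: norm_self_adjoint_square sh power_le_one)
  obtain w where w [simp]: "w \<in> carrier A" and sw: "w\<^sup>\<star> = w"
      and ww: "w \<oplus> w = h \<otimes> h \<oplus> w \<otimes> w"
      and comm: "\<And>z. z \<in> carrier A \<Longrightarrow> z \<otimes> (h \<otimes> h) = h \<otimes> h \<otimes> z \<Longrightarrow> z \<otimes> w = w \<otimes> z"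
    using one_minus_sqrt[OF _ _ nx] by (metis assms(1) m_closed sh star_mult)
  let ?k = "\<one> \<ominus> w"
  have hw: "h \<otimes> w = w \<otimes> h" by (rule comm) (simp_all add: m_assoc)
  have c: "w \<in> carrier A" "h \<otimes> h \<in> carrier A" "h \<in> carrier A" "w \<otimes> w \<in> carrier A" by auto
  have "?k \<otimes> ?k = \<one> \<ominus> (w \<oplus> w) \<oplus> w \<otimes> w" using c(1) by algebra
  also have "\<dots> = \<one> \<ominus> h \<otimes> h" unfolding ww using c(2,4) by algebra
  finally have kk: "?k \<otimes> ?k = \<one> \<ominus> h \<otimes> h" .
  have "h \<otimes> ?k = ?k \<otimes> h" by (simp add: a_minus_def l_distr r_distr l_minus r_minus hw)
  moreover have "h \<otimes> h \<oplus> ?k \<otimes> ?k = \<one>" unfolding kk using c(2) by algebra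
  ultimately have "\<parallel>?k\<parallel> \<le> 1"
    using norm_le_of_square_sum[of h ?k 1] norm_one_le by (simp add: sh star_diff sw)
  then show ?thesis
    using norm_self_adjoint_square[of ?k] norm_nonneg[of ?k]
    by (simp add: star_diff sw kk power_le_one)
qed

lemma norm_scal_minus_square_le:
  assumes [simp]: "h \<in> carrier A" and sh: "h\<^sup>\<star> = h" and t: "\<parallel>h\<parallel>\<^sup>2 \<le> t"
  shows "\<parallel>scal t \<ominus> h \<otimes> h\<parallel> \<le> t"
proof (cases "t = 0")
  case True
  then have "h = \<zero>" using t by (simp add: norm_eq_zero)
  then show ?thesis using True by (simp add: a_minus_def)
next
  case False
  with t have t0: "0 < t" by (meson dual_order.strict_iff_order order_trans zero_le_power2)
  define g where "g = of_real (1 / sqrt t) \<odot> h"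
  have [simp]: "g \<in> carrier A" and sg: "g\<^sup>\<star> = g"
    by (simp_all add: g_def star_smult sh)
  have "\<parallel>h\<parallel> \<le> sqrt t" using t by (simp add: real_le_rsqrt)
  then have "\<parallel>g\<parallel> \<le> 1" using t0 by (simp add: g_def norm_smult norm_divide)
  from norm_one_minus_square_le[OF _ sg this] have "\<parallel>\<one> \<ominus> g \<otimes> g\<parallel> \<le> 1" by simp
  moreover have "scal t \<ominus> h \<otimes> h = of_real t \<odot> (\<one> \<ominus> g \<otimes> g)"
    using t0 by (simp add: g_def smult_diff_right smult_mult_left smult_mult_right smult_smult
      scal_def flip: of_real_mult)
  ultimately show ?thesis using t0 by (simp add: norm_smult)
qed

lemma pos_square: "\<lbrakk>h \<in> carrier A; h\<^sup>\<star> = h\<rbrakk> \<Longrightarrow> pos (h \<otimes> h)"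
  using norm_scal_minus_square_le[of h "\<parallel>h\<parallel>\<^sup>2"] by (auto simp: pos_def star_mult intro!: exI[of _ "\<parallel>h\<parallel>\<^sup>2"])

text \<open>Frees positivity from the unspecified bound in its definition: every bound of the norm
  will do, because \<open>a\<close> is the square of a self-adjoint element.\<close>

lemma pos_norm: assumes "pos a" "\<parallel>a\<parallel> \<le> t" shows "\<parallel>scal t \<ominus> a\<parallel> \<le> t"
proof -
  obtain h where "pos h" "h \<otimes> h = a" using pos_sqrt[OF assms(1)] by metis
  then show ?thesis
    using norm_scal_minus_square_le[of h t] norm_self_adjoint_square[of h] assms
    by (auto simp: pos_star)
qed

lemma pos_add: assumes "pos a" "pos b" shows "pos (a \<oplus> b)"
proof -
  obtain s t where st: "0 \<le> s" "\<parallel>scal s \<ominus> a\<parallel> \<le> s" "0 \<le> t" "\<parallel>scal t \<ominus> b\<parallel> \<le> t"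
    using assms by (auto simp: pos_def)
  have c: "a \<in> carrier A" "b \<in> carrier A" "scal s \<in> carrier A" "scal t \<in> carrier A"
    using assms by auto
  have "scal (s + t) \<ominus> (a \<oplus> b) = (scal s \<ominus> a) \<oplus> (scal t \<ominus> b)"
    unfolding scal_add using c by algebra
  then have "\<parallel>scal (s + t) \<ominus> (a \<oplus> b)\<parallel> \<le> s + t"
    using st norm_triangle[of "scal s \<ominus> a" "scal t \<ominus> b"] c by simp
  then show ?thesis
    using assms st by (auto simp: pos_def star_add intro!: exI[of _ "s + t"])
qed

lemma pos_smult: assumes "pos a" "0 \<le> r" shows "pos (of_real r \<odot> a)"
proof -
  obtain t where t: "0 \<le> t" "\<parallel>scal t \<ominus> a\<parallel> \<le> t" using assms by (auto simp: pos_def)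
  have "scal (r * t) \<ominus> of_real r \<odot> a = of_real r \<odot> (scal t \<ominus> a)"
    using assms by (simp add: smult_diff_right pos_carrier smult_scal)
  then have "\<parallel>scal (r * t) \<ominus> of_real r \<odot> a\<parallel> \<le> r * t"
    using assms t by (simp add: norm_smult pos_carrier mult_left_mono)
  then show ?thesis
    using assms t by (auto simp: pos_def star_smult intro!: exI[of _ "r * t"])
qed

lemma pos_zero [simp]: "pos \<zero>"
  using pos_square[of \<zero>] by simp

lemma pos_scal_diff: "\<lbrakk>a \<in> carrier A; a\<^sup>\<star> = a; \<parallel>a\<parallel> \<le> t\<rbrakk> \<Longrightarrow> pos (scal t \<ominus> a)"
proof -
  assume a: "a \<in> carrier A" "a\<^sup>\<star> = a" "\<parallel>a\<parallel> \<le> t"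
  have "scal t \<ominus> (scal t \<ominus> a) = a" using a(1) scal_carrier[of t] by algebra
  then show ?thesis
    using a norm_nonneg[of a] by (auto simp: pos_def star_diff intro!: exI[of _ t])
qed

text \<open>By \<open>pos_norm\<close> the single bound ||a|| + 1 serves all positive elements
  within distance 1 of \<open>a\<close>, so the defining inequality survives the limit.\<close>

lemma pos_closed:
  assumes [simp]: "a \<in> carrier A" and lim: "\<And>\<epsilon>. 0 < \<epsilon> \<Longrightarrow> \<exists>p. pos p \<and> \<parallel>a \<ominus> p\<parallel> \<le> \<epsilon>"
  shows "pos a"
proof -
  have "a\<^sup>\<star> = a"
  proof (rule eq_of_norm_le)
    fix e :: real assume "0 < e"
    then obtain p where p: "pos p" "\<parallel>a \<ominus> p\<parallel> \<le> e" using lim by blast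
    then have "\<parallel>a\<^sup>\<star> \<ominus> p\<parallel> = \<parallel>a \<ominus> p\<parallel>"
      by (metis assms(1) minus_closed norm_star pos_carrier pos_star star_diff)
    then show "\<parallel>a\<^sup>\<star> \<ominus> a\<parallel> \<le> 2 * e"
      using p norm_diff_triangle[of "a\<^sup>\<star>" p a] norm_diff_commute[of a p] by (simp add: pos_carrier)
  qed auto
  moreover have "\<parallel>scal (\<parallel>a\<parallel> + 1) \<ominus> a\<parallel> \<le> \<parallel>a\<parallel> + 1"
  proof (rule field_le_epsilon)
    fix e :: real assume "0 < e"
    then obtain p where p: "pos p" "\<parallel>a \<ominus> p\<parallel> \<le> min 1 e" using lim[of "min 1 e"] by auto
    then have [simp]: "p \<in> carrier A" by blast
    have "\<parallel>p\<parallel> \<le> \<parallel>a\<parallel> + 1" using p norm_le_diff[of p a] norm_diff_commute[of a p] by simp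
    then show "\<parallel>scal (\<parallel>a\<parallel> + 1) \<ominus> a\<parallel> \<le> \<parallel>a\<parallel> + 1 + e"
      using pos_norm[OF p(1)] norm_diff_triangle[of "scal (\<parallel>a\<parallel> + 1)" p a] p(2)
        norm_diff_commute[of a p] by force
  qed
  ultimately show ?thesis
    using norm_nonneg[of a] by (auto simp: pos_def intro!: exI[of _ "\<parallel>a\<parallel> + 1"])
qed

text \<open>The roots h of \<open>a\<close> and k of r - a commute and satisfy
  \<open>h\<^sup>2 + k\<^sup>2 = r\<close>, so \<open>norm_le_of_square_sum\<close> bounds h by the
  root of \<open>r\<close>.\<close>

lemma norm_le_of_pos:
  assumes "pos a" "pos (scal r \<ominus> a)" "0 \<le> r" shows "\<parallel>a\<parallel> \<le> r"
proof -
  obtain h where h: "pos h" "h \<otimes> h = a" using pos_sqrt[OF assms(1)] by metis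
  obtain k where k: "pos k" "k \<otimes> k = scal r \<ominus> a"
    and comm: "\<And>z. z \<in> carrier A \<Longrightarrow> z \<otimes> (scal r \<ominus> a) = (scal r \<ominus> a) \<otimes> z \<Longrightarrow> z \<otimes> k = k \<otimes> z"
    using pos_sqrt[OF assms(2)] by metis
  have [simp]: "h \<in> carrier A" "k \<in> carrier A" "a \<in> carrier A" using h k assms by auto
  have "h \<otimes> (scal r \<ominus> a) = (scal r \<ominus> a) \<otimes> h"
    by (simp add: a_minus_def l_distr r_distr l_minus r_minus scal_mult mult_scal m_assoc
        flip: h(2))
  then have "h \<otimes> k = k \<otimes> h" using comm by simp
  moreover have "k \<otimes> k \<oplus> h \<otimes> h = scal r"
    unfolding h k using scal_carrier[of r] \<open>a \<in> carrier A\<close> by algebra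
  ultimately have "\<parallel>h\<parallel> \<le> sqrt r"
    using norm_le_of_square_sum[of k h "sqrt r"] h k assms norm_scal_le[of r] by (simp add: pos_star)
  then have "\<parallel>h\<parallel>\<^sup>2 \<le> r"
    using norm_nonneg[of h] assms(3) by (metis power_mono real_sqrt_pow2 \<open>h \<in> carrier A\<close>)
  then show ?thesis using norm_self_adjoint_square[of h] h by (simp add: pos_star)
qed

text \<open>In the order of self-adjoint elements, \<open>a\<close> lies below \<open>b\<close>, and
  \<open>b\<close> below its norm times the unit.\<close>

lemma pos_norm_mono:
  assumes "pos a" "pos (b \<ominus> a)" "b \<in> carrier A" shows "\<parallel>a\<parallel> \<le> \<parallel>b\<parallel>"
proof (rule norm_le_of_pos[OF assms(1)])
  have c: "a \<in> carrier A" "b \<in> carrier A" "scal \<parallel>b\<parallel> \<in> carrier A" using assms by auto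
  have e: "a \<oplus> (b \<ominus> a) = b" using c(1,2) by algebra
  have "b\<^sup>\<star> = b" using pos_star[OF pos_add[OF assms(1,2)]] unfolding e .
  then have "pos (scal \<parallel>b\<parallel> \<ominus> b)" using c by (intro pos_scal_diff) auto
  from pos_add[OF this assms(2)] have "pos ((scal \<parallel>b\<parallel> \<ominus> b) \<oplus> (b \<ominus> a))" .
  then show "pos (scal \<parallel>b\<parallel> \<ominus> a)" using c by (simp add: diff_diff_add)
qed (simp add: assms norm_nonneg)

lemma pos_antisym: "\<lbrakk>pos a; pos (\<ominus> a)\<rbrakk> \<Longrightarrow> a = \<zero>"
  using norm_le_of_pos[of a 0] norm_nonneg[of a]
  by (simp add: a_minus_def pos_carrier norm_eq_zero)

text \<open>The square roots h and k of the factors commute, hence hk is self-adjoint and its square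
  is the product.\<close>

lemma pos_mult_of_commute:
  assumes "pos a" "pos b" "a \<otimes> b = b \<otimes> a" shows "pos (a \<otimes> b)"
proof -
  obtain h where h: "pos h" "h \<otimes> h = a"
    and ch: "\<And>z. z \<in> carrier A \<Longrightarrow> z \<otimes> a = a \<otimes> z \<Longrightarrow> z \<otimes> h = h \<otimes> z"
    using pos_sqrt[OF assms(1)] by metis
  obtain k where k: "pos k" "k \<otimes> k = b"
    and ck: "\<And>z. z \<in> carrier A \<Longrightarrow> z \<otimes> b = b \<otimes> z \<Longrightarrow> z \<otimes> k = k \<otimes> z"
    using pos_sqrt[OF assms(2)] by metis
  have [simp]: "h \<in> carrier A" "k \<in> carrier A" "a \<in> carrier A" "b \<in> carrier A"
    using h k assms by auto
  have hk: "h \<otimes> k = k \<otimes> h" using ck[of h] ch[of b] assms(3) by simp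
  have "(h \<otimes> k) \<otimes> (h \<otimes> k) = a \<otimes> b"
    unfolding h(2)[symmetric] k(2)[symmetric] using hk
    by (metis \<open>h \<in> carrier A\<close> \<open>k \<in> carrier A\<close> m_assoc m_closed)
  moreover have "pos ((h \<otimes> k) \<otimes> (h \<otimes> k))"
    by (rule pos_square) (use h k hk in \<open>auto simp: star_mult pos_star\<close>)
  ultimately show ?thesis by simp
qed

text \<open>The contradiction for \<open>\<parallel>y\<parallel> = 1\<close>: with \<open>a = y y*\<close> one has
  \<open>(1 + a) y = y (1 - g\<^sup>2)\<close>, so \<open>\<parallel>a + a\<^sup>2\<parallel> \<le> 1\<close>, whence \<open>2 a\<^sup>2 \<le> a + a\<^sup>2 \<le> 1\<close>
  although \<open>\<parallel>a\<^sup>2\<parallel> = 1\<close>.\<close>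

lemma eq_zero_of_star_mult_neg:
  assumes y [simp]: "y \<in> carrier A" and [simp]: "g \<in> carrier A" and sg: "g\<^sup>\<star> = g"
    and yg: "y\<^sup>\<star> \<otimes> y = \<ominus> (g \<otimes> g)"
  shows "y = \<zero>"
proof -
  have unit: "\<parallel>y\<parallel> \<noteq> 1"
    if [simp]: "y \<in> carrier A" "g \<in> carrier A" and sg: "g\<^sup>\<star> = g" and yg: "y\<^sup>\<star> \<otimes> y = \<ominus> (g \<otimes> g)"
    for y g
  proof
    assume y1: "\<parallel>y\<parallel> = 1"
    define a where "a = y \<otimes> y\<^sup>\<star>"
    have a [simp]: "a \<in> carrier A" and sa: "a\<^sup>\<star> = a" by (simp_all add: a_def star_mult)
    have na: "\<parallel>a\<parallel> = 1" using cstar_identity[of "y\<^sup>\<star>"] y1 by (simp add: a_def)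
    have ng: "\<parallel>g\<parallel>\<^sup>2 = 1"
      using cstar_identity[of y] y1 norm_self_adjoint_square[of g] sg yg by simp
    have c: "y \<in> carrier A" "y\<^sup>\<star> \<in> carrier A" "g \<in> carrier A" "a \<in> carrier A"
      "g \<otimes> g \<in> carrier A" "a \<otimes> a \<in> carrier A" by auto
    have "pos a"
    proof -
      \<comment> \<open>Up to factors 2 and -2 these are the real and the imaginary part of
        \<open>y\<close>. The sum of their squares is 2(y y* + y* y), so 2a is a sum of squares once
        \<open>y* y\<close> is replaced by \<open>- g\<^sup>2\<close>.\<close>
      let ?p = "y \<oplus> y\<^sup>\<star>" and ?q = "\<i> \<odot> (y \<ominus> y\<^sup>\<star>)"
      have qq: "?q \<otimes> ?q = \<ominus> ((y \<ominus> y\<^sup>\<star>) \<otimes> (y \<ominus> y\<^sup>\<star>))"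
        by (simp add: smult_mult_left smult_mult_right smult_smult neg_smult)
      have "?q\<^sup>\<star> = \<ominus> (\<i> \<odot> (y\<^sup>\<star> \<ominus> y))" by (simp add: star_smult star_diff neg_smult)
      also have "\<dots> = ?q" using a_inv_diff[of "y\<^sup>\<star>" y] by (simp flip: a_inv_smult)
      finally have sq: "?q\<^sup>\<star> = ?q" .
      have sp: "?p\<^sup>\<star> = ?p" by (simp add: star_add a_comm)
      have "?p \<otimes> ?p \<oplus> ?q \<otimes> ?q = (a \<oplus> a) \<oplus> (y\<^sup>\<star> \<otimes> y \<oplus> y\<^sup>\<star> \<otimes> y)"
        unfolding qq a_def using c(1,2) by algebra
      then have "?p \<otimes> ?p \<oplus> ?q \<otimes> ?q \<oplus> (g \<otimes> g \<oplus> g \<otimes> g) = a \<oplus> a"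
        unfolding yg using c(4,5) by algebra
      moreover have "pos (?p \<otimes> ?p \<oplus> ?q \<otimes> ?q \<oplus> (g \<otimes> g \<oplus> g \<otimes> g))"
        by (intro pos_add pos_square sp sq sg) auto
      ultimately have "pos (a \<oplus> a)" by simp
      then have "pos (of_real (1/2) \<odot> (a \<oplus> a))" by (rule pos_smult) simp
      moreover have "of_real (1/2) \<odot> (a \<oplus> a) = a"
        using smult_add_left[of a "1/2" "1/2"] by (simp add: smult_add_right)
      ultimately show ?thesis by simp
    qed
    have "(\<one> \<oplus> a) \<otimes> y = y \<oplus> y \<otimes> (y\<^sup>\<star> \<otimes> y)" unfolding a_def using c(1,2) by algebra
    also have "\<dots> = y \<otimes> (\<one> \<ominus> g \<otimes> g)" unfolding yg using c(1,5) by algebra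
    finally have "\<parallel>(\<one> \<oplus> a) \<otimes> y\<parallel> \<le> \<parallel>y\<parallel> * \<parallel>\<one> \<ominus> g \<otimes> g\<parallel>" using norm_mult by simp
    also have "\<dots> \<le> 1"
      using norm_scal_minus_square_le[of g 1] ng y1 sg by simp
    finally have "\<parallel>(\<one> \<oplus> a) \<otimes> y\<parallel> \<le> 1" .
    moreover have "a \<oplus> a \<otimes> a = (\<one> \<oplus> a) \<otimes> y \<otimes> y\<^sup>\<star>" unfolding a_def using c(1,2) by algebra
    ultimately have "\<parallel>a \<oplus> a \<otimes> a\<parallel> \<le> 1"
      using norm_mult[of "(\<one> \<oplus> a) \<otimes> y" "y\<^sup>\<star>"] y1 by simp
    then have 1: "pos (\<one> \<ominus> (a \<oplus> a \<otimes> a))"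
      using pos_scal_diff[of "a \<oplus> a \<otimes> a" 1] by (simp add: star_add star_mult sa)
    have "pos (\<one> \<ominus> a)" using pos_scal_diff[of a 1] sa na by simp
    then have 2: "pos (a \<otimes> (\<one> \<ominus> a))"
      by (intro pos_mult_of_commute \<open>pos a\<close>)
        (simp_all add: a_minus_def l_distr r_distr l_minus r_minus)
    have "(\<one> \<ominus> (a \<oplus> a \<otimes> a)) \<oplus> a \<otimes> (\<one> \<ominus> a) = \<one> \<ominus> (a \<otimes> a \<oplus> a \<otimes> a)"
      using c(4) by algebra
    then have "pos (of_real (1/2) \<odot> (\<one> \<ominus> (a \<otimes> a \<oplus> a \<otimes> a)))"
      using pos_add[OF 1 2] by (intro pos_smult) auto
    moreover have "of_real (1/2) \<odot> (\<one> \<ominus> (a \<otimes> a \<oplus> a \<otimes> a)) = scal (1/2) \<ominus> a \<otimes> a"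
      using smult_add_left[of "a \<otimes> a" "1/2" "1/2"]
      by (simp add: smult_diff_right smult_add_right scal_def)
    ultimately have "\<parallel>a \<otimes> a\<parallel> \<le> 1/2"
      using pos_square[OF a sa] by (intro norm_le_of_pos) auto
    then show False using norm_self_adjoint_square[OF a sa] na by simp
  qed
  show ?thesis
  proof (rule ccontr)
    assume "y \<noteq> \<zero>"
    then have n: "0 < \<parallel>y\<parallel>" using norm_nonneg[OF y] norm_eq_zero[OF y] by linarith
    \<comment> \<open>Scaling \<open>y\<close> and \<open>g\<close> alike preserves the relation and
      reduces to the excluded case of norm 1.\<close>
    let ?c = "of_real (1 / \<parallel>y\<parallel>) :: complex"
    have "(?c \<odot> y)\<^sup>\<star> \<otimes> (?c \<odot> y) = \<ominus> ((?c \<odot> g) \<otimes> (?c \<odot> g))"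
      by (simp add: star_smult smult_mult_left smult_mult_right smult_smult yg a_inv_smult)
    then have "\<parallel>?c \<odot> y\<parallel> \<noteq> 1" by (intro unit) (auto simp: star_smult sg)
    then show False using n by (simp add: norm_smult norm_divide)
  qed
qed

text \<open>The element \<open>d\<close> is \<open>\<bar>c\<bar> - c\<close> and \<open>r = \<bar>c\<bar>\<^sup>1\<^sup>/\<^sup>2 d\<close>.\<close>

lemma self_adjoint_pos_criterion:
  assumes [simp]: "c \<in> carrier A" and sc: "c\<^sup>\<star> = c"
  obtains d r where "d \<in> carrier A" "d\<^sup>\<star> = d" "r \<in> carrier A" "r\<^sup>\<star> = r"
    "d \<otimes> c \<otimes> d = \<ominus> (r \<otimes> r)" "r = \<zero> \<Longrightarrow> pos c"
proof -
  obtain m where m: "pos m" "m \<otimes> m = c \<otimes> c"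
    and cm: "\<And>z. z \<in> carrier A \<Longrightarrow> z \<otimes> (c \<otimes> c) = c \<otimes> c \<otimes> z \<Longrightarrow> z \<otimes> m = m \<otimes> z"
    using pos_sqrt[OF pos_square[OF assms]] by metis
  obtain s where s: "pos s" "s \<otimes> s = m"
    and cs: "\<And>z. z \<in> carrier A \<Longrightarrow> z \<otimes> m = m \<otimes> z \<Longrightarrow> z \<otimes> s = s \<otimes> z"
    using pos_sqrt[OF m(1)] by metis
  have [simp]: "m \<in> carrier A" "s \<in> carrier A" using m s by auto
  have c1: "c \<otimes> m = m \<otimes> c" by (rule cm) (simp_all add: m_assoc)
  have c2: "c \<otimes> s = s \<otimes> c" by (rule cs) (simp_all add: c1)
  have c3: "m \<otimes> s = s \<otimes> m" by (rule cs) simp_all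
  define d where "d = m \<ominus> c"
  have d [simp]: "d \<in> carrier A" and sd: "d\<^sup>\<star> = d"
    by (simp_all add: d_def star_diff sc pos_star[OF m(1)])
  have ds: "d \<otimes> s = s \<otimes> d" by (simp add: d_def a_minus_def l_distr r_distr l_minus r_minus c2 c3)
  \<comment> \<open>With m = |c|, multiplying c by |c| - c gives \<open>c |c| - |c|\<^sup>2\<close>:
    on the range of \<open>d\<close>, which is twice the negative part, c acts as -|c|.\<close>
  have cd: "c \<otimes> d = \<ominus> (m \<otimes> d)"
    by (simp add: d_def a_minus_def l_distr r_distr l_minus r_minus c1 m(2) minus_add)
       (simp add: a_comm)
  have "d \<otimes> c \<otimes> d = \<ominus> (d \<otimes> (s \<otimes> s) \<otimes> d)"
    by (simp add: m_assoc cd r_minus s(2))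
  also have "d \<otimes> (s \<otimes> s) \<otimes> d = (s \<otimes> d) \<otimes> (s \<otimes> d)"
    using ds by (metis \<open>s \<in> carrier A\<close> d m_assoc m_closed)
  finally have "d \<otimes> c \<otimes> d = \<ominus> ((s \<otimes> d) \<otimes> (s \<otimes> d))" .
  moreover have "(s \<otimes> d)\<^sup>\<star> = s \<otimes> d" by (simp add: star_mult sd pos_star[OF s(1)] ds)
  \<comment> \<open>If sd = 0 then md = 0 and cd = 0, hence \<open>d\<^sup>2 = 0\<close> and c =
    |c|.\<close>
  moreover have "pos c" if "s \<otimes> d = \<zero>"
  proof -
    have md: "m \<otimes> d = \<zero>" using that by (simp add: m_assoc flip: s(2))
    then have "d \<otimes> d = \<zero>"
      using cd by (subst d_def) (simp add: a_minus_def l_distr l_minus)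
    then have "d = \<zero>" using norm_self_adjoint_square[OF d sd] by (simp add: norm_eq_zero)
    then show ?thesis using m(1) diff_eq_zero[of m c] by (simp add: d_def)
  qed
  ultimately show ?thesis using that[OF d sd, of "s \<otimes> d"] by simp
qed

text \<open>The criterion for \<open>x* x\<close> yields \<open>d\<close> with (xd)* xd =
  \<open>- r\<^sup>2\<close>. By \<open>eq_zero_of_star_mult_neg\<close> this forces xd = 0, so r =
  0 and the criterion concludes.\<close>

lemma pos_star_mult: assumes [simp]: "x \<in> carrier A" shows "pos (x\<^sup>\<star> \<otimes> x)"
proof -
  have c: "x\<^sup>\<star> \<otimes> x \<in> carrier A" and sc: "(x\<^sup>\<star> \<otimes> x)\<^sup>\<star> = x\<^sup>\<star> \<otimes> x"
    by (simp_all add: star_mult)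
  obtain d r where d [simp]: "d \<in> carrier A" and sd: "d\<^sup>\<star> = d"
    and r [simp]: "r \<in> carrier A" and sr: "r\<^sup>\<star> = r"
    and e: "d \<otimes> (x\<^sup>\<star> \<otimes> x) \<otimes> d = \<ominus> (r \<otimes> r)" and r0: "r = \<zero> \<Longrightarrow> pos (x\<^sup>\<star> \<otimes> x)"
    by (rule self_adjoint_pos_criterion[OF c sc]) (rule that)
  have yy: "(x \<otimes> d)\<^sup>\<star> \<otimes> (x \<otimes> d) = \<ominus> (r \<otimes> r)"
    using e by (simp add: star_mult sd m_assoc)
  then have "x \<otimes> d = \<zero>" by (intro eq_zero_of_star_mult_neg[OF _ r sr]) auto
  with yy have "\<ominus> (r \<otimes> r) = \<zero>" by simp
  then have "r \<otimes> r = \<zero>" by (metis m_closed minus_minus minus_zero r)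
  then have "r = \<zero>" using norm_self_adjoint_square[OF r sr] by (simp add: norm_eq_zero)
  then show ?thesis by (rule r0)
qed

lemma pos_conj: assumes "pos a" and [simp]: "b \<in> carrier A" shows "pos (b\<^sup>\<star> \<otimes> a \<otimes> b)"
proof -
  obtain h where h: "pos h" "h \<otimes> h = a" using pos_sqrt[OF assms(1)] by metis
  then have [simp]: "h \<in> carrier A" by auto
  have "pos ((h \<otimes> b)\<^sup>\<star> \<otimes> (h \<otimes> b))" by (rule pos_star_mult) simp
  then show ?thesis using h by (simp add: star_mult pos_star m_assoc flip: h(2))
qed

end

section \<open>Hilbert modules and adjointable operators\<close>

text \<open>The operations are specified only through their effect on \<open>ip\<close>. This admits
  formal sums as vectors, with concatenation of lists as addition; the form may be
  degenerate.\<close>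

locale semi_hilbert = cstar_algebra B
  for B :: "('b, 'm) cstar_scheme" (structure) +
  fixes M :: "'x set" and padd :: "'x \<Rightarrow> 'x \<Rightarrow> 'x" and pzero :: 'x
    and act :: "'x \<Rightarrow> 'b \<Rightarrow> 'x" and ip :: "'x \<Rightarrow> 'x \<Rightarrow> 'b"
  assumes padd_closed [simp, intro]: "\<lbrakk>x \<in> M; y \<in> M\<rbrakk> \<Longrightarrow> padd x y \<in> M"
    and pzero_closed [simp, intro]: "pzero \<in> M"
    and act_closed [simp, intro]: "\<lbrakk>x \<in> M; b \<in> carrier B\<rbrakk> \<Longrightarrow> act x b \<in> M"
    and ip_closed [simp, intro]: "\<lbrakk>x \<in> M; y \<in> M\<rbrakk> \<Longrightarrow> ip x y \<in> carrier B"
    and ip_add: "\<lbrakk>x \<in> M; y \<in> M; z \<in> M\<rbrakk> \<Longrightarrow> ip x (padd y z) = ip x y \<oplus> ip x z"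
    and ip_zero: "x \<in> M \<Longrightarrow> ip x pzero = \<zero>"
    and ip_act: "\<lbrakk>x \<in> M; y \<in> M; b \<in> carrier B\<rbrakk> \<Longrightarrow> ip x (act y b) = ip x y \<otimes> b"
    and ip_star: "\<lbrakk>x \<in> M; y \<in> M\<rbrakk> \<Longrightarrow> (ip x y)\<^sup>\<star> = ip y x"
    and ip_pos: "x \<in> M \<Longrightarrow> pos (ip x x)"
begin

lemma ip_add_left: "\<lbrakk>x \<in> M; y \<in> M; z \<in> M\<rbrakk> \<Longrightarrow> ip (padd x y) z = ip x z \<oplus> ip y z"
  using arg_cong[OF ip_add[of z x y], of "\<lambda>b. b\<^sup>\<star>"] by (simp add: ip_star star_add)

lemma ip_zero_left: "x \<in> M \<Longrightarrow> ip pzero x = \<zero>"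
  using arg_cong[OF ip_zero[of x], of "\<lambda>b. b\<^sup>\<star>"] by (simp add: ip_star)

lemma ip_act_left: "\<lbrakk>x \<in> M; y \<in> M; b \<in> carrier B\<rbrakk> \<Longrightarrow> ip (act x b) y = b\<^sup>\<star> \<otimes> ip x y"
  using arg_cong[OF ip_act[of y x b], of "\<lambda>b. b\<^sup>\<star>"] by (simp add: ip_star star_mult)

definition pdiff :: "'x \<Rightarrow> 'x \<Rightarrow> 'x" where
  "pdiff x y = padd x (act y (\<ominus> \<one>))"

lemma pdiff_closed [simp, intro]: "\<lbrakk>x \<in> M; y \<in> M\<rbrakk> \<Longrightarrow> pdiff x y \<in> M"
  by (simp add: pdiff_def)

lemma ip_diff: "\<lbrakk>x \<in> M; y \<in> M; z \<in> M\<rbrakk> \<Longrightarrow> ip z (pdiff x y) = ip z x \<ominus> ip z y"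
  by (simp add: pdiff_def ip_add ip_act r_minus a_minus_def)

lemma ip_diff_left: "\<lbrakk>x \<in> M; y \<in> M; z \<in> M\<rbrakk> \<Longrightarrow> ip (pdiff x y) z = ip x z \<ominus> ip y z"
  using arg_cong[OF ip_diff[of x y z], of "\<lambda>b. b\<^sup>\<star>"] by (simp add: ip_star star_diff)

section \<open>The seminorm of a semi-inner-product module and the Cauchy-Schwarz inequality\<close>

definition nrm :: "'x \<Rightarrow> real" where
  "nrm x = sqrt \<parallel>ip x x\<parallel>"

lemma nrm_nonneg [simp]: "x \<in> M \<Longrightarrow> 0 \<le> nrm x"
  by (simp add: nrm_def norm_nonneg)

lemma nrm_square: "x \<in> M \<Longrightarrow> (nrm x)\<^sup>2 = \<parallel>ip x x\<parallel>"
  by (simp add: nrm_def norm_nonneg)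

lemma nrm_zero [simp]: "nrm pzero = 0"
  by (simp add: nrm_def ip_zero)

text \<open>Cauchy-Schwarz. With c = <x, y>, positivity of <z, z> for z = xc - ty reads R - 2P + Q
  >= 0, and <x, x> <= t gives R <= P after conjugation by c. Adding the two leaves P <= Q, that is,
  t c* c <= \<open>t\<^sup>2\<close> <y, y>.\<close>

lemma norm_ip_square_le:
  assumes [simp]: "x \<in> M" "y \<in> M" and t: "0 < t" "\<parallel>ip x x\<parallel> \<le> t"
  shows "\<parallel>ip x y\<parallel>\<^sup>2 \<le> t * \<parallel>ip y y\<parallel>"
proof -
  define c where "c = ip x y"
  have [simp]: "c \<in> carrier B" and yx: "ip y x = c\<^sup>\<star>" by (simp_all add: c_def ip_star)
  let ?z = "padd (act x c) (act y (scal (- t)))"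
  define P where "P = of_real t \<odot> (c\<^sup>\<star> \<otimes> c)"
  define Q where "Q = of_real t \<odot> (of_real t \<odot> ip y y)"
  define R where "R = c\<^sup>\<star> \<otimes> ip x x \<otimes> c"
  have c: "P \<in> carrier B" "Q \<in> carrier B" "R \<in> carrier B" by (simp_all add: P_def Q_def R_def)
  have "ip ?z ?z = R \<ominus> P \<ominus> P \<oplus> Q"
    using c by (simp add: ip_add ip_add_left ip_act ip_act_left mult_scal scal_mult l_distr r_distr
      yx m_assoc a_minus_def neg_smult smult_add_right smult_mult_left smult_mult_right r_minus
      l_minus a_inv_smult flip: c_def)
      (simp add: P_def Q_def R_def m_assoc a_assoc a_inv_smult smult_mult_left smult_mult_right)
  moreover have "pos (ip ?z ?z)" by (intro ip_pos) auto
  moreover have "pos (scal t \<ominus> ip x x)" using t by (intro pos_scal_diff) (auto simp: ip_star)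
  then have "pos (c\<^sup>\<star> \<otimes> (scal t \<ominus> ip x x) \<otimes> c)" by (rule pos_conj) simp
  moreover have "c\<^sup>\<star> \<otimes> (scal t \<ominus> ip x x) \<otimes> c = P \<ominus> R"
    by (simp add: P_def R_def a_minus_def l_distr r_distr l_minus r_minus scal_mult mult_scal
      smult_mult_left)
  ultimately have "pos ((R \<ominus> P \<ominus> P \<oplus> Q) \<oplus> (P \<ominus> R))" using pos_add by simp
  moreover have "(R \<ominus> P \<ominus> P \<oplus> Q) \<oplus> (P \<ominus> R) = Q \<ominus> P" using c by algebra
  ultimately have "pos (Q \<ominus> P)" by simp
  moreover have "pos P" using t unfolding P_def by (intro pos_smult pos_star_mult) auto
  ultimately have "\<parallel>P\<parallel> \<le> \<parallel>Q\<parallel>" using c by (intro pos_norm_mono)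
  then have "t * \<parallel>c\<parallel>\<^sup>2 \<le> t * (t * \<parallel>ip y y\<parallel>)"
    using t by (simp add: P_def Q_def norm_smult cstar_identity)
  then show ?thesis using t by (simp add: c_def)
qed

lemma norm_ip_le: assumes [simp]: "x \<in> M" "y \<in> M" shows "\<parallel>ip x y\<parallel> \<le> nrm x * nrm y"
proof (rule power2_le_imp_le)
  show "\<parallel>ip x y\<parallel>\<^sup>2 \<le> (nrm x * nrm y)\<^sup>2"
  proof (rule field_le_epsilon)
    fix e :: real assume e: "0 < e"
    let ?q = "\<parallel>ip y y\<parallel>"
    have q: "0 \<le> ?q" by (simp add: norm_nonneg)
    \<comment> \<open>The bound on <x, x> must be strictly positive even for a null vector
      \<open>x\<close>; the slack is chosen so that multiplying it by \<open>?q\<close> costs at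
      most \<open>e\<close>.\<close>
    have "\<parallel>ip x y\<parallel>\<^sup>2 \<le> (\<parallel>ip x x\<parallel> + e / (?q + 1)) * ?q"
      using e q norm_nonneg[of "ip x x"]
      by (intro norm_ip_square_le) (auto intro!: add_nonneg_pos divide_pos_pos)
    also have "\<dots> = \<parallel>ip x x\<parallel> * ?q + e * (?q / (?q + 1))" by (simp add: algebra_simps)
    also have "\<dots> \<le> \<parallel>ip x x\<parallel> * ?q + e * 1"
      using e q by (intro add_left_mono mult_left_mono) auto
    finally show "\<parallel>ip x y\<parallel>\<^sup>2 \<le> (nrm x * nrm y)\<^sup>2 + e" by (simp add: power_mult_distrib nrm_square)
  qed
qed simp

lemma nrm_triangle: assumes [simp]: "x \<in> M" "y \<in> M" shows "nrm (padd x y) \<le> nrm x + nrm y"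
proof (rule power2_le_imp_le)
  have "(nrm (padd x y))\<^sup>2 = \<parallel>(ip x x \<oplus> ip y x) \<oplus> (ip x y \<oplus> ip y y)\<parallel>"
    by (simp add: nrm_square ip_add ip_add_left)
  also have "\<dots> \<le> (\<parallel>ip x x\<parallel> + \<parallel>ip y x\<parallel>) + (\<parallel>ip x y\<parallel> + \<parallel>ip y y\<parallel>)"
    using norm_triangle[of "ip x x \<oplus> ip y x" "ip x y \<oplus> ip y y"]
      norm_triangle[of "ip x x" "ip y x"] norm_triangle[of "ip x y" "ip y y"] by simp
  also have "\<dots> \<le> ((nrm x)\<^sup>2 + nrm y * nrm x) + (nrm x * nrm y + (nrm y)\<^sup>2)"
    by (intro add_mono norm_ip_le) (simp_all add: nrm_square)
  finally show "(nrm (padd x y))\<^sup>2 \<le> (nrm x + nrm y)\<^sup>2" by (simp add: power2_eq_square algebra_simps)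
qed simp

lemma nrm_smult: assumes [simp]: "x \<in> M" shows "nrm (act x (c \<odot> \<one>)) = cmod c * nrm x"
proof -
  have "ip (act x (c \<odot> \<one>)) (act x (c \<odot> \<one>)) = (cnj c * c) \<odot> ip x x"
    by (simp add: ip_act ip_act_left star_smult smult_mult_left smult_mult_right smult_smult
        mult.commute)
  then show ?thesis
    by (simp add: nrm_def norm_smult Real_Vector_Spaces.norm_mult real_sqrt_mult)
qed

lemma nrm_cong: "\<lbrakk>ip x x = ip y y\<rbrakk> \<Longrightarrow> nrm x = nrm y"
  by (simp add: nrm_def)

lemma nrm_diff_commute: "\<lbrakk>x \<in> M; y \<in> M\<rbrakk> \<Longrightarrow> nrm (pdiff x y) = nrm (pdiff y x)"
proof (rule nrm_cong)
  assume [simp]: "x \<in> M" "y \<in> M"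
  have c: "ip x x \<in> carrier B" "ip x y \<in> carrier B" "ip y x \<in> carrier B" "ip y y \<in> carrier B" by auto
  show "ip (pdiff x y) (pdiff x y) = ip (pdiff y x) (pdiff y x)"
    by (simp add: ip_diff ip_diff_left) (use c in algebra)
qed

text \<open>Since the left-hand side is the square of \<open>nrm x\<close>, one factor cancels. Norm
  bounds below are obtained by testing a vector against itself.\<close>

lemma nrm_le_of_ip_le:
  assumes [simp]: "x \<in> M" and C: "\<parallel>ip x x\<parallel> \<le> C * nrm x" "0 \<le> C" shows "nrm x \<le> C"
proof (cases "nrm x = 0")
  case False
  then have "0 < nrm x" using nrm_nonneg[of x] by (simp del: nrm_nonneg)
  moreover have "nrm x * nrm x \<le> C * nrm x" using C nrm_square[of x] by (simp add: power2_eq_square)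
  ultimately show ?thesis by simp
qed (simp add: C)

lemma nrm_le_of_dist_ip:
  assumes [simp]: "x \<in> M" "y \<in> M" and C: "\<And>z. z \<in> M \<Longrightarrow> \<parallel>ip z x \<ominus> ip z y\<parallel> \<le> C * nrm z" "0 \<le> C"
  shows "nrm (pdiff x y) \<le> C"
  using C by (intro nrm_le_of_ip_le) (auto simp: ip_diff[of x y "pdiff x y"])

lemma nrm_diff_triangle:
  assumes [simp]: "x \<in> M" "y \<in> M" "z \<in> M"
  shows "nrm (pdiff x z) \<le> nrm (pdiff x y) + nrm (pdiff y z)"
proof (rule nrm_le_of_dist_ip)
  fix w assume [simp]: "w \<in> M"
  have "\<parallel>ip w x \<ominus> ip w z\<parallel> \<le> \<parallel>ip w x \<ominus> ip w y\<parallel> + \<parallel>ip w y \<ominus> ip w z\<parallel>"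
    by (intro norm_diff_triangle) auto
  also have "\<dots> = \<parallel>ip w (pdiff x y)\<parallel> + \<parallel>ip w (pdiff y z)\<parallel>" by (simp add: ip_diff)
  also have "\<dots> \<le> nrm w * nrm (pdiff x y) + nrm w * nrm (pdiff y z)"
    by (intro add_mono norm_ip_le) auto
  finally show "\<parallel>ip w x \<ominus> ip w z\<parallel> \<le> (nrm (pdiff x y) + nrm (pdiff y z)) * nrm w"
    by (simp add: algebra_simps)
qed auto

lemma nrm_le_diff: "\<lbrakk>x \<in> M; y \<in> M\<rbrakk> \<Longrightarrow> nrm x \<le> nrm (pdiff x y) + nrm y"
proof -
  assume [simp]: "x \<in> M" "y \<in> M"
  have "nrm (pdiff x pzero) = nrm x" "nrm (pdiff y pzero) = nrm y"
    by (intro nrm_cong, simp add: ip_diff ip_diff_left ip_zero ip_zero_left a_minus_def)+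
  then show ?thesis using nrm_diff_triangle[of x y pzero] by simp
qed

end

text \<open>Definiteness is assumed in the weak form \<open>eqI\<close>: vectors that no inner
  product separates are equal. Module laws are then proved by testing both sides against
  \<open>ip\<close>.\<close>

locale hilbert_module = semi_hilbert B M padd pzero act ip
  for B :: "('b, 'm) cstar_scheme" (structure) and M :: "'x set" and padd pzero act ip +
  assumes eqI: "\<lbrakk>x \<in> M; y \<in> M; \<And>z. z \<in> M \<Longrightarrow> ip z x = ip z y\<rbrakk> \<Longrightarrow> x = y"
    and module_complete:
      "\<lbrakk>\<And>n::nat. s n \<in> M; \<forall>\<epsilon>>0. \<exists>N. \<forall>m\<ge>N. \<forall>n\<ge>N. nrm (pdiff (s m) (s n)) < \<epsilon>\<rbrakk>
        \<Longrightarrow> \<exists>l\<in>M. (\<lambda>n. nrm (pdiff (s n) l)) \<longlonglongrightarrow> 0"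
begin

lemma nrm_eq_zero: assumes [simp]: "x \<in> M" shows "nrm x = 0 \<longleftrightarrow> x = pzero"
proof
  assume "nrm x = 0"
  then have "ip z x = \<zero>" if "z \<in> M" for z
    using norm_ip_le[OF that assms] norm_nonneg[of "ip z x"] that by (simp add: norm_eq_zero)
  then show "x = pzero" by (intro eqI) (auto simp: ip_zero)
qed simp

section \<open>Adjointable operators and their algebra\<close>

definition is_adjoint :: "('x \<Rightarrow> 'x) \<Rightarrow> ('x \<Rightarrow> 'x) \<Rightarrow> bool" where
  "is_adjoint T S \<longleftrightarrow> S \<in> M \<rightarrow> M \<and> (\<forall>x\<in>M. \<forall>y\<in>M. ip (T x) y = ip x (S y))"

definition bounded_by :: "('x \<Rightarrow> 'x) \<Rightarrow> real \<Rightarrow> bool" where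
  "bounded_by T C \<longleftrightarrow> 0 \<le> C \<and> (\<forall>x\<in>M. nrm (T x) \<le> C * nrm x)"

text \<open>Linearity over \<open>B\<close> is a consequence of having an adjoint
  (\<open>ops_add\<close>, \<open>ops_act\<close>), while boundedness is included, which avoids the
  uniform boundedness principle. Extensionality makes operators equal when they agree on
  \<open>M\<close>.\<close>

definition ops :: "('x \<Rightarrow> 'x) set" where
  "ops = {T \<in> extensional M. T \<in> M \<rightarrow> M \<and> (\<exists>S. is_adjoint T S) \<and> (\<exists>C. bounded_by T C)}"

text \<open>The choice is determined on \<open>M\<close> by \<open>eqI\<close>, and the restriction
  fixes the values elsewhere.\<close>

definition adj :: "('x \<Rightarrow> 'x) \<Rightarrow> 'x \<Rightarrow> 'x" where
  "adj T = restrict (SOME S. is_adjoint T S) M"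

definition opnorm :: "('x \<Rightarrow> 'x) \<Rightarrow> real" where
  "opnorm T = Inf {C. bounded_by T C}"

text \<open>A complex scalar acts as the central element \<open>c \<odot> \<one>\<close> of
  \<open>B\<close> on the right, since the module has no scalar multiplication of its own.\<close>

definition op_alg :: "('x \<Rightarrow> 'x) cstar" where
  "op_alg = \<lparr>carrier = ops, monoid.mult = (\<lambda>T S. \<lambda>x\<in>M. T (S x)), one = (\<lambda>x\<in>M. x),
     ring.zero = (\<lambda>x\<in>M. pzero), add = (\<lambda>T S. \<lambda>x\<in>M. padd (T x) (S x)),
     module.smult = (\<lambda>c T. \<lambda>x\<in>M. act (T x) (c \<odot> \<one>)), star = adj, cnorm = opnorm\<rparr>"

lemma op_alg_simps [simp]:
  "carrier op_alg = ops"
  "T \<otimes>\<^bsub>op_alg\<^esub> S = (\<lambda>x\<in>M. T (S x))"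
  "\<one>\<^bsub>op_alg\<^esub> = (\<lambda>x\<in>M. x)"
  "\<zero>\<^bsub>op_alg\<^esub> = (\<lambda>x\<in>M. pzero)"
  "T \<oplus>\<^bsub>op_alg\<^esub> S = (\<lambda>x\<in>M. padd (T x) (S x))"
  "c \<odot>\<^bsub>op_alg\<^esub> T = (\<lambda>x\<in>M. act (T x) (c \<odot> \<one>))"
  "T\<^sup>\<star>\<^bsub>op_alg\<^esub> = adj T"
  "\<parallel>T\<parallel>\<^bsub>op_alg\<^esub> = opnorm T"
  by (simp_all add: op_alg_def)

lemma is_adjointD:
  "is_adjoint T S \<Longrightarrow> x \<in> M \<Longrightarrow> S x \<in> M"
  "is_adjoint T S \<Longrightarrow> x \<in> M \<Longrightarrow> y \<in> M \<Longrightarrow> ip (T x) y = ip x (S y)"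
  by (auto simp: is_adjoint_def)

lemma is_adjoint_sym:
  assumes "is_adjoint T S" "T \<in> M \<rightarrow> M" shows "is_adjoint S T"
proof -
  have "ip (S x) y = ip x (T y)" if "x \<in> M" "y \<in> M" for x y
    using is_adjointD[OF assms(1)] that assms(2) ip_star by (metis PiE)
  then show ?thesis using assms by (auto simp: is_adjoint_def)
qed

text \<open>The square of \<open>nrm (S y)\<close> is the norm of <T S y, y>, at most C times
  \<open>nrm (S y)\<close> times \<open>nrm y\<close>.\<close>

lemma bounded_by_adjoint:
  assumes "is_adjoint T S" "T \<in> M \<rightarrow> M" "bounded_by T C" shows "bounded_by S C"
proof -
  have "nrm (S y) \<le> C * nrm y" if [simp]: "y \<in> M" for y
  proof (rule nrm_le_of_ip_le)
    note [simp] = is_adjointD(1)[OF assms(1)]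
    have [simp]: "T x \<in> M" if "x \<in> M" for x using assms(2) that by auto
    show "S y \<in> M" by simp
    have "\<parallel>ip (S y) (S y)\<parallel> = \<parallel>ip (T (S y)) y\<parallel>" by (simp add: is_adjointD(2)[OF assms(1)])
    also have "\<dots> \<le> nrm (T (S y)) * nrm y" by (intro norm_ip_le) auto
    also have "\<dots> \<le> (C * nrm (S y)) * nrm y"
      using assms(3) by (intro mult_right_mono) (auto simp: bounded_by_def)
    finally show "\<parallel>ip (S y) (S y)\<parallel> \<le> C * nrm y * nrm (S y)" by (simp add: mult_ac)
    show "0 \<le> C * nrm y" using assms(3) by (simp add: bounded_by_def)
  qed
  then show ?thesis using assms by (simp add: bounded_by_def)
qed

lemma opsI:
  assumes "\<And>x. x \<in> M \<Longrightarrow> T x \<in> M" "is_adjoint T S" "bounded_by T C"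
  shows "restrict T M \<in> ops"
  using assms unfolding ops_def is_adjoint_def bounded_by_def by auto

lemma ops_closed [simp]: "\<lbrakk>T \<in> ops; x \<in> M\<rbrakk> \<Longrightarrow> T x \<in> M"
  by (auto simp: ops_def)

lemma ops_ext: "T \<in> ops \<Longrightarrow> T \<in> extensional M"
  unfolding ops_def by blast

lemma ops_eqI: "\<lbrakk>T \<in> extensional M; S \<in> extensional M; \<And>x. x \<in> M \<Longrightarrow> T x = S x\<rbrakk> \<Longrightarrow> T = S"
  by (rule extensionalityI)

lemma adjoint_exists: "T \<in> ops \<Longrightarrow> is_adjoint T (adj T)"
proof -
  assume "T \<in> ops"
  define S where "S = (SOME S. is_adjoint T S)"
  have "\<exists>S. is_adjoint T S" using \<open>T \<in> ops\<close> unfolding ops_def by blast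
  then have "is_adjoint T S" unfolding S_def by (rule someI_ex)
  moreover have "adj T = restrict S M" by (simp add: adj_def S_def)
  ultimately show ?thesis by (auto simp: is_adjoint_def)
qed

lemma adj_eq: assumes "T \<in> ops" "is_adjoint T S" "x \<in> M" shows "adj T x = S x"
proof (rule eqI)
  fix z assume "z \<in> M"
  then show "ip z (adj T x) = ip z (S x)"
    using is_adjointD[OF assms(2)] is_adjointD[OF adjoint_exists[OF assms(1)]] assms(3) by metis
qed (use assms is_adjointD[OF assms(2)] is_adjointD[OF adjoint_exists[OF assms(1)]] in auto)

lemma adj_ext: "adj T \<in> extensional M"
  by (simp add: adj_def)

lemma adj_closed [simp, intro]: assumes "T \<in> ops" shows "adj T \<in> ops"
proof -
  have "T \<in> M \<rightarrow> M" using assms by auto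
  moreover obtain C where "bounded_by T C" using assms unfolding ops_def by blast
  ultimately show ?thesis
    using is_adjoint_sym[OF adjoint_exists[OF assms]] bounded_by_adjoint[OF adjoint_exists[OF assms]]
      is_adjointD(1)[OF adjoint_exists[OF assms]] adj_ext[of T] unfolding ops_def by blast
qed

lemma ip_adj: "\<lbrakk>T \<in> ops; x \<in> M; y \<in> M\<rbrakk> \<Longrightarrow> ip (T x) y = ip x (adj T y)"
  by (rule is_adjointD(2)[OF adjoint_exists])

lemma ip_adj': "\<lbrakk>T \<in> ops; x \<in> M; y \<in> M\<rbrakk> \<Longrightarrow> ip (adj T x) y = ip x (T y)"
  using ip_star[of "T y" x] ip_star[of y "adj T x"] ip_adj[of T y x] by simp

lemma ops_add: "\<lbrakk>T \<in> ops; x \<in> M; y \<in> M\<rbrakk> \<Longrightarrow> T (padd x y) = padd (T x) (T y)"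
  by (rule eqI) (auto simp: ip_add simp flip: ip_adj')

lemma ops_act: "\<lbrakk>T \<in> ops; x \<in> M; b \<in> carrier B\<rbrakk> \<Longrightarrow> T (act x b) = act (T x) b"
  by (rule eqI) (auto simp: ip_act simp flip: ip_adj')

lemma opnorm_props:
  assumes "T \<in> ops"
  shows opnorm_nonneg: "0 \<le> opnorm T" and opnorm_bound: "x \<in> M \<Longrightarrow> nrm (T x) \<le> opnorm T * nrm x"
proof -
  let ?S = "{C. bounded_by T C}"
  have ne: "?S \<noteq> {}" using assms unfolding ops_def by blast
  then show "0 \<le> opnorm T" unfolding opnorm_def
    by (intro cInf_greatest) (auto simp: bounded_by_def)
  assume x: "x \<in> M"
  show "nrm (T x) \<le> opnorm T * nrm x"
  proof (cases "nrm x = 0")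
    case True
    then show ?thesis using ne x by (auto simp: bounded_by_def)
  next
    case False
    then have p: "0 < nrm x" using nrm_nonneg[OF x] by linarith
    have "nrm (T x) / nrm x \<le> opnorm T" unfolding opnorm_def
      using ne p x by (intro cInf_greatest) (auto simp: bounded_by_def divide_le_eq)
    then show ?thesis using p by (simp add: divide_le_eq)
  qed
qed

lemma opnorm_le: "bounded_by T C \<Longrightarrow> opnorm T \<le> C"
  unfolding opnorm_def by (rule cInf_lower) (auto intro!: bdd_belowI[of _ 0] simp: bounded_by_def)

lemma bounded_by_opnorm: "T \<in> ops \<Longrightarrow> bounded_by T (opnorm T)"
  by (simp add: bounded_by_def opnorm_nonneg opnorm_bound)

lemma add_in_ops:
  assumes [simp]: "T \<in> ops" "S \<in> ops"
  shows "(\<lambda>x\<in>M. padd (T x) (S x)) \<in> ops" "opnorm (\<lambda>x\<in>M. padd (T x) (S x)) \<le> opnorm T + opnorm S"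
    "x \<in> M \<Longrightarrow> adj (\<lambda>x\<in>M. padd (T x) (S x)) x = padd (adj T x) (adj S x)"
proof -
  have a: "is_adjoint (\<lambda>x\<in>M. padd (T x) (S x)) (\<lambda>x. padd (adj T x) (adj S x))"
    by (auto simp: is_adjoint_def ip_add ip_add_left ip_adj)
  have "nrm (padd (T x) (S x)) \<le> (opnorm T + opnorm S) * nrm x" if "x \<in> M" for x
    using that nrm_triangle[of "T x" "S x"] opnorm_bound[of T x] opnorm_bound[of S x]
    by (simp add: distrib_right)
  then have b: "bounded_by (\<lambda>x\<in>M. padd (T x) (S x)) (opnorm T + opnorm S)"
    by (simp add: bounded_by_def opnorm_nonneg)
  show c: "(\<lambda>x\<in>M. padd (T x) (S x)) \<in> ops"
    using opsI[OF _ a b] by (simp cong: restrict_cong)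
  show "opnorm (\<lambda>x\<in>M. padd (T x) (S x)) \<le> opnorm T + opnorm S" by (rule opnorm_le[OF b])
  show "x \<in> M \<Longrightarrow> adj (\<lambda>x\<in>M. padd (T x) (S x)) x = padd (adj T x) (adj S x)"
    by (rule adj_eq[OF c a])
qed

lemma mult_in_ops:
  assumes [simp]: "T \<in> ops" "S \<in> ops"
  shows "(\<lambda>x\<in>M. T (S x)) \<in> ops" "opnorm (\<lambda>x\<in>M. T (S x)) \<le> opnorm T * opnorm S"
    "x \<in> M \<Longrightarrow> adj (\<lambda>x\<in>M. T (S x)) x = adj S (adj T x)"
proof -
  have a: "is_adjoint (\<lambda>x\<in>M. T (S x)) (\<lambda>x. adj S (adj T x))"
    by (auto simp: is_adjoint_def ip_adj)
  have "nrm (T (S x)) \<le> opnorm T * opnorm S * nrm x" if "x \<in> M" for x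
  proof -
    have "nrm (T (S x)) \<le> opnorm T * nrm (S x)" using that by (intro opnorm_bound) auto
    also have "\<dots> \<le> opnorm T * (opnorm S * nrm x)"
      using that by (intro mult_left_mono opnorm_bound opnorm_nonneg) auto
    finally show ?thesis by (simp add: mult_ac)
  qed
  then have b: "bounded_by (\<lambda>x\<in>M. T (S x)) (opnorm T * opnorm S)"
    by (auto simp: bounded_by_def opnorm_nonneg)
  show c: "(\<lambda>x\<in>M. T (S x)) \<in> ops"
    using opsI[OF _ a b] by (simp cong: restrict_cong)
  show "opnorm (\<lambda>x\<in>M. T (S x)) \<le> opnorm T * opnorm S" by (rule opnorm_le[OF b])
  show "x \<in> M \<Longrightarrow> adj (\<lambda>x\<in>M. T (S x)) x = adj S (adj T x)"
    by (rule adj_eq[OF c a])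
qed

lemma smult_in_ops:
  assumes [simp]: "T \<in> ops"
  shows "(\<lambda>x\<in>M. act (T x) (c \<odot> \<one>)) \<in> ops"
    "opnorm (\<lambda>x\<in>M. act (T x) (c \<odot> \<one>)) \<le> cmod c * opnorm T"
    "x \<in> M \<Longrightarrow> adj (\<lambda>x\<in>M. act (T x) (c \<odot> \<one>)) x = act (adj T x) (cnj c \<odot> \<one>)"
proof -
  have a: "is_adjoint (\<lambda>x\<in>M. act (T x) (c \<odot> \<one>)) (\<lambda>x. act (adj T x) (cnj c \<odot> \<one>))"
    by (auto simp: is_adjoint_def ip_act ip_act_left ip_adj star_smult smult_mult_left
        smult_mult_right)
  have b: "bounded_by (\<lambda>x\<in>M. act (T x) (c \<odot> \<one>)) (cmod c * opnorm T)"
    by (auto simp: bounded_by_def opnorm_nonneg nrm_smult mult.assoc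
        intro!: mult_left_mono opnorm_bound)
  show c: "(\<lambda>x\<in>M. act (T x) (c \<odot> \<one>)) \<in> ops"
    using opsI[OF _ a b] by (simp cong: restrict_cong)
  show "opnorm (\<lambda>x\<in>M. act (T x) (c \<odot> \<one>)) \<le> cmod c * opnorm T" by (rule opnorm_le[OF b])
  show "x \<in> M \<Longrightarrow> adj (\<lambda>x\<in>M. act (T x) (c \<odot> \<one>)) x = act (adj T x) (cnj c \<odot> \<one>)"
    by (rule adj_eq[OF c a])
qed

lemma one_in_ops: "(\<lambda>x\<in>M. x) \<in> ops"
proof -
  have "is_adjoint (\<lambda>x. x) (\<lambda>x. x)" "bounded_by (\<lambda>x. x) 1"
    by (auto simp: is_adjoint_def bounded_by_def)
  from opsI[OF _ this] show ?thesis by simp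
qed

lemma zero_in_ops: "(\<lambda>x\<in>M. pzero) \<in> ops"
proof -
  have "is_adjoint (\<lambda>x. pzero) (\<lambda>x. pzero)" "bounded_by (\<lambda>x. pzero) 0"
    by (auto simp: is_adjoint_def bounded_by_def ip_zero ip_zero_left)
  from opsI[OF _ this] show ?thesis by simp
qed

lemma neg_add_zero: "x \<in> M \<Longrightarrow> padd (act x ((-1) \<odot> \<one>)) x = pzero"
  by (intro eqI) (auto simp: ip_add ip_act ip_zero neg_smult r_minus l_neg)

lemma ring_op_alg: "ring op_alg"
proof (rule ringI)
  show "abelian_group op_alg"
  proof (rule abelian_groupI)
    fix T assume T: "T \<in> carrier op_alg"
    then have [simp]: "T \<in> ops" by simp
    show "\<exists>S\<in>carrier op_alg. S \<oplus>\<^bsub>op_alg\<^esub> T = \<zero>\<^bsub>op_alg\<^esub>"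
    proof (rule bexI)
      show "(\<lambda>x\<in>M. act (T x) ((-1) \<odot> \<one>)) \<in> carrier op_alg" using smult_in_ops(1)[of T "-1"] by simp
      show "(\<lambda>x\<in>M. act (T x) ((-1) \<odot> \<one>)) \<oplus>\<^bsub>op_alg\<^esub> T = \<zero>\<^bsub>op_alg\<^esub>"
        using neg_add_zero by (auto intro!: ops_eqI)
    qed
  qed (auto intro!: ops_eqI eqI
        simp: ops_ext add_in_ops zero_in_ops ip_add ip_zero a_assoc a_comm a_lcomm)
  show "monoid op_alg"
    by (rule monoidI) (auto intro!: ops_eqI simp: mult_in_ops one_in_ops ops_ext)
qed (auto intro!: ops_eqI simp: ops_add)

lemma a_inv_op_alg:
  assumes "T \<in> ops" shows "\<ominus>\<^bsub>op_alg\<^esub> T = (\<lambda>x\<in>M. act (T x) (\<ominus> \<one>))"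
proof -
  have "(\<lambda>x\<in>M. act (T x) ((-1) \<odot> \<one>)) \<oplus>\<^bsub>op_alg\<^esub> T = \<zero>\<^bsub>op_alg\<^esub>"
    using neg_add_zero assms by (auto intro!: ops_eqI)
  from abelian_group.minus_equality[OF ring.is_abelian_group[OF ring_op_alg] this]
  show ?thesis using smult_in_ops(1)[OF assms, of "-1"] assms a_inv_eq[OF one_closed] by simp
qed

lemma minus_op_alg:
  "\<lbrakk>T \<in> ops; S \<in> ops\<rbrakk> \<Longrightarrow> T \<ominus>\<^bsub>op_alg\<^esub> S = (\<lambda>x\<in>M. pdiff (T x) (S x))"
  by (auto simp: a_minus_def a_inv_op_alg pdiff_def intro!: ops_eqI)

end

section \<open>C*-identity, completeness and positivity in the algebra of operators\<close>

context hilbert_module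
begin

lemma is_adjoint_adj: "T \<in> ops \<Longrightarrow> is_adjoint (adj T) T"
  by (rule is_adjoint_sym[OF adjoint_exists]) auto

lemma opnorm_adj: assumes [simp]: "T \<in> ops" shows "opnorm (adj T) = opnorm T"
proof (rule antisym)
  have *: "S \<in> M \<rightarrow> M" if "S \<in> ops" for S using that by auto
  show "opnorm (adj T) \<le> opnorm T"
    using bounded_by_adjoint[OF adjoint_exists * bounded_by_opnorm] by (intro opnorm_le) auto
  show "opnorm T \<le> opnorm (adj T)"
    using bounded_by_adjoint[OF is_adjoint_adj * bounded_by_opnorm] by (intro opnorm_le) auto
qed

lemma adj_adj: "T \<in> ops \<Longrightarrow> adj (adj T) = T"
  by (rule ops_eqI) (simp_all add: ops_ext adj_ext adj_eq[OF adj_closed is_adjoint_adj])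

text \<open>The nontrivial inequality is Cauchy-Schwarz: the square of \<open>nrm (T x)\<close> is
  the norm of <x, T* T x>.\<close>

lemma opnorm_square_le: assumes [simp]: "T \<in> ops"
  shows "opnorm (\<lambda>x\<in>M. adj T (T x)) = (opnorm T)\<^sup>2"
proof (rule antisym)
  let ?S = "\<lambda>x\<in>M. adj T (T x)"
  have S [simp]: "?S \<in> ops" by (intro mult_in_ops) auto
  show "opnorm ?S \<le> (opnorm T)\<^sup>2"
    using mult_in_ops(2)[of "adj T" T] by (simp add: opnorm_adj power2_eq_square)
  have "nrm (T x) \<le> sqrt (opnorm ?S) * nrm x" if [simp]: "x \<in> M" for x
  proof (rule power2_le_imp_le)
    have "(nrm (T x))\<^sup>2 = \<parallel>ip x (?S x)\<parallel>" by (simp add: nrm_square ip_adj)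
    also have "\<dots> \<le> nrm x * nrm (?S x)" by (intro norm_ip_le ops_closed[OF S]) auto
    also have "\<dots> \<le> nrm x * (opnorm ?S * nrm x)" by (intro mult_left_mono opnorm_bound[OF S]) auto
    finally show "(nrm (T x))\<^sup>2 \<le> (sqrt (opnorm ?S) * nrm x)\<^sup>2"
      using opnorm_nonneg[OF S] by (simp add: power_mult_distrib) (simp add: power2_eq_square mult_ac)
  qed (simp add: opnorm_nonneg[OF S])
  then have "opnorm T \<le> sqrt (opnorm ?S)"
    by (intro opnorm_le) (simp add: bounded_by_def opnorm_nonneg[OF S])
  then have "(opnorm T)\<^sup>2 \<le> (sqrt (opnorm ?S))\<^sup>2"
    by (rule power_mono) (simp add: opnorm_nonneg)
  then show "(opnorm T)\<^sup>2 \<le> opnorm ?S" by (simp add: opnorm_nonneg[OF S])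
qed

text \<open>Formulated for arbitrary maps, so that it applies to a Cauchy sequence of operators and
  equally to their adjoints.\<close>

lemma uniform_limit_exists:
  assumes tM [simp]: "\<And>n x. x \<in> M \<Longrightarrow> t n x \<in> M"
    and C: "\<And>\<epsilon>. 0 < \<epsilon> \<Longrightarrow> \<exists>N::nat. \<forall>m\<ge>N. \<forall>n\<ge>N. \<forall>x\<in>M. nrm (pdiff (t m x) (t n x)) \<le> \<epsilon> * nrm x"
  obtains L where "\<And>x. x \<in> M \<Longrightarrow> L x \<in> M"
    "\<And>\<epsilon>. 0 < \<epsilon> \<Longrightarrow> \<exists>N. \<forall>n\<ge>N. \<forall>x\<in>M. nrm (pdiff (t n x) (L x)) \<le> \<epsilon> * nrm x"
proof -
  have "\<exists>l\<in>M. (\<lambda>n. nrm (pdiff (t n x) l)) \<longlonglongrightarrow> 0" if x: "x \<in> M" for x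
  proof (rule module_complete)
    show "\<forall>e>0. \<exists>N. \<forall>m\<ge>N. \<forall>n\<ge>N. nrm (pdiff (t m x) (t n x)) < e"
    proof (intro allI impI)
      fix e :: real assume e: "0 < e"
      have p: "0 < nrm x + 1" using nrm_nonneg[OF x] by linarith
      then obtain N where N: "\<forall>m\<ge>N. \<forall>n\<ge>N. nrm (pdiff (t m x) (t n x)) \<le> e / (nrm x + 1) * nrm x"
        using C[of "e / (nrm x + 1)"] e x by (meson divide_pos_pos)
      have "e / (nrm x + 1) * nrm x < e" using e p by (simp add: field_simps)
      then show "\<exists>N. \<forall>m\<ge>N. \<forall>n\<ge>N. nrm (pdiff (t m x) (t n x)) < e" using N by (meson le_less_trans)
    qed
  qed (simp add: x)
  then obtain L where L: "\<And>x. x \<in> M \<Longrightarrow> L x \<in> M \<and> (\<lambda>n. nrm (pdiff (t n x) (L x))) \<longlonglongrightarrow> 0"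
    by metis
  show ?thesis
  proof
    fix e :: real assume "0 < e"
    then obtain N where N: "\<forall>m\<ge>N. \<forall>n\<ge>N. \<forall>x\<in>M. nrm (pdiff (t m x) (t n x)) \<le> e * nrm x"
      using C by blast
    have "nrm (pdiff (t n x) (L x)) \<le> e * nrm x" if n: "n \<ge> N" and x: "x \<in> M" for n x
    \<comment> \<open>The Cauchy estimate between indices n and m is kept, and m tends to
      infinity.\<close>
    proof (rule LIMSEQ_le_const)
      show "(\<lambda>m. e * nrm x + nrm (pdiff (t m x) (L x))) \<longlonglongrightarrow> e * nrm x"
        using tendsto_add[OF tendsto_const[of "e * nrm x"] conjunct2[OF L[OF x]]] by simp
      have "nrm (pdiff (t n x) (L x)) \<le> e * nrm x + nrm (pdiff (t m x) (L x))" if "m \<ge> N" for m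
        using nrm_diff_triangle[of "t n x" "t m x" "L x"] x L[OF x] N that n by force
      then show "\<exists>K. \<forall>m\<ge>K. nrm (pdiff (t n x) (L x)) \<le> e * nrm x + nrm (pdiff (t m x) (L x))"
        by blast
    qed
    then show "\<exists>N. \<forall>n\<ge>N. \<forall>x\<in>M. nrm (pdiff (t n x) (L x)) \<le> e * nrm x" by blast
  qed (use L in blast)
qed

text \<open>A pointwise limit of operators need not visibly have an adjoint. Adjoints of differences
  obey the same bounds, so the adjoints converge as well, and their limit \<open>S\<close> is an
  adjoint of the limit \<open>T\<close>.\<close>

lemma ops_complete:
  assumes s [simp]: "\<And>n::nat. s n \<in> ops"
    and C: "\<forall>\<epsilon>>0. \<exists>N. \<forall>m\<ge>N. \<forall>n\<ge>N. opnorm (\<lambda>x\<in>M. pdiff (s m x) (s n x)) < \<epsilon>"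
  shows "\<exists>l\<in>ops. (\<lambda>n. opnorm (\<lambda>x\<in>M. pdiff (s n x) (l x))) \<longlonglongrightarrow> 0"
proof -
  interpret L: ring op_alg by (rule ring_op_alg)
  have D [simp]: "(\<lambda>x\<in>M. pdiff (s m x) (s n x)) \<in> ops" for m n
    using L.minus_closed[of "s m" "s n"] by (simp add: minus_op_alg)
  have b: "nrm (pdiff (s m x) (s n x)) \<le> opnorm (\<lambda>x\<in>M. pdiff (s m x) (s n x)) * nrm x"
    if "x \<in> M" for m n x
    using opnorm_bound[OF D[of m n] that] that by simp
  have a: "is_adjoint (\<lambda>x\<in>M. pdiff (s m x) (s n x)) (\<lambda>x. pdiff (adj (s m) x) (adj (s n) x))" for m n
    by (auto simp: is_adjoint_def ip_diff ip_diff_left ip_adj)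
  have b': "nrm (pdiff (adj (s m) x) (adj (s n) x)) \<le> opnorm (\<lambda>x\<in>M. pdiff (s m x) (s n x)) * nrm x"
    if "x \<in> M" for m n x
    using bounded_by_adjoint[OF a _ bounded_by_opnorm[OF D]] that by (auto simp: bounded_by_def)
  have Cb: "\<exists>N. \<forall>m\<ge>N. \<forall>n\<ge>N. \<forall>x\<in>M. nrm (pdiff (s m x) (s n x)) \<le> e * nrm x"
    and Cb': "\<exists>N. \<forall>m\<ge>N. \<forall>n\<ge>N. \<forall>x\<in>M. nrm (pdiff (adj (s m) x) (adj (s n) x)) \<le> e * nrm x"
    if "0 < e" for e
  proof -
    obtain N where N: "\<forall>m\<ge>N. \<forall>n\<ge>N. opnorm (\<lambda>x\<in>M. pdiff (s m x) (s n x)) < e"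
      using C \<open>0 < e\<close> by blast
    have N': "opnorm (\<lambda>x\<in>M. pdiff (s m x) (s n x)) * nrm x \<le> e * nrm x"
      if "m \<ge> N" "n \<ge> N" "x \<in> M" for m n x
      using N that by (intro mult_right_mono) (auto intro: less_imp_le)
    show "\<exists>N. \<forall>m\<ge>N. \<forall>n\<ge>N. \<forall>x\<in>M. nrm (pdiff (s m x) (s n x)) \<le> e * nrm x"
      using N' b by (meson order_trans)
    show "\<exists>N. \<forall>m\<ge>N. \<forall>n\<ge>N. \<forall>x\<in>M. nrm (pdiff (adj (s m) x) (adj (s n) x)) \<le> e * nrm x"
      using N' b' by (meson order_trans)
  qed
  obtain T where T [simp]: "\<And>x. x \<in> M \<Longrightarrow> T x \<in> M"
    and Tl: "\<And>e. 0 < e \<Longrightarrow> \<exists>N. \<forall>n\<ge>N. \<forall>x\<in>M. nrm (pdiff (s n x) (T x)) \<le> e * nrm x"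
    by (rule uniform_limit_exists[of s, OF _ Cb]) (auto intro: that)
  obtain S where S [simp]: "\<And>x. x \<in> M \<Longrightarrow> S x \<in> M"
    and Sl: "\<And>e. 0 < e \<Longrightarrow> \<exists>N. \<forall>n\<ge>N. \<forall>x\<in>M. nrm (pdiff (adj (s n) x) (S x)) \<le> e * nrm x"
    by (rule uniform_limit_exists[of "\<lambda>n. adj (s n)", OF _ Cb']) (auto intro: that)
  have "ip (T x) y = ip x (S y)" if [simp]: "x \<in> M" "y \<in> M" for x y
  proof (rule eq_of_norm_le)
    fix e :: real assume "0 < e"
    then obtain N1 N2
      where N1: "\<forall>n\<ge>N1. \<forall>x\<in>M. nrm (pdiff (s n x) (T x)) \<le> e * nrm x"
        and N2: "\<forall>n\<ge>N2. \<forall>x\<in>M. nrm (pdiff (adj (s n) x) (S x)) \<le> e * nrm x"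
      using Tl Sl by meson
    define n where "n = max N1 N2"
    have e1: "nrm (pdiff (s n x) (T x)) \<le> e * nrm x" and e2: "nrm (pdiff (adj (s n) y) (S y)) \<le> e * nrm y"
      using N1 N2 by (simp_all add: n_def)
    have "\<parallel>ip (T x) y \<ominus> ip x (S y)\<parallel> \<le>
        \<parallel>ip (T x) y \<ominus> ip (s n x) y\<parallel> + \<parallel>ip x (adj (s n) y) \<ominus> ip x (S y)\<parallel>"
      using norm_diff_triangle[of "ip (T x) y" "ip (s n x) y" "ip x (S y)"] by (simp add: ip_adj)
    also have "\<dots> = \<parallel>ip (pdiff (T x) (s n x)) y\<parallel> + \<parallel>ip x (pdiff (adj (s n) y) (S y))\<parallel>"
      by (simp add: ip_diff ip_diff_left)
    also have "\<dots> \<le> nrm (pdiff (T x) (s n x)) * nrm y + nrm x * nrm (pdiff (adj (s n) y) (S y))"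
      by (intro add_mono norm_ip_le) auto
    also have "\<dots> \<le> (e * nrm x) * nrm y + nrm x * (e * nrm y)"
      using e1 e2 nrm_diff_commute[of "s n x" "T x"] \<open>0 < e\<close> by (intro add_mono mult_mono) auto
    finally show "\<parallel>ip (T x) y \<ominus> ip x (S y)\<parallel> \<le> (2 * (nrm x * nrm y)) * e" by (simp add: mult_ac)
  qed auto
  then have adjT: "is_adjoint T S" by (auto simp: is_adjoint_def)
  \<comment> \<open>One term within distance 1 is enough to bound the limit.\<close>
  obtain N where N: "\<forall>n\<ge>N. \<forall>x\<in>M. nrm (pdiff (s n x) (T x)) \<le> 1 * nrm x"
    using Tl[of 1] by auto
  have "nrm (T x) \<le> (1 + opnorm (s N)) * nrm x" if [simp]: "x \<in> M" for x
  proof -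
    have "nrm (T x) \<le> nrm (pdiff (T x) (s N x)) + nrm (s N x)" by (intro nrm_le_diff) auto
    moreover have "nrm (pdiff (T x) (s N x)) \<le> nrm x"
      using N nrm_diff_commute[of "s N x" "T x"] that by (metis T mult_1 ops_closed order_refl s)
    moreover have "nrm (s N x) \<le> opnorm (s N) * nrm x" by (intro opnorm_bound) auto
    ultimately show ?thesis by (simp add: algebra_simps)
  qed
  then have bT: "bounded_by T (1 + opnorm (s N))"
    by (simp add: bounded_by_def opnorm_nonneg)
  have Tops: "restrict T M \<in> ops" by (rule opsI[OF T adjT bT])
  have "(\<lambda>n. opnorm (\<lambda>x\<in>M. pdiff (s n x) (T x))) \<longlonglongrightarrow> 0"
  proof (rule LIMSEQ_I)
    fix r :: real assume "0 < r"
    then obtain N where N: "\<forall>n\<ge>N. \<forall>x\<in>M. nrm (pdiff (s n x) (T x)) \<le> r/2 * nrm x"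
      using Tl[of "r/2"] by auto
    have "\<bar>opnorm (\<lambda>x\<in>M. pdiff (s n x) (T x))\<bar> < r" if "n \<ge> N" for n
    proof -
      have "(\<lambda>x\<in>M. pdiff (s n x) (T x)) = s n \<ominus>\<^bsub>op_alg\<^esub> restrict T M"
        using Tops by (simp add: minus_op_alg cong: restrict_cong)
      then have "(\<lambda>x\<in>M. pdiff (s n x) (T x)) \<in> ops"
        using L.minus_closed[of "s n" "restrict T M"] Tops by simp
      moreover have "opnorm (\<lambda>x\<in>M. pdiff (s n x) (T x)) \<le> r/2"
        using N that \<open>0 < r\<close> by (intro opnorm_le) (auto simp: bounded_by_def)
      ultimately show ?thesis using opnorm_nonneg \<open>0 < r\<close> by force
    qed
    then show "\<exists>N. \<forall>n\<ge>N. norm (opnorm (\<lambda>x\<in>M. pdiff (s n x) (T x)) - 0) < r" by auto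
  qed
  then have "(\<lambda>n. opnorm (\<lambda>x\<in>M. pdiff (s n x) (restrict T M x))) \<longlonglongrightarrow> 0"
    by (simp cong: restrict_cong)
  then show ?thesis using Tops by blast
qed

theorem cstar_algebra_op_alg: "cstar_algebra op_alg"
proof -
  interpret L: ring op_alg by (rule ring_op_alg)
  have scalars: "module (ring_of_type_algebra :: complex ring) op_alg"
    by (rule moduleI[OF cring_from_type_algebra L.is_abelian_group])
      (auto intro!: ops_eqI eqI simp: ring_of_type_algebra_def smult_in_ops ops_ext ip_add ip_act
        smult_add_left smult_add_right smult_smult smult_mult_left smult_mult_right l_distr r_distr mult.commute)
  show ?thesis
  proof (intro cstar_algebra.intro cstar_algebra_axioms.intro L.ring_axioms scalars)
    fix T S c assume "T \<in> carrier op_alg" "S \<in> carrier op_alg"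
    then have [simp]: "T \<in> ops" "S \<in> ops" by simp_all
    show "c \<odot>\<^bsub>op_alg\<^esub> T \<otimes>\<^bsub>op_alg\<^esub> S = c \<odot>\<^bsub>op_alg\<^esub> (T \<otimes>\<^bsub>op_alg\<^esub> S)"
      by (auto intro!: ops_eqI)
    show "T \<otimes>\<^bsub>op_alg\<^esub> (c \<odot>\<^bsub>op_alg\<^esub> S) = c \<odot>\<^bsub>op_alg\<^esub> (T \<otimes>\<^bsub>op_alg\<^esub> S)"
      by (auto intro!: ops_eqI simp: ops_act)
    show "T\<^sup>\<star>\<^bsub>op_alg\<^esub> \<in> carrier op_alg" by simp
    show "(T\<^sup>\<star>\<^bsub>op_alg\<^esub>)\<^sup>\<star>\<^bsub>op_alg\<^esub> = T" by (simp add: adj_adj)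
    show "(T \<oplus>\<^bsub>op_alg\<^esub> S)\<^sup>\<star>\<^bsub>op_alg\<^esub> = T\<^sup>\<star>\<^bsub>op_alg\<^esub> \<oplus>\<^bsub>op_alg\<^esub> S\<^sup>\<star>\<^bsub>op_alg\<^esub>"
      by (auto intro!: ops_eqI simp: adj_ext add_in_ops)
    show "(c \<odot>\<^bsub>op_alg\<^esub> T)\<^sup>\<star>\<^bsub>op_alg\<^esub> = cnj c \<odot>\<^bsub>op_alg\<^esub> T\<^sup>\<star>\<^bsub>op_alg\<^esub>"
      by (auto intro!: ops_eqI simp: adj_ext smult_in_ops)
    show "(T \<otimes>\<^bsub>op_alg\<^esub> S)\<^sup>\<star>\<^bsub>op_alg\<^esub> = S\<^sup>\<star>\<^bsub>op_alg\<^esub> \<otimes>\<^bsub>op_alg\<^esub> T\<^sup>\<star>\<^bsub>op_alg\<^esub>"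
      by (auto intro!: ops_eqI simp: adj_ext mult_in_ops)
    show "0 \<le> \<parallel>T\<parallel>\<^bsub>op_alg\<^esub>" by (simp add: opnorm_nonneg)
    show "\<parallel>T\<parallel>\<^bsub>op_alg\<^esub> = 0 \<longleftrightarrow> T = \<zero>\<^bsub>op_alg\<^esub>"
    proof
      assume "\<parallel>T\<parallel>\<^bsub>op_alg\<^esub> = 0"
      then have "T x = pzero" if "x \<in> M" for x
        using opnorm_bound[of T x] that nrm_eq_zero[of "T x"] order_antisym[OF _ nrm_nonneg[of "T x"]]
        by simp
      then show "T = \<zero>\<^bsub>op_alg\<^esub>" by (auto intro!: ops_eqI simp: ops_ext)
    next
      assume "T = \<zero>\<^bsub>op_alg\<^esub>"
      then have "bounded_by T 0" by (simp add: bounded_by_def)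
      then show "\<parallel>T\<parallel>\<^bsub>op_alg\<^esub> = 0" using opnorm_le[of T 0] opnorm_nonneg[of T] by simp
    qed
    show "\<parallel>T \<oplus>\<^bsub>op_alg\<^esub> S\<parallel>\<^bsub>op_alg\<^esub> \<le> \<parallel>T\<parallel>\<^bsub>op_alg\<^esub> + \<parallel>S\<parallel>\<^bsub>op_alg\<^esub>" by (simp add: add_in_ops)
    show "\<parallel>T \<otimes>\<^bsub>op_alg\<^esub> S\<parallel>\<^bsub>op_alg\<^esub> \<le> \<parallel>T\<parallel>\<^bsub>op_alg\<^esub> * \<parallel>S\<parallel>\<^bsub>op_alg\<^esub>" by (simp add: mult_in_ops)
    show "\<parallel>T\<^sup>\<star>\<^bsub>op_alg\<^esub> \<otimes>\<^bsub>op_alg\<^esub> T\<parallel>\<^bsub>op_alg\<^esub> = (\<parallel>T\<parallel>\<^bsub>op_alg\<^esub>)\<^sup>2" by (simp add: opnorm_square_le)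
    show "\<parallel>c \<odot>\<^bsub>op_alg\<^esub> T\<parallel>\<^bsub>op_alg\<^esub> = cmod c * \<parallel>T\<parallel>\<^bsub>op_alg\<^esub>"
    proof (rule antisym)
      show "\<parallel>c \<odot>\<^bsub>op_alg\<^esub> T\<parallel>\<^bsub>op_alg\<^esub> \<le> cmod c * \<parallel>T\<parallel>\<^bsub>op_alg\<^esub>" by (simp add: smult_in_ops)
      let ?cT = "\<lambda>x\<in>M. act (T x) (c \<odot> \<one>)"
      have cT: "?cT \<in> ops" by (rule smult_in_ops) simp
      show "cmod c * \<parallel>T\<parallel>\<^bsub>op_alg\<^esub> \<le> \<parallel>c \<odot>\<^bsub>op_alg\<^esub> T\<parallel>\<^bsub>op_alg\<^esub>"
      proof (cases "c = 0")
        case True then show ?thesis using opnorm_nonneg[OF cT] by simp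
      next
        case False
        then have "nrm (T x) \<le> opnorm ?cT / cmod c * nrm x" if "x \<in> M" for x
          using opnorm_bound[OF cT that] that by (simp add: nrm_smult field_simps)
        then have "opnorm T \<le> opnorm ?cT / cmod c"
          by (intro opnorm_le) (simp add: bounded_by_def opnorm_nonneg[OF cT])
        then show ?thesis using False by (simp add: field_simps)
      qed
    qed
  next
    fix s :: "nat \<Rightarrow> 'x \<Rightarrow> 'x"
    assume "\<And>n. s n \<in> carrier op_alg"
      and C: "\<forall>\<epsilon>>0. \<exists>N. \<forall>m\<ge>N. \<forall>n\<ge>N. \<parallel>s m \<ominus>\<^bsub>op_alg\<^esub> s n\<parallel>\<^bsub>op_alg\<^esub> < \<epsilon>"
    then have s: "s n \<in> ops" for n by simp
    obtain l where "l \<in> ops" "(\<lambda>n. opnorm (\<lambda>x\<in>M. pdiff (s n x) (l x))) \<longlonglongrightarrow> 0"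
      using ops_complete[of s, OF s] C by (auto simp: minus_op_alg s)
    then show "\<exists>l\<in>carrier op_alg. (\<lambda>n. \<parallel>s n \<ominus>\<^bsub>op_alg\<^esub> l\<parallel>\<^bsub>op_alg\<^esub>) \<longlonglongrightarrow> 0"
      by (auto simp: minus_op_alg s)
  qed
qed

text \<open>The criterion gives \<open>d\<close> and \<open>r\<close> with
  \<open>d T d = - r\<^sup>2\<close>. Evaluated at x, both <rx, rx> and its negative <dx, T dx> are
  positive, so rx = 0 for every x. This is how positivity of operators is reduced to positivity in
  \<open>B\<close>.\<close>

lemma op_pos:
  assumes T [simp]: "T \<in> ops" and sa: "adj T = T" and p: "\<And>x. x \<in> M \<Longrightarrow> pos (ip x (T x))"
  shows "cstar_algebra.pos op_alg T"
proof -
  interpret L: cstar_algebra op_alg by (rule cstar_algebra_op_alg)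
  have "T \<in> carrier op_alg" "T\<^sup>\<star>\<^bsub>op_alg\<^esub> = T" by (simp_all add: sa)
  then obtain d r where "d \<in> carrier op_alg" "d\<^sup>\<star>\<^bsub>op_alg\<^esub> = d" "r \<in> carrier op_alg" "r\<^sup>\<star>\<^bsub>op_alg\<^esub> = r"
    and drd: "d \<otimes>\<^bsub>op_alg\<^esub> T \<otimes>\<^bsub>op_alg\<^esub> d = \<ominus>\<^bsub>op_alg\<^esub> (r \<otimes>\<^bsub>op_alg\<^esub> r)"
    and r0: "r = \<zero>\<^bsub>op_alg\<^esub> \<Longrightarrow> L.pos T"
    by (rule L.self_adjoint_pos_criterion) (rule that)
  then have d [simp]: "d \<in> ops" and sd: "adj d = d" and r [simp]: "r \<in> ops" and sr: "adj r = r"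
    by simp_all
  have rr: "(\<lambda>x\<in>M. r (r x)) \<in> ops" by (rule mult_in_ops) auto
  have "r x = pzero" if [simp]: "x \<in> M" for x
  proof -
    have "d (T (d x)) = act (r (r x)) (\<ominus> \<one>)"
      using fun_cong[OF drd, of x] by (simp add: a_inv_op_alg rr)
    then have "ip (d x) (T (d x)) = \<ominus> ip (r x) (r x)"
      using ip_adj[of d x "T (d x)"] ip_adj[of r x "r x"] by (simp add: sd sr ip_act r_minus)
    then have "pos (\<ominus> ip (r x) (r x))" using p[of "d x"] by simp
    then have "ip (r x) (r x) = \<zero>" by (intro pos_antisym ip_pos) auto
    then show ?thesis using nrm_eq_zero[of "r x"] by (simp add: nrm_def)
  qed
  then have "r = \<zero>\<^bsub>op_alg\<^esub>" by (auto intro!: ops_eqI simp: ops_ext)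
  then show ?thesis by (rule r0)
qed

end

section \<open>Completion of semi-inner-product modules\<close>

lemma le_of_le_add_mult:
  fixes a b K :: real
  assumes "\<And>\<delta>. 0 < \<delta> \<Longrightarrow> a \<le> b + K * \<delta>" shows "a \<le> b"
proof (rule field_le_epsilon)
  fix e :: real assume "0 < e"
  then have "0 < e / (\<bar>K\<bar> + 1)" by (simp add: add_nonneg_pos)
  from assms[OF this] have "a \<le> b + K / (\<bar>K\<bar> + 1) * e" by simp
  also have "\<dots> \<le> b + 1 * e"
    using \<open>0 < e\<close> by (intro add_left_mono mult_right_mono) (auto simp: divide_le_eq)
  finally show "a \<le> b + e" by simp
qed

context semi_hilbert
begin

text \<open>A vector \<open>y\<close> is identified with the functional \<open>\<langle>\<sqdot>, y\<rangle>\<close>, and the completion consists of the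
  norm limits \<open>F\<close> of such functionals. The inner product \<open>cip F G\<close> is the limit of \<open>G y\<close> as \<open>y\<close>
  tends to \<open>F\<close>.\<close>

definition approx :: "('x \<Rightarrow> 'b) \<Rightarrow> real \<Rightarrow> 'x \<Rightarrow> bool" where
  "approx F \<epsilon> y \<longleftrightarrow> y \<in> M \<and> (\<forall>x\<in>M. \<parallel>F x \<ominus> ip x y\<parallel> \<le> \<epsilon> * nrm x)"

definition completion :: "('x \<Rightarrow> 'b) set" where
  "completion = {F \<in> M \<rightarrow>\<^sub>E carrier B. \<forall>\<epsilon>>0. \<exists>y. approx F \<epsilon> y}"

definition cadd :: "('x \<Rightarrow> 'b) \<Rightarrow> ('x \<Rightarrow> 'b) \<Rightarrow> 'x \<Rightarrow> 'b" where
  "cadd F G = (\<lambda>x\<in>M. F x \<oplus> G x)"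

definition czero :: "'x \<Rightarrow> 'b" where
  "czero = (\<lambda>x\<in>M. \<zero>)"

definition cact :: "('x \<Rightarrow> 'b) \<Rightarrow> 'b \<Rightarrow> 'x \<Rightarrow> 'b" where
  "cact F b = (\<lambda>x\<in>M. F x \<otimes> b)"

definition cip :: "('x \<Rightarrow> 'b) \<Rightarrow> ('x \<Rightarrow> 'b) \<Rightarrow> 'b" where
  "cip F G = (THE l. l \<in> carrier B \<and> (\<exists>C. \<forall>\<epsilon>>0. \<forall>y. approx F \<epsilon> y \<longrightarrow> \<parallel>G y \<ominus> l\<parallel> \<le> C * \<epsilon>))"

text \<open>Null vectors become the zero functional, so that passing to functionals performs the
  quotient by them.\<close>

definition embed :: "'x \<Rightarrow> 'x \<Rightarrow> 'b" where
  "embed y = (\<lambda>x\<in>M. ip x y)"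

lemma approxI:
  "\<lbrakk>y \<in> M; \<And>x. x \<in> M \<Longrightarrow> \<parallel>F x \<ominus> ip x y\<parallel> \<le> \<epsilon> * nrm x\<rbrakk> \<Longrightarrow> approx F \<epsilon> y"
  by (simp add: approx_def)

lemma approx_carrier: "approx F \<epsilon> y \<Longrightarrow> y \<in> M"
  by (simp add: approx_def)

lemma approxD: "approx F \<epsilon> y \<Longrightarrow> x \<in> M \<Longrightarrow> \<parallel>F x \<ominus> ip x y\<parallel> \<le> \<epsilon> * nrm x"
  by (simp add: approx_def)

declare approx_carrier [simp]

lemma completionI:
  assumes "F \<in> extensional M" "\<And>x. x \<in> M \<Longrightarrow> F x \<in> carrier B"
    and "\<And>\<epsilon>. 0 < \<epsilon> \<Longrightarrow> \<exists>y. approx F \<epsilon> y"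
  shows "F \<in> completion"
  using assms by (auto simp: completion_def PiE_iff)

lemma completion_ext: "F \<in> completion \<Longrightarrow> F \<in> extensional M"
  by (auto simp: completion_def PiE_iff)

lemma completion_eval [simp]: "\<lbrakk>F \<in> completion; x \<in> M\<rbrakk> \<Longrightarrow> F x \<in> carrier B"
  by (auto simp: completion_def PiE_iff)

lemma completion_approx: "\<lbrakk>F \<in> completion; 0 < \<epsilon>\<rbrakk> \<Longrightarrow> \<exists>y. approx F \<epsilon> y"
  by (auto simp: completion_def)

lemma completion_eqI: "\<lbrakk>F \<in> completion; G \<in> completion; \<And>x. x \<in> M \<Longrightarrow> F x = G x\<rbrakk> \<Longrightarrow> F = G"
  by (rule extensionalityI[OF completion_ext completion_ext])

lemma approx_diff:
  assumes F: "F \<in> completion" and y: "approx F \<epsilon> y" "approx F \<delta> z" and "0 \<le> \<epsilon>" "0 \<le> \<delta>"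
  shows "nrm (pdiff y z) \<le> \<epsilon> + \<delta>"
proof (rule nrm_le_of_dist_ip)
  note [simp] = y[THEN approx_carrier]
  fix x assume [simp]: "x \<in> M"
  show "\<parallel>ip x y \<ominus> ip x z\<parallel> \<le> (\<epsilon> + \<delta>) * nrm x"
    using norm_diff_triangle[of "ip x y" "F x" "ip x z"] approxD[OF y(1), of x] approxD[OF y(2), of x]
      norm_diff_commute[of "F x" "ip x y"] F by (simp add: distrib_right)
qed (use assms in auto)

lemma completion_add:
  assumes F [simp]: "F \<in> completion" and x [simp]: "x \<in> M" "z \<in> M"
  shows "F (padd x z) = F x \<oplus> F z"
proof (rule eq_of_norm_le)
  fix e :: real assume "0 < e"
  then obtain y where y: "approx F e y" using completion_approx[OF F] by blast
  then have [simp]: "y \<in> M" by simp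
  have c: "F x \<in> carrier B" "F z \<in> carrier B" "ip x y \<in> carrier B" "ip z y \<in> carrier B" by auto
  have "ip (padd x z) y \<ominus> (F x \<oplus> F z) = (ip x y \<ominus> F x) \<oplus> (ip z y \<ominus> F z)"
    by (simp add: ip_add_left) (use c in algebra)
  then have "\<parallel>ip (padd x z) y \<ominus> (F x \<oplus> F z)\<parallel> \<le> \<parallel>F x \<ominus> ip x y\<parallel> + \<parallel>F z \<ominus> ip z y\<parallel>"
    using norm_triangle[of "ip x y \<ominus> F x" "ip z y \<ominus> F z"]
      norm_diff_commute[of "F x" "ip x y"] norm_diff_commute[of "F z" "ip z y"] c by simp
  then have "\<parallel>F (padd x z) \<ominus> (F x \<oplus> F z)\<parallel> \<le> e * nrm (padd x z) + (e * nrm x + e * nrm z)"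
    using norm_diff_triangle[of "F (padd x z)" "ip (padd x z) y" "F x \<oplus> F z"]
      approxD[OF y, of x] approxD[OF y, of z] approxD[OF y, of "padd x z"] by simp
  then show "\<parallel>F (padd x z) \<ominus> (F x \<oplus> F z)\<parallel> \<le> (nrm (padd x z) + nrm x + nrm z) * e"
    by (simp add: algebra_simps)
qed auto

lemma completion_act:
  assumes F [simp]: "F \<in> completion" and x [simp]: "x \<in> M" and b [simp]: "b \<in> carrier B"
  shows "F (act x b) = b\<^sup>\<star> \<otimes> F x"
proof (rule eq_of_norm_le)
  fix e :: real assume "0 < e"
  then obtain y where y: "approx F e y" using completion_approx[OF F] by blast
  then have [simp]: "y \<in> M" by simp
  have c: "b\<^sup>\<star> \<in> carrier B" "F x \<in> carrier B" "ip x y \<in> carrier B" by auto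
  have "ip (act x b) y \<ominus> b\<^sup>\<star> \<otimes> F x = b\<^sup>\<star> \<otimes> (ip x y \<ominus> F x)"
    by (simp add: ip_act_left) (use c in algebra)
  then have "\<parallel>ip (act x b) y \<ominus> b\<^sup>\<star> \<otimes> F x\<parallel> \<le> \<parallel>b\<parallel> * \<parallel>F x \<ominus> ip x y\<parallel>"
    using norm_mult[of "b\<^sup>\<star>" "ip x y \<ominus> F x"] norm_diff_commute[of "F x" "ip x y"] by simp
  also have "\<dots> \<le> \<parallel>b\<parallel> * (e * nrm x)"
    by (intro mult_left_mono approxD[OF y] norm_nonneg) auto
  finally have "\<parallel>F (act x b) \<ominus> b\<^sup>\<star> \<otimes> F x\<parallel> \<le> e * nrm (act x b) + \<parallel>b\<parallel> * (e * nrm x)"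
    using norm_diff_triangle[of "F (act x b)" "ip (act x b) y" "b\<^sup>\<star> \<otimes> F x"]
      approxD[OF y, of "act x b"] by simp
  then show "\<parallel>F (act x b) \<ominus> b\<^sup>\<star> \<otimes> F x\<parallel> \<le> (nrm (act x b) + \<parallel>b\<parallel> * nrm x) * e"
    by (simp add: algebra_simps)
qed auto

lemma completion_diff:
  "\<lbrakk>F \<in> completion; x \<in> M; y \<in> M\<rbrakk> \<Longrightarrow> F (pdiff x y) = F x \<ominus> F y"
  by (simp add: pdiff_def completion_add completion_act star_a_inv l_minus a_minus_def)

text \<open>Elements of the completion do not see the difference between formal sums that represent
  the same vector. This replaces computing in a quotient.\<close>

lemma completion_cong:
  assumes F [simp]: "F \<in> completion" and x [simp]: "x \<in> M" "y \<in> M"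
    and eq: "\<And>z. z \<in> M \<Longrightarrow> ip x z = ip y z"
  shows "F x = F y"
proof (rule eq_of_norm_le)
  fix e :: real assume "0 < e"
  then obtain z where z: "approx F e z" using completion_approx[OF F] by blast
  then have [simp]: "z \<in> M" by simp
  show "\<parallel>F x \<ominus> F y\<parallel> \<le> (nrm x + nrm y) * e"
    using norm_diff_triangle[of "F x" "ip x z" "F y"] approxD[OF z, of x] approxD[OF z, of y] eq[of z]
      norm_diff_commute[of "F y" "ip y z"] by (simp add: algebra_simps)
qed auto

lemma completion_bounded:
  assumes F [simp]: "F \<in> completion"
  obtains C where "0 \<le> C" "\<And>x. x \<in> M \<Longrightarrow> \<parallel>F x\<parallel> \<le> C * nrm x"
proof -
  obtain y where y: "approx F 1 y" using completion_approx[OF F, of 1] by auto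
  then have [simp]: "y \<in> M" by simp
  have "\<parallel>F x\<parallel> \<le> (1 + nrm y) * nrm x" if "x \<in> M" for x
    using norm_le_diff[of "F x" "ip x y"] approxD[OF y that] norm_ip_le[of x y] that
    by (simp add: algebra_simps)
  moreover have "0 \<le> 1 + nrm y" using nrm_nonneg[OF \<open>y \<in> M\<close>] by linarith
  ultimately show ?thesis using that by blast
qed

text \<open>The functional is tested at its own approximant \<open>y\<close>, where it is close to
  <y, y>.\<close>

lemma nrm_approx_le:
  assumes F [simp]: "F \<in> completion" and y: "approx F \<epsilon> y" and "0 \<le> \<epsilon>"
    and C: "0 \<le> C" "\<And>x. x \<in> M \<Longrightarrow> \<parallel>F x\<parallel> \<le> C * nrm x"
  shows "nrm y \<le> C + \<epsilon>"
proof (rule nrm_le_of_ip_le)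
  show [simp]: "y \<in> M" using y by simp
  show "\<parallel>ip y y\<parallel> \<le> (C + \<epsilon>) * nrm y"
    using norm_le_diff[of "ip y y" "F y"] norm_diff_commute[of "F y" "ip y y"] C(2)[of y]
      approxD[OF y, of y] by (simp add: algebra_simps)
qed (use assms in auto)

text \<open>All computations of \<open>cip\<close> go through this: a linear error estimate over all
  approximants identifies the limit, without fixing a sequence.\<close>

lemma cip_eqI:
  assumes F [simp]: "F \<in> completion" and G [simp]: "G \<in> completion" and l [simp]: "l \<in> carrier B"
    and C: "\<And>\<epsilon> y. 0 < \<epsilon> \<Longrightarrow> approx F \<epsilon> y \<Longrightarrow> \<parallel>G y \<ominus> l\<parallel> \<le> C * \<epsilon>"
  shows "cip F G = l"
  unfolding cip_def
proof (rule the_equality)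
  show "l \<in> carrier B \<and> (\<exists>C. \<forall>\<epsilon>>0. \<forall>y. approx F \<epsilon> y \<longrightarrow> \<parallel>G y \<ominus> l\<parallel> \<le> C * \<epsilon>)" using C by auto
  fix k assume k: "k \<in> carrier B \<and> (\<exists>C. \<forall>\<epsilon>>0. \<forall>y. approx F \<epsilon> y \<longrightarrow> \<parallel>G y \<ominus> k\<parallel> \<le> C * \<epsilon>)"
  then obtain D where D: "\<And>\<epsilon> y. 0 < \<epsilon> \<Longrightarrow> approx F \<epsilon> y \<Longrightarrow> \<parallel>G y \<ominus> k\<parallel> \<le> D * \<epsilon>" by blast
  from k have [simp]: "k \<in> carrier B" by simp
  show "k = l"
  proof (rule eq_of_norm_le)
    fix e :: real assume "0 < e"
    then obtain y where y: "approx F e y" using completion_approx[OF F] by blast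
    show "\<parallel>k \<ominus> l\<parallel> \<le> (D + C) * e"
      using norm_diff_triangle[of k "G y" l] D[OF \<open>0 < e\<close> y] C[OF \<open>0 < e\<close> y] y
        norm_diff_commute[of k "G y"] by (simp add: algebra_simps)
  qed auto
qed

text \<open>Two approximants of \<open>F\<close> are as close as their precisions allow, and
  \<open>G\<close> is Lipschitz, so its values along approximants of precision 1/(n+1) are Cauchy.
  The bound C of \<open>G\<close> is also the constant in the rate; by uniqueness of the limit the
  value is the same for every such C.\<close>

lemma cip_approx:
  assumes F [simp]: "F \<in> completion" and G [simp]: "G \<in> completion"
  shows cip_closed: "cip F G \<in> carrier B"
    and cip_approx_le: "\<lbrakk>0 \<le> C; \<And>x. x \<in> M \<Longrightarrow> \<parallel>G x\<parallel> \<le> C * nrm x; 0 < \<epsilon>; approx F \<epsilon> y\<rbrakk>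
      \<Longrightarrow> \<parallel>G y \<ominus> cip F G\<parallel> \<le> C * \<epsilon>"
proof -
  have main: "\<exists>l\<in>carrier B. \<forall>\<epsilon>>0. \<forall>y. approx F \<epsilon> y \<longrightarrow> \<parallel>G y \<ominus> l\<parallel> \<le> C * \<epsilon>"
    if C0: "0 \<le> C" and C: "\<And>x. x \<in> M \<Longrightarrow> \<parallel>G x\<parallel> \<le> C * nrm x" for C
  proof -
    have d: "\<parallel>G y \<ominus> G z\<parallel> \<le> C * (\<epsilon> + \<delta>)"
      if y: "approx F \<epsilon> y" and z: "approx F \<delta> z" and "0 \<le> \<epsilon>" "0 \<le> \<delta>" for \<epsilon> \<delta> y z
    proof -
      have "\<parallel>G y \<ominus> G z\<parallel> = \<parallel>G (pdiff y z)\<parallel>" using y z by (simp add: completion_diff)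
      also have "\<dots> \<le> C * nrm (pdiff y z)" using y z by (intro C) auto
      also have "\<dots> \<le> C * (\<epsilon> + \<delta>)" using that C0 by (intro mult_left_mono approx_diff[OF F]) auto
      finally show ?thesis .
    qed
    have "\<exists>y. approx F (1 / real (Suc n)) y" for n by (rule completion_approx) auto
    then obtain y where y: "\<And>n. approx F (1 / real (Suc n)) (y n)" by metis
    have [simp]: "y n \<in> M" for n using y by (rule approx_carrier)
    have lim: "(\<lambda>n. 1 / real (Suc n)) \<longlonglongrightarrow> 0" using LIMSEQ_inverse_real_of_nat by (simp add: inverse_eq_divide)
    have "\<exists>l\<in>carrier B. (\<lambda>n. \<parallel>G (y n) \<ominus> l\<parallel>) \<longlonglongrightarrow> 0"
    proof (rule complete)
      show "\<forall>e>0. \<exists>N. \<forall>m\<ge>N. \<forall>n\<ge>N. \<parallel>G (y m) \<ominus> G (y n)\<parallel> < e"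
      proof (intro allI impI)
        fix e :: real assume e: "0 < e"
        \<comment> \<open>Here C + 1 replaces C because C may vanish; it also makes the final
          inequality strict.\<close>
        define d0 where "d0 = e / (2 * (C + 1))"
        have d0: "0 < d0" "2 * (C + 1) * d0 = e" using e C0 by (simp_all add: d0_def)
        then obtain N where N: "\<And>n. n \<ge> N \<Longrightarrow> 1 / real (Suc n) < d0"
          using LIMSEQ_D[OF lim] by force
        have "\<parallel>G (y m) \<ominus> G (y n)\<parallel> < e" if "m \<ge> N" "n \<ge> N" for m n
        proof -
          have "\<parallel>G (y m) \<ominus> G (y n)\<parallel> \<le> C * (1 / real (Suc m) + 1 / real (Suc n))"
            by (rule d[OF y y]) auto
          also have "\<dots> \<le> C * (d0 + d0)"
            using N[OF that(1)] N[OF that(2)] C0 by (intro mult_left_mono add_mono) auto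
          also have "\<dots> = 2 * (C + 1) * d0 - 2 * d0" by (simp add: algebra_simps)
          also have "\<dots> < e" using d0 by simp
          finally show ?thesis .
        qed
        then show "\<exists>N. \<forall>m\<ge>N. \<forall>n\<ge>N. \<parallel>G (y m) \<ominus> G (y n)\<parallel> < e" by blast
      qed
    qed simp
    then obtain l where l [simp]: "l \<in> carrier B" and ll: "(\<lambda>n. \<parallel>G (y n) \<ominus> l\<parallel>) \<longlonglongrightarrow> 0" by blast
    have "\<parallel>G z \<ominus> l\<parallel> \<le> C * \<epsilon>" if "0 < \<epsilon>" and z: "approx F \<epsilon> z" for \<epsilon> z
    proof (rule LIMSEQ_le_const)
      have "(\<lambda>n. C * (\<epsilon> + 1 / real (Suc n)) + \<parallel>G (y n) \<ominus> l\<parallel>) \<longlonglongrightarrow> C * (\<epsilon> + 0) + 0"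
        by (intro tendsto_intros lim ll)
      then show "(\<lambda>n. C * (\<epsilon> + 1 / real (Suc n)) + \<parallel>G (y n) \<ominus> l\<parallel>) \<longlonglongrightarrow> C * \<epsilon>" by simp
      have "\<parallel>G z \<ominus> l\<parallel> \<le> C * (\<epsilon> + 1 / real (Suc n)) + \<parallel>G (y n) \<ominus> l\<parallel>" for n
        using norm_diff_triangle[of "G z" "G (y n)" l] d[OF z y[of n]] z \<open>0 < \<epsilon>\<close> by simp
      then show "\<exists>N. \<forall>n\<ge>N. \<parallel>G z \<ominus> l\<parallel> \<le> C * (\<epsilon> + 1 / real (Suc n)) + \<parallel>G (y n) \<ominus> l\<parallel>" by blast
    qed
    then show ?thesis using l by blast
  qed
  obtain D where "0 \<le> D" "\<And>x. x \<in> M \<Longrightarrow> \<parallel>G x\<parallel> \<le> D * nrm x"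
    by (rule completion_bounded[OF G]) (rule that)
  from main[OF this] show "cip F G \<in> carrier B" using cip_eqI[OF F G] by metis
  assume "0 \<le> C" "\<And>x. x \<in> M \<Longrightarrow> \<parallel>G x\<parallel> \<le> C * nrm x" "0 < \<epsilon>" "approx F \<epsilon> y"
  with main[OF this(1,2)] show "\<parallel>G y \<ominus> cip F G\<parallel> \<le> C * \<epsilon>" using cip_eqI[OF F G] by metis
qed

lemma cadd_closed [simp]: assumes "F \<in> completion" "G \<in> completion" shows "cadd F G \<in> completion"
proof (rule completionI)
  fix e :: real assume "0 < e"
  then obtain y z where y: "approx F (e/2) y" and z: "approx G (e/2) z"
    using completion_approx assms by (meson half_gt_zero)
  then have [simp]: "y \<in> M" "z \<in> M" by simp_all
  have "approx (cadd F G) e (padd y z)"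
  proof (rule approxI)
    fix x assume [simp]: "x \<in> M"
    have c: "F x \<in> carrier B" "G x \<in> carrier B" "ip x y \<in> carrier B" "ip x z \<in> carrier B"
      using assms by auto
    have "cadd F G x \<ominus> ip x (padd y z) = (F x \<ominus> ip x y) \<oplus> (G x \<ominus> ip x z)"
      by (simp add: cadd_def ip_add) (use c in algebra)
    then show "\<parallel>cadd F G x \<ominus> ip x (padd y z)\<parallel> \<le> e * nrm x"
      using norm_triangle[of "F x \<ominus> ip x y" "G x \<ominus> ip x z"] c approxD[OF y, of x] approxD[OF z, of x]
      by simp
  qed simp
  then show "\<exists>y. approx (cadd F G) e y" by blast
qed (use assms in \<open>auto simp: cadd_def\<close>)

lemma czero_closed [simp]: "czero \<in> completion"
proof (rule completionI)
  fix e :: real assume "0 < e"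
  then have "approx czero e pzero" by (intro approxI) (auto simp: czero_def ip_zero a_minus_def)
  then show "\<exists>y. approx czero e y" by blast
qed (auto simp: czero_def)

lemma czero_eval: "x \<in> M \<Longrightarrow> czero x = \<zero>"
  by (simp add: czero_def)

lemma cact_closed [simp]:
  assumes F: "F \<in> completion" and [simp]: "b \<in> carrier B" shows "cact F b \<in> completion"
proof (rule completionI)
  fix e :: real assume e: "0 < e"
  have b: "0 < \<parallel>b\<parallel> + 1" using norm_nonneg[of b] by simp
  then obtain y where y: "approx F (e / (\<parallel>b\<parallel> + 1)) y" using completion_approx[OF F] e by (meson divide_pos_pos)
  then have [simp]: "y \<in> M" by simp
  have "approx (cact F b) e (act y b)"
  proof (rule approxI)
    fix x assume x [simp]: "x \<in> M"
    have c: "F x \<in> carrier B" "ip x y \<in> carrier B" "b \<in> carrier B" using F by auto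
    have "cact F b x \<ominus> ip x (act y b) = (F x \<ominus> ip x y) \<otimes> b"
      by (simp add: cact_def ip_act) (use c in algebra)
    then have "\<parallel>cact F b x \<ominus> ip x (act y b)\<parallel> \<le> \<parallel>F x \<ominus> ip x y\<parallel> * \<parallel>b\<parallel>" using norm_mult c by simp
    also have "\<dots> \<le> (e / (\<parallel>b\<parallel> + 1) * nrm x) * \<parallel>b\<parallel>"
      by (intro mult_right_mono approxD[OF y] norm_nonneg) auto
    also have "\<dots> = (e * nrm x) * (\<parallel>b\<parallel> / (\<parallel>b\<parallel> + 1))" by simp
    also have "\<dots> \<le> (e * nrm x) * 1" using b e by (intro mult_left_mono) auto
    finally show "\<parallel>cact F b x \<ominus> ip x (act y b)\<parallel> \<le> e * nrm x" by simp
  qed simp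
  then show "\<exists>y. approx (cact F b) e y" by blast
qed (use assms in \<open>auto simp: cact_def\<close>)

lemma semi_hilbert_completion: "semi_hilbert B completion cadd czero cact cip"
proof (intro semi_hilbert.intro semi_hilbert_axioms.intro cstar_algebra_axioms cadd_closed
    czero_closed cact_closed cip_closed)
  fix F G H b
  assume F [simp]: "F \<in> completion" and G [simp]: "G \<in> completion"
  obtain CF where CF: "0 \<le> CF" "\<And>x. x \<in> M \<Longrightarrow> \<parallel>F x\<parallel> \<le> CF * nrm x"
    by (rule completion_bounded[OF F]) (rule that)
  obtain CG where CG: "0 \<le> CG" "\<And>x. x \<in> M \<Longrightarrow> \<parallel>G x\<parallel> \<le> CG * nrm x"
    by (rule completion_bounded[OF G]) (rule that)
  note [simp] = cip_closed[OF F G]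
  show "cip F (cadd G H) = cip F G \<oplus> cip F H" if H [simp]: "H \<in> completion"
  proof -
    obtain CH where CH: "0 \<le> CH" "\<And>x. x \<in> M \<Longrightarrow> \<parallel>H x\<parallel> \<le> CH * nrm x"
      by (rule completion_bounded[OF H]) (rule that)
    note [simp] = cip_closed[OF F H]
    show ?thesis
    proof (rule cip_eqI)
      fix e y assume e: "0 < e" and y: "approx F e y"
      have c: "G y \<in> carrier B" "H y \<in> carrier B" "cip F G \<in> carrier B" "cip F H \<in> carrier B"
        using y by auto
      have "cadd G H y \<ominus> (cip F G \<oplus> cip F H) = (G y \<ominus> cip F G) \<oplus> (H y \<ominus> cip F H)"
        using y by (simp add: cadd_def) (use c in algebra)
      then show "\<parallel>cadd G H y \<ominus> (cip F G \<oplus> cip F H)\<parallel> \<le> (CG + CH) * e"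
        using norm_triangle[of "G y \<ominus> cip F G" "H y \<ominus> cip F H"] c
          cip_approx_le[OF F G CG e y] cip_approx_le[OF F H CH e y] by (simp add: distrib_right)
    qed auto
  qed
  show "cip F (cact G b) = cip F G \<otimes> b" if b [simp]: "b \<in> carrier B"
  proof (rule cip_eqI)
    fix e y assume e: "0 < e" and y: "approx F e y"
    have c: "G y \<in> carrier B" "cip F G \<in> carrier B" "b \<in> carrier B" using y by auto
    have "cact G b y \<ominus> cip F G \<otimes> b = (G y \<ominus> cip F G) \<otimes> b"
      using y by (simp add: cact_def) (use c in algebra)
    then have "\<parallel>cact G b y \<ominus> cip F G \<otimes> b\<parallel> \<le> \<parallel>G y \<ominus> cip F G\<parallel> * \<parallel>b\<parallel>" using norm_mult c by simp
    also have "\<dots> \<le> (CG * e) * \<parallel>b\<parallel>"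
      by (intro mult_right_mono cip_approx_le[OF F G CG e y] norm_nonneg b)
    finally show "\<parallel>cact G b y \<ominus> cip F G \<otimes> b\<parallel> \<le> (CG * \<parallel>b\<parallel>) * e" by (simp add: mult_ac)
  qed auto
  show "(cip F G)\<^sup>\<star> = cip G F"
  proof (rule sym, rule cip_eqI)
    fix e z assume e: "0 < e" and z: "approx G e z"
    show "\<parallel>F z \<ominus> (cip F G)\<^sup>\<star>\<parallel> \<le> CF * e"
    proof (rule le_of_le_add_mult)
      \<comment> \<open>A second approximant y, of \<open>F\<close> with precision \<open>d\<close>,
        links the sides: F z is close to <z, y> = <y, z>*, which is close to (G y)*, which is close
        to the adjoint of \<open>cip F G\<close>. Only the middle error, at most e(CF + d), survives
        as \<open>d\<close> tends to 0.\<close>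
      fix d :: real assume d: "0 < d"
      then obtain y where y: "approx F d y" using completion_approx[OF F] by blast
      note [simp] = y[THEN approx_carrier] z[THEN approx_carrier]
      have "\<parallel>(G y)\<^sup>\<star> \<ominus> (cip F G)\<^sup>\<star>\<parallel> = \<parallel>G y \<ominus> cip F G\<parallel>" by (simp flip: star_diff)
      also have "\<dots> \<le> CG * d" by (rule cip_approx_le[OF F G CG d y])
      finally have 1: "\<parallel>(G y)\<^sup>\<star> \<ominus> (cip F G)\<^sup>\<star>\<parallel> \<le> CG * d" .
      have "\<parallel>(G y)\<^sup>\<star> \<ominus> ip z y\<parallel> = \<parallel>G y \<ominus> ip y z\<parallel>"
        using norm_star[of "G y \<ominus> ip y z"] by (simp add: star_diff ip_star)
      also have "\<dots> \<le> e * nrm y" by (rule approxD[OF z]) simp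
      also have "\<dots> \<le> e * (CF + d)"
        using e d nrm_approx_le[OF F y _ CF] by (intro mult_left_mono) auto
      finally have 2: "\<parallel>ip z y \<ominus> (G y)\<^sup>\<star>\<parallel> \<le> e * (CF + d)"
        using norm_diff_commute[of "(G y)\<^sup>\<star>" "ip z y"] by simp
      have 3: "\<parallel>F z \<ominus> ip z y\<parallel> \<le> d * nrm z" by (rule approxD[OF y]) simp
      have "\<parallel>F z \<ominus> (cip F G)\<^sup>\<star>\<parallel> \<le> d * nrm z + (e * (CF + d) + CG * d)"
        using norm_diff_triangle[of "F z" "ip z y" "(cip F G)\<^sup>\<star>"]
          norm_diff_triangle[of "ip z y" "(G y)\<^sup>\<star>" "(cip F G)\<^sup>\<star>"] 1 2 3 by simp
      then show "\<parallel>F z \<ominus> (cip F G)\<^sup>\<star>\<parallel> \<le> CF * e + (nrm z + e + CG) * d" by (simp add: algebra_simps)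
    qed
  qed auto
next
  fix F assume F [simp]: "F \<in> completion"
  obtain CF where CF: "0 \<le> CF" "\<And>x. x \<in> M \<Longrightarrow> \<parallel>F x\<parallel> \<le> CF * nrm x"
    by (rule completion_bounded[OF F]) (rule that)
  note [simp] = cip_closed[OF F F]
  show "cip F czero = \<zero>"
    by (rule cip_eqI[where C = 0]) (auto simp: czero_eval a_minus_def)
  show "pos (cip F F)"
  proof (rule pos_closed)
    fix e :: real assume e: "0 < e"
    \<comment> \<open>For d <= 1 an approximant y has norm at most CF + 1, so <y, y> differs from
      \<open>cip F F\<close> by at most CF d + d (CF + 1), which equals (2 CF + 1) d.\<close>
    define q where "q = e / (2 * CF + 1)"
    have "2 * CF + 1 \<noteq> 0" using CF(1) by linarith
    then have q: "0 < q" "(2 * CF + 1) * q = e" using e CF(1) by (simp_all add: q_def)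
    define d where "d = min 1 q"
    have "(2 * CF + 1) * d \<le> (2 * CF + 1) * q"
      using CF(1) by (intro mult_left_mono) (simp_all add: d_def)
    then have d: "0 < d" "d \<le> 1" "(2 * CF + 1) * d \<le> e" using q by (simp_all add: d_def)
    obtain y where y: "approx F d y" using completion_approx[OF F d(1)] by blast
    then have [simp]: "y \<in> M" by simp
    have "\<parallel>F y \<ominus> ip y y\<parallel> \<le> d * nrm y" by (rule approxD[OF y]) simp
    also have "\<dots> \<le> d * (CF + 1)"
      using d nrm_approx_le[OF F y _ CF] by (intro mult_left_mono) auto
    finally have "\<parallel>cip F F \<ominus> ip y y\<parallel> \<le> CF * d + d * (CF + 1)"
      using norm_diff_triangle[of "cip F F" "F y" "ip y y"] cip_approx_le[OF F F CF d(1) y]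
        norm_diff_commute[of "F y" "cip F F"] by simp
    also have "\<dots> \<le> e" using d(3) by (simp add: algebra_simps)
    finally show "\<exists>p. pos p \<and> \<parallel>cip F F \<ominus> p\<parallel> \<le> e" using ip_pos[of y] by auto
  qed simp
qed

interpretation C: semi_hilbert B completion cadd czero cact cip
  by (rule semi_hilbert_completion)

lemma approx_embed: "\<lbrakk>y \<in> M; 0 \<le> \<epsilon>\<rbrakk> \<Longrightarrow> approx (embed y) \<epsilon> y"
  by (intro approxI) (auto simp: embed_def a_minus_def r_neg)

lemma embed_closed [simp]: "y \<in> M \<Longrightarrow> embed y \<in> completion"
  by (rule completionI) (auto simp: embed_def intro!: exI approx_embed[unfolded embed_def])

text \<open>A reproducing property: \<open>y\<close> approximates \<open>embed y\<close> with error
  0, so every approximant of precision e is within e of \<open>y\<close>, and \<open>F\<close> is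
  Lipschitz. It makes values of a functional accessible to Cauchy-Schwarz.\<close>

lemma cip_embed_left: assumes y [simp]: "y \<in> M" and F [simp]: "F \<in> completion"
  shows "cip (embed y) F = F y"
proof -
  obtain C where C: "0 \<le> C" "\<And>x. x \<in> M \<Longrightarrow> \<parallel>F x\<parallel> \<le> C * nrm x"
    by (rule completion_bounded[OF F]) (rule that)
  show ?thesis
  proof (rule cip_eqI)
    fix e z assume e: "0 < e" and z: "approx (embed y) e z"
    have "\<parallel>F z \<ominus> F y\<parallel> = \<parallel>F (pdiff z y)\<parallel>" using z by (simp add: completion_diff)
    also have "\<dots> \<le> C * nrm (pdiff z y)" using z by (intro C) auto
    also have "\<dots> \<le> C * (e + 0)"
      using e C by (intro mult_left_mono approx_diff[OF _ z approx_embed]) auto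
    finally show "\<parallel>F z \<ominus> F y\<parallel> \<le> C * e" by simp
  qed auto
qed

lemma nrm_embed: "y \<in> M \<Longrightarrow> C.nrm (embed y) = nrm y"
  by (simp add: C.nrm_def nrm_def cip_embed_left) (simp add: embed_def)

lemma norm_eval_le: "\<lbrakk>F \<in> completion; x \<in> M\<rbrakk> \<Longrightarrow> \<parallel>F x\<parallel> \<le> C.nrm F * nrm x"
  using C.norm_ip_le[of "embed x" F] by (simp add: cip_embed_left nrm_embed mult.commute)

text \<open>Together with \<open>norm_eval_le\<close> this identifies the norm of the completion
  with the norm as a functional. The inner product of \<open>F\<close> with itself is close to F y,
  and approximants y have norm at most C + d.\<close>

lemma nrm_completion_le:
  assumes F [simp]: "F \<in> completion" and C: "0 \<le> C" "\<And>x. x \<in> M \<Longrightarrow> \<parallel>F x\<parallel> \<le> C * nrm x"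
  shows "C.nrm F \<le> C"
proof (rule power2_le_imp_le)
  note [simp] = cip_closed[OF F F]
  show "(C.nrm F)\<^sup>2 \<le> C\<^sup>2"
  proof (rule le_of_le_add_mult)
    fix d :: real assume d: "0 < d"
    then obtain y where y: "approx F d y" using completion_approx[OF F] by blast
    then have [simp]: "y \<in> M" by simp
    have "\<parallel>F y\<parallel> \<le> C * nrm y" by (rule C) simp
    also have "\<dots> \<le> C * (C + d)" using d C nrm_approx_le[OF F y _ C] by (intro mult_left_mono) auto
    finally have "\<parallel>cip F F\<parallel> \<le> C * d + C * (C + d)"
      using norm_le_diff[of "cip F F" "F y"] cip_approx_le[OF F F C d y]
        norm_diff_commute[of "F y" "cip F F"] by simp
    then show "(C.nrm F)\<^sup>2 \<le> C\<^sup>2 + (2 * C) * d"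
      by (simp add: C.nrm_square) (simp add: power2_eq_square algebra_simps)
  qed
qed (rule C)

lemma cdiff_eval: "\<lbrakk>F \<in> completion; G \<in> completion; x \<in> M\<rbrakk> \<Longrightarrow> C.pdiff F G x = F x \<ominus> G x"
  by (simp add: C.pdiff_def cadd_def cact_def r_minus a_minus_def)

text \<open>Evaluations against embedded vectors separate functionals. A Cauchy sequence converges
  at each x, uniformly relative to \<open>nrm x\<close>, so an approximant of a late term also
  approximates the limit.\<close>

theorem hilbert_module_completion: "hilbert_module B completion cadd czero cact cip"
proof (intro hilbert_module.intro hilbert_module_axioms.intro semi_hilbert_completion)
  fix F G assume "F \<in> completion" "G \<in> completion" "\<And>H. H \<in> completion \<Longrightarrow> cip H F = cip H G"
  then show "F = G" by (intro completion_eqI) (metis cip_embed_left embed_closed)+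
next
  fix s :: "nat \<Rightarrow> 'x \<Rightarrow> 'b"
  assume s [simp]: "\<And>n. s n \<in> completion"
    and C: "\<forall>\<epsilon>>0. \<exists>N. \<forall>m\<ge>N. \<forall>n\<ge>N. C.nrm (C.pdiff (s m) (s n)) < \<epsilon>"
  have C': "\<parallel>s m x \<ominus> s n x\<parallel> \<le> C.nrm (C.pdiff (s m) (s n)) * nrm x" if "x \<in> M" for m n x
    using norm_eval_le[of "C.pdiff (s m) (s n)" x] that by (simp add: cdiff_eval)
  have "\<exists>l\<in>carrier B. (\<lambda>n. \<parallel>s n x \<ominus> l\<parallel>) \<longlonglongrightarrow> 0" if x: "x \<in> M" for x
  proof (rule complete)
    show "\<forall>e>0. \<exists>N. \<forall>m\<ge>N. \<forall>n\<ge>N. \<parallel>s m x \<ominus> s n x\<parallel> < e"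
    proof (intro allI impI)
      fix e :: real assume e: "0 < e"
      have p: "0 < nrm x + 1" using nrm_nonneg[OF x] by linarith
      then obtain N where N: "\<forall>m\<ge>N. \<forall>n\<ge>N. C.nrm (C.pdiff (s m) (s n)) < e / (nrm x + 1)"
        using C e by (meson divide_pos_pos)
      have "\<parallel>s m x \<ominus> s n x\<parallel> < e" if "m \<ge> N" "n \<ge> N" for m n
      proof -
        have "\<parallel>s m x \<ominus> s n x\<parallel> \<le> e / (nrm x + 1) * nrm x"
          using N that x by (intro order_trans[OF C'[OF x]] mult_right_mono) (auto intro: less_imp_le)
        also have "\<dots> < e" using e p by (simp add: field_simps)
        finally show ?thesis .
      qed
      then show "\<exists>N. \<forall>m\<ge>N. \<forall>n\<ge>N. \<parallel>s m x \<ominus> s n x\<parallel> < e" by blast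
    qed
  qed (simp add: x)
  then obtain F where F: "\<And>x. x \<in> M \<Longrightarrow> F x \<in> carrier B \<and> (\<lambda>n. \<parallel>s n x \<ominus> F x\<parallel>) \<longlonglongrightarrow> 0" by metis
  have lim: "\<exists>N. \<forall>n\<ge>N. \<forall>x\<in>M. \<parallel>s n x \<ominus> F x\<parallel> \<le> e * nrm x" if e: "0 < e" for e
  proof -
    obtain N where N: "\<forall>m\<ge>N. \<forall>n\<ge>N. C.nrm (C.pdiff (s m) (s n)) < e" using C e by blast
    have "\<parallel>s n x \<ominus> F x\<parallel> \<le> e * nrm x" if n: "n \<ge> N" and x: "x \<in> M" for n x
    proof (rule LIMSEQ_le_const)
      show "(\<lambda>m. e * nrm x + \<parallel>s m x \<ominus> F x\<parallel>) \<longlonglongrightarrow> e * nrm x"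
        using tendsto_add[OF tendsto_const[of "e * nrm x"] conjunct2[OF F[OF x]]] by simp
      have "\<parallel>s n x \<ominus> F x\<parallel> \<le> e * nrm x + \<parallel>s m x \<ominus> F x\<parallel>" if m: "m \<ge> N" for m
      proof -
        have "\<parallel>s n x \<ominus> s m x\<parallel> \<le> e * nrm x"
          using N m n x by (intro order_trans[OF C'[OF x]] mult_right_mono) (auto intro: less_imp_le)
        then show ?thesis using norm_diff_triangle[of "s n x" "s m x" "F x"] F[OF x] x by simp
      qed
      then show "\<exists>K. \<forall>m\<ge>K. \<parallel>s n x \<ominus> F x\<parallel> \<le> e * nrm x + \<parallel>s m x \<ominus> F x\<parallel>" by blast
    qed
    then show ?thesis by blast
  qed
  define G where "G = restrict F M"
  have G [simp]: "G \<in> completion"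
  proof (rule completionI)
    fix e :: real assume e: "0 < e"
    obtain n where n: "\<forall>x\<in>M. \<parallel>s n x \<ominus> F x\<parallel> \<le> e/2 * nrm x" using lim[of "e/2"] e by auto
    obtain y where y: "approx (s n) (e/2) y" using completion_approx[OF s, of "e/2"] e by auto
    then have [simp]: "y \<in> M" by simp
    have "\<parallel>F x \<ominus> ip x y\<parallel> \<le> e * nrm x" if x: "x \<in> M" for x
    proof -
      have "\<parallel>s n x \<ominus> F x\<parallel> \<le> e/2 * nrm x" using n x by blast
      then show ?thesis
        using norm_diff_triangle[of "F x" "s n x" "ip x y"] approxD[OF y x] F[OF x] x
          norm_diff_commute[of "s n x" "F x"] by simp
    qed
    then have "approx G e y" by (intro approxI) (auto simp: G_def)
    then show "\<exists>y. approx G e y" by blast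
  qed (use F in \<open>auto simp: G_def\<close>)
  have GF: "G x = F x" if "x \<in> M" for x using that by (simp add: G_def)
  have "(\<lambda>n. C.nrm (C.pdiff (s n) G)) \<longlonglongrightarrow> 0"
  proof (rule LIMSEQ_I)
    fix r :: real assume r: "0 < r"
    obtain N where N: "\<forall>n\<ge>N. \<forall>x\<in>M. \<parallel>s n x \<ominus> F x\<parallel> \<le> r/2 * nrm x" using lim[of "r/2"] r by auto
    have "C.nrm (C.pdiff (s n) G) \<le> r/2" if "n \<ge> N" for n
      using N that r GF by (intro nrm_completion_le) (auto simp: cdiff_eval)
    then have "\<forall>n\<ge>N. norm (C.nrm (C.pdiff (s n) G) - 0) < r" using r by force
    then show "\<exists>N. \<forall>n\<ge>N. norm (C.nrm (C.pdiff (s n) G) - 0) < r" by blast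
  qed
  then show "\<exists>l\<in>completion. (\<lambda>n. C.nrm (C.pdiff (s n) l)) \<longlonglongrightarrow> 0" using G by blast
qed

end

text \<open>Moves a Hilbert module to another type along an injection, as the type of the operators
  is prescribed.\<close>

lemma (in hilbert_module) transport:
  fixes \<phi> :: "'x \<Rightarrow> 'k"
  assumes inj: "inj_on \<phi> M"
  defines "\<psi> \<equiv> inv_into M \<phi>"
  shows "hilbert_module B (\<phi> ` M) (\<lambda>x y. \<phi> (padd (\<psi> x) (\<psi> y))) (\<phi> pzero)
    (\<lambda>x b. \<phi> (act (\<psi> x) b)) (\<lambda>x y. ip (\<psi> x) (\<psi> y))"
proof -
  have \<psi> [simp]: "\<psi> (\<phi> x) = x" if "x \<in> M" for x using inj that by (simp add: \<psi>_def)
  have semi: "semi_hilbert B (\<phi> ` M) (\<lambda>x y. \<phi> (padd (\<psi> x) (\<psi> y))) (\<phi> pzero)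
      (\<lambda>x b. \<phi> (act (\<psi> x) b)) (\<lambda>x y. ip (\<psi> x) (\<psi> y))"
    by (intro semi_hilbert.intro semi_hilbert_axioms.intro cstar_algebra_axioms)
      (auto simp: ip_add ip_zero ip_act ip_star ip_pos)
  interpret K: semi_hilbert B "\<phi> ` M" "\<lambda>x y. \<phi> (padd (\<psi> x) (\<psi> y))" "\<phi> pzero"
    "\<lambda>x b. \<phi> (act (\<psi> x) b)" "\<lambda>x y. ip (\<psi> x) (\<psi> y)" by (rule semi)
  have nd: "K.nrm (K.pdiff (\<phi> x) (\<phi> y)) = nrm (pdiff x y)" if "x \<in> M" "y \<in> M" for x y
    using that by (simp add: K.nrm_def nrm_def K.pdiff_def pdiff_def)
  show ?thesis
  proof (intro hilbert_module.intro hilbert_module_axioms.intro semi)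
    fix x y assume "x \<in> \<phi> ` M" "y \<in> \<phi> ` M"
      and eq: "\<And>z. z \<in> \<phi> ` M \<Longrightarrow> ip (\<psi> z) (\<psi> x) = ip (\<psi> z) (\<psi> y)"
    then obtain u v where u: "u \<in> M" "x = \<phi> u" and v: "v \<in> M" "y = \<phi> v" by blast
    have "ip w u = ip w v" if "w \<in> M" for w using eq[of "\<phi> w"] u v that by simp
    then have "u = v" by (intro eqI u v)
    then show "x = y" using u v by simp
  next
    fix s :: "nat \<Rightarrow> 'k"
    assume s: "\<And>n. s n \<in> \<phi> ` M"
      and C: "\<forall>\<epsilon>>0. \<exists>N. \<forall>m\<ge>N. \<forall>n\<ge>N. K.nrm (K.pdiff (s m) (s n)) < \<epsilon>"
    define t where "t n = \<psi> (s n)" for n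
    have t: "t n \<in> M \<and> s n = \<phi> (t n)" for n
      using s[of n] by (auto simp: t_def)
    have "\<exists>l\<in>M. (\<lambda>n. nrm (pdiff (t n) l)) \<longlonglongrightarrow> 0"
      using C t nd by (intro module_complete) simp_all
    then obtain l where "l \<in> M" "(\<lambda>n. nrm (pdiff (t n) l)) \<longlonglongrightarrow> 0" by blast
    then have "\<phi> l \<in> \<phi> ` M" "(\<lambda>n. K.nrm (K.pdiff (s n) (\<phi> l))) \<longlonglongrightarrow> 0" using t nd by simp_all
    then show "\<exists>l\<in>\<phi> ` M. (\<lambda>n. K.nrm (K.pdiff (s n) l)) \<longlonglongrightarrow> 0" by blast
  qed
qed

locale represented_completion = semi_hilbert B M padd pzero act ip
  for B :: "('b, 'm) cstar_scheme" (structure) and M :: "'x set" and padd pzero act ip +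
  fixes \<phi> :: "('x \<Rightarrow> 'b) \<Rightarrow> 'k"
  assumes inj_\<phi>: "inj_on \<phi> completion"
begin

definition \<psi> :: "'k \<Rightarrow> 'x \<Rightarrow> 'b" where "\<psi> = inv_into completion \<phi>"

definition kip :: "'k \<Rightarrow> 'k \<Rightarrow> 'b" where "kip x y = cip (\<psi> x) (\<psi> y)"

definition kact :: "'k \<Rightarrow> 'b \<Rightarrow> 'k" where "kact x b = \<phi> (cact (\<psi> x) b)"

definition kadd :: "'k \<Rightarrow> 'k \<Rightarrow> 'k" where "kadd x y = \<phi> (cadd (\<psi> x) (\<psi> y))"

sublocale K: hilbert_module B "\<phi> ` completion" kadd "\<phi> czero" kact kip
  unfolding kadd_def[abs_def] kact_def[abs_def] kip_def[abs_def] \<psi>_def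
  by (rule hilbert_module.transport[OF hilbert_module_completion inj_\<phi>])

lemma \<psi>_\<phi> [simp]: "F \<in> completion \<Longrightarrow> \<psi> (\<phi> F) = F"
  using inj_\<phi> by (simp add: \<psi>_def)

definition lift :: "('x \<Rightarrow> 'x) \<Rightarrow> ('x \<Rightarrow> 'b) \<Rightarrow> 'x \<Rightarrow> 'b" where
  "lift s F = (\<lambda>x\<in>M. F (s x))"

text \<open>If \<open>s\<close> is adjoint to \<open>t\<close>, then \<open>F \<mapsto> F \<circ> s\<close> extends \<open>t\<close> to the completion.\<close>

definition op :: "('x \<Rightarrow> 'x) \<Rightarrow> 'k \<Rightarrow> 'k" where
  "op s = (\<lambda>x\<in>\<phi> ` completion. \<phi> (lift s (\<psi> x)))"

text \<open>Symmetric in the two maps, so that each extends to the completion. The common bound is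
  strictly positive because precisions are divided by it.\<close>

definition adjointable :: "('x \<Rightarrow> 'x) \<Rightarrow> ('x \<Rightarrow> 'x) \<Rightarrow> bool" where
  "adjointable t s \<longleftrightarrow> (\<forall>x\<in>M. t x \<in> M \<and> s x \<in> M) \<and> (\<forall>x\<in>M. \<forall>y\<in>M. ip (t x) y = ip x (s y)) \<and>
    (\<exists>C>0. \<forall>x\<in>M. nrm (t x) \<le> C * nrm x \<and> nrm (s x) \<le> C * nrm x)"

lemma adjointableI:
  assumes t [simp]: "\<And>x. x \<in> M \<Longrightarrow> t x \<in> M" and s [simp]: "\<And>x. x \<in> M \<Longrightarrow> s x \<in> M"
    and ts: "\<And>x y. x \<in> M \<Longrightarrow> y \<in> M \<Longrightarrow> ip (t x) y = ip x (s y)"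
    and C: "0 \<le> C" "\<And>x. x \<in> M \<Longrightarrow> nrm (t x) \<le> C * nrm x"
  shows "adjointable t s"
proof -
  have 1: "nrm (t x) \<le> (C + 1) * nrm x" if "x \<in> M" for x
    using C(2)[OF that] nrm_nonneg[OF that] by (simp add: distrib_right del: nrm_nonneg)
  have "nrm (s y) \<le> (C + 1) * nrm y" if y [simp]: "y \<in> M" for y
  proof (rule nrm_le_of_ip_le)
    have "\<parallel>ip (s y) (s y)\<parallel> = \<parallel>ip (t (s y)) y\<parallel>" by (simp add: ts)
    also have "\<dots> \<le> nrm (t (s y)) * nrm y" by (intro norm_ip_le) auto
    also have "\<dots> \<le> ((C + 1) * nrm (s y)) * nrm y" by (intro mult_right_mono 1) auto
    finally show "\<parallel>ip (s y) (s y)\<parallel> \<le> (C + 1) * nrm y * nrm (s y)" by (simp add: mult_ac)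
  qed (use C in auto)
  then show ?thesis unfolding adjointable_def using 1 ts C(1)
    by (intro conjI exI[of _ "C + 1"]) auto
qed

lemma adjointable_sym: "adjointable t s \<Longrightarrow> adjointable s t"
  unfolding adjointable_def by (metis ip_star)

lemma adjointableD:
  "adjointable t s \<Longrightarrow> x \<in> M \<Longrightarrow> t x \<in> M"
  "adjointable t s \<Longrightarrow> x \<in> M \<Longrightarrow> s x \<in> M"
  "adjointable t s \<Longrightarrow> x \<in> M \<Longrightarrow> y \<in> M \<Longrightarrow> ip (t x) y = ip x (s y)"
  unfolding adjointable_def by blast+

lemma adjointable_bounded:
  assumes "adjointable t s"
  obtains C where "0 < C" "\<And>x. x \<in> M \<Longrightarrow> nrm (s x) \<le> C * nrm x"
  using assms unfolding adjointable_def by blast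

lemma approx_lift:
  assumes ts: "adjointable t s" and C: "\<And>x. x \<in> M \<Longrightarrow> nrm (s x) \<le> C * nrm x"
    and "0 \<le> \<epsilon>" and y: "approx F \<epsilon> y"
  shows "approx (lift s F) (C * \<epsilon>) (t y)"
proof (rule approxI)
  note [simp] = adjointableD(1,2)[OF ts] approx_carrier[OF y]
  show "t y \<in> M" by simp
  fix x assume [simp]: "x \<in> M"
  have "\<parallel>lift s F x \<ominus> ip x (t y)\<parallel> = \<parallel>F (s x) \<ominus> ip (s x) y\<parallel>"
    using adjointableD(3)[OF adjointable_sym[OF ts], of x y] by (simp add: lift_def)
  also have "\<dots> \<le> \<epsilon> * nrm (s x)" by (rule approxD[OF y]) simp
  also have "\<dots> \<le> \<epsilon> * (C * nrm x)" using assms by (intro mult_left_mono C) auto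
  finally show "\<parallel>lift s F x \<ominus> ip x (t y)\<parallel> \<le> C * \<epsilon> * nrm x" by (simp add: mult_ac)
qed

lemma lift_closed: assumes ts: "adjointable t s" and F: "F \<in> completion" shows "lift s F \<in> completion"
proof (rule completionI)
  obtain C where C: "0 < C" "\<And>x. x \<in> M \<Longrightarrow> nrm (s x) \<le> C * nrm x" by (rule adjointable_bounded[OF ts]) (rule that)
  fix e :: real assume e: "0 < e"
  then obtain y where y: "approx F (e / C) y" using completion_approx[OF F] C by (meson divide_pos_pos)
  have "approx (lift s F) (C * (e / C)) (t y)" using e C by (intro approx_lift[OF ts C(2) _ y]) auto
  then have "approx (lift s F) e (t y)" using C by simp
  then show "\<exists>y. approx (lift s F) e y" by blast
qed (use adjointableD[OF ts] F in \<open>auto simp: lift_def\<close>)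

text \<open>If y approximates \<open>F\<close>, then \<open>t y\<close> approximates
  \<open>lift s F\<close> with precision scaled by the bound of \<open>s\<close>, and
  \<open>lift t G\<close> at y is G at \<open>t y\<close>. Both inner products are thus limits of
  the same values.\<close>

lemma cip_lift:
  assumes ts: "adjointable t s" and F: "F \<in> completion" and G: "G \<in> completion"
  shows "cip (lift s F) G = cip F (lift t G)"
proof -
  obtain C where C: "0 < C" "\<And>x. x \<in> M \<Longrightarrow> nrm (s x) \<le> C * nrm x"
    by (rule adjointable_bounded[OF ts]) (rule that)
  obtain D where D: "0 \<le> D" "\<And>x. x \<in> M \<Longrightarrow> \<parallel>G x\<parallel> \<le> D * nrm x"
    by (rule completion_bounded[OF G]) (rule that)
  have sF: "lift s F \<in> completion" by (rule lift_closed[OF ts F])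
  have "cip F (lift t G) = cip (lift s F) G"
  proof (rule cip_eqI[OF F])
    show "lift t G \<in> completion" by (rule lift_closed[OF adjointable_sym[OF ts] G])
    show "cip (lift s F) G \<in> carrier B" by (rule cip_closed[OF sF G])
    fix e y assume e: "0 < e" and y: "approx F e y"
    have "\<parallel>G (t y) \<ominus> cip (lift s F) G\<parallel> \<le> D * (C * e)"
      using e C by (intro cip_approx_le[OF sF G D] approx_lift[OF ts C(2) _ y]) auto
    then show "\<parallel>lift t G y \<ominus> cip (lift s F) G\<parallel> \<le> (D * C) * e"
      using approx_carrier[OF y] by (simp add: lift_def mult_ac)
  qed
  then show ?thesis by simp
qed

lemma nrm_\<phi>: "F \<in> completion \<Longrightarrow> K.nrm (\<phi> F) = semi_hilbert.nrm B cip F"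
  by (simp add: K.nrm_def semi_hilbert.nrm_def[OF semi_hilbert_completion] kip_def)

lemma op_\<phi>: "F \<in> completion \<Longrightarrow> op s (\<phi> F) = \<phi> (lift s F)"
  by (simp add: op_def)

lemma op_in_ops: assumes ts: "adjointable t s" shows "op s \<in> K.ops"
proof -
  obtain C where C: "0 < C" "\<And>x. x \<in> M \<Longrightarrow> nrm (s x) \<le> C * nrm x" by (rule adjointable_bounded[OF ts]) (rule that)
  note [simp] = lift_closed[OF ts] lift_closed[OF adjointable_sym[OF ts]]
  have "K.is_adjoint (\<lambda>x. \<phi> (lift s (\<psi> x))) (\<lambda>x. \<phi> (lift t (\<psi> x)))"
    by (auto simp: K.is_adjoint_def kip_def cip_lift[OF ts])
  moreover have "K.bounded_by (\<lambda>x. \<phi> (lift s (\<psi> x))) C"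
    unfolding K.bounded_by_def
  proof (intro conjI ballI)
    fix x assume "x \<in> \<phi> ` completion"
    then obtain F where x: "x = \<phi> F" and F [simp]: "F \<in> completion" by blast
    interpret C: semi_hilbert B completion cadd czero cact cip by (rule semi_hilbert_completion)
    have "C.nrm (lift s F) \<le> C * C.nrm F"
    proof (rule nrm_completion_le)
      fix z assume z: "z \<in> M"
      have "\<parallel>lift s F z\<parallel> = \<parallel>F (s z)\<parallel>" using z by (simp add: lift_def)
      also have "\<dots> \<le> C.nrm F * nrm (s z)" using z adjointableD[OF ts] by (intro norm_eval_le) auto
      also have "\<dots> \<le> C.nrm F * (C * nrm z)" using z by (intro mult_left_mono C) auto
      finally show "\<parallel>lift s F z\<parallel> \<le> C * C.nrm F * nrm z" by (simp add: mult_ac)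
    qed (use C in auto)
    then show "K.nrm (\<phi> (lift s (\<psi> x))) \<le> C * K.nrm x" by (simp add: x nrm_\<phi>)
  qed (use C in simp)
  ultimately show ?thesis unfolding op_def by (intro K.opsI) auto
qed

lemma adj_op: assumes ts: "adjointable t s" shows "K.adj (op s) = op t"
proof (rule K.ops_eqI)
  note [simp] = lift_closed[OF ts] lift_closed[OF adjointable_sym[OF ts]]
  have "K.is_adjoint (op s) (op t)"
    by (auto simp: K.is_adjoint_def op_\<phi> kip_def cip_lift[OF ts])
  then show "K.adj (op s) x = op t x" if "x \<in> \<phi> ` completion" for x
    using K.adj_eq[OF op_in_ops[OF ts]] that by blast
qed (auto simp: K.adj_ext op_def)

lemma op_embed: assumes ts: "adjointable t s" and y: "y \<in> M" shows "op s (\<phi> (embed y)) = \<phi> (embed (t y))"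
proof -
  have "lift s (embed y) = embed (t y)"
    using adjointableD[OF ts] adjointableD(3)[OF adjointable_sym[OF ts]] y
    by (auto simp: lift_def embed_def)
  then show ?thesis using y by (simp add: op_\<phi>)
qed

lemma kip_embed: "\<lbrakk>x \<in> M; F \<in> completion\<rbrakk> \<Longrightarrow> kip (\<phi> (embed x)) (\<phi> F) = F x"
  by (simp add: kip_def cip_embed_left)

end

section \<open>Positive matrices\<close>

context cstar_algebra
begin

lemma star_finsum:
  "\<lbrakk>finite I; \<And>i. i \<in> I \<Longrightarrow> f i \<in> carrier A\<rbrakk> \<Longrightarrow> (\<Oplus>i\<in>I. f i)\<^sup>\<star> = (\<Oplus>i\<in>I. (f i)\<^sup>\<star>)"
  by (induction I rule: finite_induct) (auto simp: star_add Pi_def)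

lemma pos_finsum: "\<lbrakk>finite I; \<And>i. i \<in> I \<Longrightarrow> pos (f i)\<rbrakk> \<Longrightarrow> pos (\<Oplus>i\<in>I. f i)"
  by (induction I rule: finite_induct) (auto simp: pos_add Pi_def)

lemma norm_finsum_le:
  "\<lbrakk>finite I; \<And>i. i \<in> I \<Longrightarrow> f i \<in> carrier A\<rbrakk> \<Longrightarrow> \<parallel>\<Oplus>i\<in>I. f i\<parallel> \<le> (\<Sum>i\<in>I. \<parallel>f i\<parallel>)"
proof (induction I rule: finite_induct)
  case (insert i I)
  then show ?case using norm_triangle[of "f i" "\<Oplus>j\<in>I. f j"] by (simp add: Pi_def)
qed simp

lemma finsum_swap:
  assumes "finite I" "finite J" "\<And>i j. i \<in> I \<Longrightarrow> j \<in> J \<Longrightarrow> f i j \<in> carrier A"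
  shows "(\<Oplus>i\<in>I. \<Oplus>j\<in>J. f i j) = (\<Oplus>j\<in>J. \<Oplus>i\<in>I. f i j)"
  using assms(1,3)
proof (induction I rule: finite_induct)
  case (insert i I)
  have "(\<Oplus>i\<in>insert i I. \<Oplus>j\<in>J. f i j) = (\<Oplus>j\<in>J. f i j) \<oplus> (\<Oplus>j\<in>J. \<Oplus>i\<in>I. f i j)"
    using insert by (simp add: Pi_def)
  also have "\<dots> = (\<Oplus>j\<in>J. f i j \<oplus> (\<Oplus>i\<in>I. f i j))"
    using insert by (subst finsum_addf) (auto simp: Pi_def)
  also have "\<dots> = (\<Oplus>j\<in>J. \<Oplus>i\<in>insert i I. f i j)"
    using insert by (intro finsum_cong') (auto simp: Pi_def)
  finally show ?case .
qed (simp add: finsum_zero)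

section \<open>The standard Hilbert module of n-tuples\<close>

definition vecs :: "nat \<Rightarrow> (nat \<Rightarrow> 'a) set" where
  "vecs n = {..<n} \<rightarrow>\<^sub>E carrier A"

definition vadd :: "nat \<Rightarrow> (nat \<Rightarrow> 'a) \<Rightarrow> (nat \<Rightarrow> 'a) \<Rightarrow> nat \<Rightarrow> 'a" where
  "vadd n x y = (\<lambda>i\<in>{..<n}. x i \<oplus> y i)"

definition vzero :: "nat \<Rightarrow> nat \<Rightarrow> 'a" where
  "vzero n = (\<lambda>i\<in>{..<n}. \<zero>)"

definition vact :: "nat \<Rightarrow> (nat \<Rightarrow> 'a) \<Rightarrow> 'a \<Rightarrow> nat \<Rightarrow> 'a" where
  "vact n x b = (\<lambda>i\<in>{..<n}. x i \<otimes> b)"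

definition vip :: "nat \<Rightarrow> (nat \<Rightarrow> 'a) \<Rightarrow> (nat \<Rightarrow> 'a) \<Rightarrow> 'a" where
  "vip n x y = (\<Oplus>i\<in>{..<n}. (x i)\<^sup>\<star> \<otimes> y i)"

definition unit_vec :: "nat \<Rightarrow> nat \<Rightarrow> nat \<Rightarrow> 'a" where
  "unit_vec n i = (\<lambda>j\<in>{..<n}. if i = j then \<one> else \<zero>)"

lemma vecs_eval: "\<lbrakk>x \<in> vecs n; i < n\<rbrakk> \<Longrightarrow> x i \<in> carrier A"
  by (auto simp: vecs_def PiE_iff)

lemma vecsI: "\<lbrakk>x \<in> extensional {..<n}; \<And>i. i < n \<Longrightarrow> x i \<in> carrier A\<rbrakk> \<Longrightarrow> x \<in> vecs n"
  by (auto simp: vecs_def PiE_iff)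

lemma vecs_ext: "x \<in> vecs n \<Longrightarrow> x \<in> extensional {..<n}"
  by (auto simp: vecs_def PiE_iff)

lemma unit_vec_closed [simp]: "unit_vec n i \<in> vecs n"
  by (rule vecsI) (auto simp: unit_vec_def)

lemma semi_hilbert_vecs: "semi_hilbert A (vecs n) (vadd n) (vzero n) (vact n) (vip n)"
proof (intro semi_hilbert.intro semi_hilbert_axioms.intro cstar_algebra_axioms)
  fix x y z b assume x: "x \<in> vecs n" and y: "y \<in> vecs n"
  note [simp] = x y vecs_eval[OF x] vecs_eval[OF y]
  show "vadd n x y \<in> vecs n" by (rule vecsI) (auto simp: vadd_def)
  show "vact n x b \<in> vecs n" if "b \<in> carrier A" using that by (intro vecsI) (auto simp: vact_def)
  show "vip n x y \<in> carrier A" by (auto simp: vip_def intro!: finsum_closed)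
  show "vip n x (vadd n y z) = vip n x y \<oplus> vip n x z" if z: "z \<in> vecs n"
  proof -
    note [simp] = vecs_eval[OF z]
    have "vip n x (vadd n y z) = (\<Oplus>i\<in>{..<n}. (x i)\<^sup>\<star> \<otimes> y i \<oplus> (x i)\<^sup>\<star> \<otimes> z i)"
      unfolding vip_def by (intro finsum_cong') (auto simp: vadd_def r_distr)
    then show ?thesis by (simp add: vip_def finsum_addf Pi_def)
  qed
  show "vip n x (vact n y b) = vip n x y \<otimes> b" if [simp]: "b \<in> carrier A"
  proof -
    have "vip n x (vact n y b) = (\<Oplus>i\<in>{..<n}. (x i)\<^sup>\<star> \<otimes> y i \<otimes> b)"
      unfolding vip_def by (intro finsum_cong') (auto simp: vact_def m_assoc)
    then show ?thesis by (simp add: vip_def finsum_ldistr Pi_def)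
  qed
  have "(vip n x y)\<^sup>\<star> = (\<Oplus>i\<in>{..<n}. ((x i)\<^sup>\<star> \<otimes> y i)\<^sup>\<star>)"
    unfolding vip_def by (rule star_finsum) auto
  also have "\<dots> = vip n y x" unfolding vip_def by (intro finsum_cong') (auto simp: star_mult)
  finally show "(vip n x y)\<^sup>\<star> = vip n y x" .
next
  fix x assume x: "x \<in> vecs n"
  note [simp] = vecs_eval[OF x]
  have "vip n x (vzero n) = (\<Oplus>i\<in>{..<n}. \<zero>)"
    unfolding vip_def by (intro finsum_cong') (auto simp: vzero_def)
  then show "vip n x (vzero n) = \<zero>" by (simp add: finsum_zero)
  show "pos (vip n x x)" unfolding vip_def by (rule pos_finsum) (auto intro: pos_star_mult)
qed (auto simp: vzero_def intro!: vecsI)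

lemma vip_unit_vec: assumes x: "x \<in> vecs n" and i: "i < n" shows "vip n (unit_vec n i) x = x i"
proof -
  note [simp] = vecs_eval[OF x] vecs_eval[OF unit_vec_closed]
  have "vip n (unit_vec n i) x = (\<Oplus>j\<in>{..<n}. if i = j then x j else \<zero>)"
    unfolding vip_def by (intro finsum_cong') (auto simp: unit_vec_def)
  also have "\<dots> = x i" using i by (subst finsum_singleton) auto
  finally show ?thesis .
qed

text \<open>Coordinates are inner products with unit vectors, hence dominated by the norm;
  conversely the squared norm is at most the sum of the squared norms of the coordinates. So
  convergence is coordinatewise.\<close>

lemma hilbert_module_vecs: "hilbert_module A (vecs n) (vadd n) (vzero n) (vact n) (vip n)"
proof -
  interpret V: semi_hilbert A "vecs n" "vadd n" "vzero n" "vact n" "vip n" by (rule semi_hilbert_vecs)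
  have diff: "V.pdiff x y i = x i \<ominus> y i" if "x \<in> vecs n" "y \<in> vecs n" "i < n" for x y i
    using that by (simp add: vecs_eval V.pdiff_def vadd_def vact_def r_minus a_minus_def)
  have coord: "\<parallel>x i\<parallel> \<le> V.nrm x" if x [simp]: "x \<in> vecs n" and i: "i < n" for x i
  proof -
    have "unit_vec n i i = \<one>" using i by (simp add: unit_vec_def)
    then have "V.nrm (unit_vec n i) = sqrt \<parallel>\<one>\<parallel>"
      using i by (simp add: V.nrm_def vip_unit_vec)
    then have "V.nrm (unit_vec n i) \<le> 1" using norm_one_le by simp
    moreover have "\<parallel>x i\<parallel> \<le> V.nrm (unit_vec n i) * V.nrm x"
      using V.norm_ip_le[of "unit_vec n i" x] i by (simp add: vip_unit_vec)
    ultimately show ?thesis using mult_right_mono[of _ 1 "V.nrm x"] V.nrm_nonneg[OF x] by fastforce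
  qed
  show ?thesis
  proof (intro hilbert_module.intro hilbert_module_axioms.intro semi_hilbert_vecs)
    fix x y assume xy: "x \<in> vecs n" "y \<in> vecs n" and "\<And>z. z \<in> vecs n \<Longrightarrow> vip n z x = vip n z y"
    then have "x i = y i" if "i < n" for i using that by (metis unit_vec_closed vip_unit_vec)
    then show "x = y" using xy by (intro extensionalityI[OF vecs_ext vecs_ext]) auto
  next
    fix s :: "nat \<Rightarrow> nat \<Rightarrow> 'a"
    assume s [simp]: "\<And>k. s k \<in> vecs n"
      and C: "\<forall>\<epsilon>>0. \<exists>N. \<forall>k\<ge>N. \<forall>m\<ge>N. V.nrm (V.pdiff (s k) (s m)) < \<epsilon>"
    have "\<exists>l\<in>carrier A. (\<lambda>k. \<parallel>s k i \<ominus> l\<parallel>) \<longlonglongrightarrow> 0" if i: "i < n" for i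
    proof (rule complete)
      show "\<forall>e>0. \<exists>N. \<forall>k\<ge>N. \<forall>m\<ge>N. \<parallel>s k i \<ominus> s m i\<parallel> < e"
      proof (intro allI impI)
        fix e :: real assume "0 < e"
        then obtain N where N: "\<forall>k\<ge>N. \<forall>m\<ge>N. V.nrm (V.pdiff (s k) (s m)) < e" using C by blast
        have "\<parallel>s k i \<ominus> s m i\<parallel> < e" if "k \<ge> N" "m \<ge> N" for k m
          using N that coord[of "V.pdiff (s k) (s m)" i] i by (force simp: diff)
        then show "\<exists>N. \<forall>k\<ge>N. \<forall>m\<ge>N. \<parallel>s k i \<ominus> s m i\<parallel> < e" by blast
      qed
    qed (rule vecs_eval[OF s i])
    then obtain l where l: "\<And>i. i < n \<Longrightarrow> l i \<in> carrier A \<and> (\<lambda>k. \<parallel>s k i \<ominus> l i\<parallel>) \<longlonglongrightarrow> 0" by metis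
    define v where "v = restrict l {..<n}"
    have v [simp]: "v \<in> vecs n" using l by (intro vecsI) (auto simp: v_def)
    have vi: "v i = l i" if "i < n" for i using that by (simp add: v_def)
    have le: "(V.nrm (V.pdiff (s k) v))\<^sup>2 \<le> (\<Sum>i<n. \<parallel>s k i \<ominus> l i\<parallel>\<^sup>2)" for k
    proof -
      have d: "V.pdiff (s k) v \<in> vecs n" by simp
      have "(V.nrm (V.pdiff (s k) v))\<^sup>2 = \<parallel>\<Oplus>i\<in>{..<n}. (V.pdiff (s k) v i)\<^sup>\<star> \<otimes> V.pdiff (s k) v i\<parallel>"
        by (simp add: V.nrm_square) (simp add: vip_def)
      also have "\<dots> \<le> (\<Sum>i<n. \<parallel>(V.pdiff (s k) v i)\<^sup>\<star> \<otimes> V.pdiff (s k) v i\<parallel>)"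
        using vecs_eval[OF d] by (intro norm_finsum_le) auto
      also have "\<dots> = (\<Sum>i<n. \<parallel>s k i \<ominus> l i\<parallel>\<^sup>2)"
        using vecs_eval[OF d] l by (intro sum.cong) (auto simp: cstar_identity diff vi)
      finally show ?thesis .
    qed
    have "(\<lambda>k. \<Sum>i<n. \<parallel>s k i \<ominus> l i\<parallel>\<^sup>2) \<longlonglongrightarrow> (\<Sum>i<n. 0\<^sup>2)"
      using l by (intro tendsto_sum tendsto_power) auto
    then have lim: "(\<lambda>k. \<Sum>i<n. \<parallel>s k i \<ominus> l i\<parallel>\<^sup>2) \<longlonglongrightarrow> 0" by simp
    have "(\<lambda>k. (V.nrm (V.pdiff (s k) v))\<^sup>2) \<longlonglongrightarrow> 0"
      by (rule real_tendsto_sandwich[OF _ _ tendsto_const lim]) (simp_all add: le)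
    then have "(\<lambda>k. sqrt ((V.nrm (V.pdiff (s k) v))\<^sup>2)) \<longlonglongrightarrow> sqrt 0" by (rule tendsto_real_sqrt)
    then have "(\<lambda>k. V.nrm (V.pdiff (s k) v)) \<longlonglongrightarrow> 0" by simp
    then show "\<exists>l\<in>vecs n. (\<lambda>k. V.nrm (V.pdiff (s k) l)) \<longlonglongrightarrow> 0" using v by blast
  qed
qed

text \<open>The matrix \<open>G\<close> acts on the Hilbert module \<open>A\<^sup>n\<close> as a positive operator, and \<open>S\<close> is the
  matrix of its positive square root.\<close>

lemma mat_positiveI:
  assumes G [simp]: "\<And>i j. i < n \<Longrightarrow> j < n \<Longrightarrow> G i j \<in> carrier A"
    and sG: "\<And>i j. i < n \<Longrightarrow> j < n \<Longrightarrow> (G i j)\<^sup>\<star> = G j i"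
    and pG: "\<And>c. c \<in> vecs n \<Longrightarrow> pos (\<Oplus>i\<in>{..<n}. \<Oplus>j\<in>{..<n}. (c i)\<^sup>\<star> \<otimes> G i j \<otimes> c j)"
  shows "mat_positive A n G"
proof -
  interpret V: hilbert_module A "vecs n" "vadd n" "vzero n" "vact n" "vip n"
    by (rule hilbert_module_vecs)
  define T where "T = (\<lambda>x. \<lambda>i\<in>{..<n}. \<Oplus>j\<in>{..<n}. G i j \<otimes> x j)"
  have Tx: "T x i = (\<Oplus>j\<in>{..<n}. G i j \<otimes> x j)" if "i < n" for x i using that by (simp add: T_def)
  have T [simp]: "T x \<in> vecs n" if "x \<in> vecs n" for x
    using vecs_eval[OF that] by (intro vecsI) (auto simp: T_def intro!: finsum_closed)
  have ipT: "vip n x (T y) = (\<Oplus>i\<in>{..<n}. \<Oplus>j\<in>{..<n}. (x i)\<^sup>\<star> \<otimes> G i j \<otimes> y j)"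
    if "x \<in> vecs n" "y \<in> vecs n" for x y
    unfolding vip_def using vecs_eval[OF that(1)] vecs_eval[OF that(2)]
    by (intro finsum_cong') (auto simp: T_def finsum_rdistr Pi_def m_assoc intro!: finsum_closed finsum_cong')
  have Tadj: "vip n (T x) y = vip n x (T y)" if [simp]: "x \<in> vecs n" "y \<in> vecs n" for x y
  proof -
    note [simp] = vecs_eval[OF that(1)] vecs_eval[OF that(2)]
    have "vip n (T x) y = (\<Oplus>i\<in>{..<n}. \<Oplus>j\<in>{..<n}. (y i)\<^sup>\<star> \<otimes> G i j \<otimes> x j)\<^sup>\<star>"
      by (simp add: V.ip_star flip: ipT)
    also have "\<dots> = (\<Oplus>i\<in>{..<n}. (\<Oplus>j\<in>{..<n}. (y i)\<^sup>\<star> \<otimes> G i j \<otimes> x j)\<^sup>\<star>)"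
      by (intro star_finsum) (auto intro!: finsum_closed)
    also have "\<dots> = (\<Oplus>i\<in>{..<n}. \<Oplus>j\<in>{..<n}. (x j)\<^sup>\<star> \<otimes> G j i \<otimes> y i)"
      by (intro finsum_cong' refl Pi_I trans[OF star_finsum])
        (auto simp: star_mult sG m_assoc intro!: finsum_closed finsum_cong')
    also have "\<dots> = vip n x (T y)" by (simp add: ipT) (intro finsum_swap, auto)
    finally show ?thesis .
  qed
  have adjT: "V.is_adjoint T T" by (auto simp: V.is_adjoint_def Tadj)
  have coord: "\<parallel>x i\<parallel> \<le> V.nrm (unit_vec n i) * V.nrm x" if "x \<in> vecs n" "i < n" for x i
    using V.norm_ip_le[of "unit_vec n i" x] that by (simp add: vip_unit_vec)
  \<comment> \<open>A bound for the i-th coordinate of T x relative to the norm of x, by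
    Cauchy-Schwarz in each coordinate of x.\<close>
  define g where "g i = (\<Sum>j<n. \<parallel>G i j\<parallel> * V.nrm (unit_vec n j))" for i
  have "V.nrm (T x) \<le> sqrt (\<Sum>i<n. (g i)\<^sup>2) * V.nrm x" if x [simp]: "x \<in> vecs n" for x
  proof (rule power2_le_imp_le)
    note [simp] = vecs_eval[OF x] vecs_eval[OF T[OF x]]
    have Ti: "\<parallel>T x i\<parallel> \<le> g i * V.nrm x" if i: "i < n" for i
    proof -
      have "\<parallel>T x i\<parallel> \<le> (\<Sum>j<n. \<parallel>G i j \<otimes> x j\<parallel>)"
        using i by (simp add: Tx) (intro norm_finsum_le, auto)
      also have "\<dots> \<le> (\<Sum>j<n. \<parallel>G i j\<parallel> * (V.nrm (unit_vec n j) * V.nrm x))"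
        using i by (intro sum_mono order_trans[OF norm_mult] mult_left_mono coord norm_nonneg) auto
      also have "\<dots> = g i * V.nrm x" by (simp add: g_def sum_distrib_right mult.assoc)
      finally show ?thesis .
    qed
    have "(V.nrm (T x))\<^sup>2 = \<parallel>\<Oplus>i\<in>{..<n}. (T x i)\<^sup>\<star> \<otimes> T x i\<parallel>"
      by (simp add: V.nrm_square) (simp add: vip_def)
    also have "\<dots> \<le> (\<Sum>i<n. \<parallel>(T x i)\<^sup>\<star> \<otimes> T x i\<parallel>)" by (intro norm_finsum_le) auto
    also have "\<dots> = (\<Sum>i<n. \<parallel>T x i\<parallel>\<^sup>2)" by (intro sum.cong) (auto simp: cstar_identity)
    also have "\<dots> \<le> (\<Sum>i<n. (g i * V.nrm x)\<^sup>2)"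
      by (intro sum_mono power_mono Ti norm_nonneg) auto
    also have "\<dots> = (sqrt (\<Sum>i<n. (g i)\<^sup>2) * V.nrm x)\<^sup>2"
      by (simp add: power_mult_distrib sum_nonneg sum_distrib_right)
    finally show "(V.nrm (T x))\<^sup>2 \<le> (sqrt (\<Sum>i<n. (g i)\<^sup>2) * V.nrm x)\<^sup>2" .
  qed (simp add: sum_nonneg)
  then have bT: "V.bounded_by T (sqrt (\<Sum>i<n. (g i)\<^sup>2))"
    by (simp add: V.bounded_by_def sum_nonneg)
  define R where "R = restrict T (vecs n)"
  have R [simp]: "R \<in> V.ops" unfolding R_def by (rule V.opsI[OF T adjT bT])
  have RT: "R x = T x" if "x \<in> vecs n" for x using that by (simp add: R_def)
  have "V.is_adjoint R T" using adjT by (simp add: V.is_adjoint_def RT)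
  then have "V.adj R = R"
    using V.adj_eq[OF R] by (intro V.ops_eqI) (auto simp: V.adj_ext R_def)
  moreover have "pos (vip n x (R x))" if "x \<in> vecs n" for x
    using pG[OF that] that by (simp add: RT ipT)
  ultimately have "cstar_algebra.pos V.op_alg R" by (intro V.op_pos R)
  then obtain S where "cstar_algebra.pos V.op_alg S" and SS: "S \<otimes>\<^bsub>V.op_alg\<^esub> S = R"
    by (rule cstar_algebra.pos_sqrt[OF V.cstar_algebra_op_alg]) (rule that)
  then have S [simp]: "S \<in> V.ops" and sS: "V.adj S = S"
    using cstar_algebra.pos_carrier[OF V.cstar_algebra_op_alg]
      cstar_algebra.pos_star[OF V.cstar_algebra_op_alg] by fastforce+
  \<comment> \<open>Here \<open>G i j\<close> is <e_i, R e_j> with \<open>R\<close> =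
    \<open>S\<^sup>2\<close> and \<open>S\<close> self-adjoint, that is, <S e_i, S e_j>. The vectors
    S e_i are the columns of the required matrix.\<close>
  have "G i j = (\<Oplus>k\<in>{..<n}. (S (unit_vec n i) k)\<^sup>\<star> \<otimes> S (unit_vec n j) k)" if i: "i < n" and j: "j < n" for i j
  proof -
    have "T (unit_vec n j) i = (\<Oplus>k\<in>{..<n}. if j = k then G i k else \<zero>)"
      using i j by (simp add: Tx, intro finsum_cong') (auto simp: unit_vec_def)
    also have "\<dots> = G i j" using i j by (subst finsum_singleton) auto
    finally have "G i j = vip n (unit_vec n i) (R (unit_vec n j))" using i by (simp add: vip_unit_vec RT)
    also have "R (unit_vec n j) = S (S (unit_vec n j))" using fun_cong[OF SS, of "unit_vec n j"] by simp
    also have "vip n (unit_vec n i) \<dots> = vip n (S (unit_vec n i)) (S (unit_vec n j))"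
      using V.ip_adj[of S "unit_vec n i" "S (unit_vec n j)"] by (simp add: sS)
    finally show ?thesis by (simp add: vip_def)
  qed
  then show ?thesis unfolding mat_positive_def mat_over_def
    by (intro exI[of _ "\<lambda>k i. S (unit_vec n i) k"]) (auto intro!: vecs_eval[of _ n])
qed

end

section \<open>Gram matrices\<close>

context semi_hilbert
begin

text \<open>A recursion instead of a finite sum over a set, because \<open>padd\<close> may be
  concatenation and so depend on the order. Inner products do not see the order.\<close>

fun lincomb :: "(nat \<Rightarrow> 'x) \<Rightarrow> (nat \<Rightarrow> 'b) \<Rightarrow> nat \<Rightarrow> 'x" where
  "lincomb x c 0 = pzero"
| "lincomb x c (Suc n) = padd (lincomb x c n) (act (x n) (c n))"

lemma lincomb_closed [simp]:
  "\<lbrakk>\<And>i. i < n \<Longrightarrow> x i \<in> M; \<And>i. i < n \<Longrightarrow> c i \<in> carrier B\<rbrakk> \<Longrightarrow> lincomb x c n \<in> M"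
  by (induction n) auto

lemma ip_lincomb:
  "\<lbrakk>z \<in> M; \<And>i. i < n \<Longrightarrow> x i \<in> M; \<And>i. i < n \<Longrightarrow> c i \<in> carrier B\<rbrakk>
    \<Longrightarrow> ip z (lincomb x c n) = (\<Oplus>i\<in>{..<n}. ip z (x i) \<otimes> c i)"
  by (induction n) (auto simp: ip_zero ip_add ip_act lessThan_Suc Pi_def a_comm)

text \<open>The double sum is <v, v> for the combination v of the vectors x_i with coefficients
  c_i.\<close>

lemma pos_gram:
  assumes x [simp]: "\<And>i. i < n \<Longrightarrow> x i \<in> M" and c: "c \<in> vecs n"
  shows "pos (\<Oplus>i\<in>{..<n}. \<Oplus>j\<in>{..<n}. (c i)\<^sup>\<star> \<otimes> ip (x i) (x j) \<otimes> c j)"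
proof -
  note [simp] = vecs_eval[OF c]
  let ?v = "lincomb x c n"
  have v [simp]: "?v \<in> M" by simp
  have "(\<Oplus>j\<in>{..<n}. (c i)\<^sup>\<star> \<otimes> ip (x i) (x j) \<otimes> c j) = (c i)\<^sup>\<star> \<otimes> ip (x i) ?v" if "i < n" for i
    using that by (simp add: ip_lincomb finsum_rdistr Pi_def) (intro finsum_cong', auto simp: m_assoc)
  then have "(\<Oplus>i\<in>{..<n}. \<Oplus>j\<in>{..<n}. (c i)\<^sup>\<star> \<otimes> ip (x i) (x j) \<otimes> c j) =
      (\<Oplus>i\<in>{..<n}. (c i)\<^sup>\<star> \<otimes> ip (x i) ?v)"
    by (intro finsum_cong') auto
  also have "\<dots> = (\<Oplus>i\<in>{..<n}. (ip ?v (x i) \<otimes> c i)\<^sup>\<star>)"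
    by (intro finsum_cong') (auto simp: star_mult ip_star)
  also have "\<dots> = (\<Oplus>i\<in>{..<n}. ip ?v (x i) \<otimes> c i)\<^sup>\<star>" by (rule star_finsum[symmetric]) auto
  also have "\<dots> = (ip ?v ?v)\<^sup>\<star>" by (simp add: ip_lincomb)
  also have "\<dots> = ip ?v ?v" by (simp add: ip_star)
  finally show ?thesis using ip_pos[OF v] by simp
qed

text \<open>The sum over k is what a compressed matrix product \<open>T* T\<close> looks like. The
  quadratic form is a sum of forms of single Gram matrices.\<close>

lemma mat_positive_gram:
  fixes m n :: nat
  assumes x [simp]: "\<And>k i. k < m \<Longrightarrow> i < n \<Longrightarrow> x k i \<in> M"
  shows "mat_positive B n (\<lambda>i j. \<Oplus>k\<in>{..<m}. ip (x k i) (x k j))"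
proof (rule mat_positiveI)
  fix i j assume [simp]: "i < n" "j < n"
  show "(\<Oplus>k\<in>{..<m}. ip (x k i) (x k j)) \<in> carrier B" by (auto intro!: finsum_closed)
  show "(\<Oplus>k\<in>{..<m}. ip (x k i) (x k j))\<^sup>\<star> = (\<Oplus>k\<in>{..<m}. ip (x k j) (x k i))"
    by (subst star_finsum) (auto simp: ip_star intro!: finsum_cong')
next
  fix c assume c: "c \<in> vecs n"
  note [simp] = vecs_eval[OF c]
  have e: "(c i)\<^sup>\<star> \<otimes> (\<Oplus>k\<in>{..<m}. ip (x k i) (x k j)) \<otimes> c j =
      (\<Oplus>k\<in>{..<m}. (c i)\<^sup>\<star> \<otimes> ip (x k i) (x k j) \<otimes> c j)" if [simp]: "i < n" "j < n" for i j
    by (simp add: finsum_rdistr finsum_ldistr Pi_def)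
  have "(\<Oplus>i\<in>{..<n}. \<Oplus>j\<in>{..<n}. (c i)\<^sup>\<star> \<otimes> (\<Oplus>k\<in>{..<m}. ip (x k i) (x k j)) \<otimes> c j) =
      (\<Oplus>i\<in>{..<n}. \<Oplus>j\<in>{..<n}. \<Oplus>k\<in>{..<m}. (c i)\<^sup>\<star> \<otimes> ip (x k i) (x k j) \<otimes> c j)"
    by (intro finsum_cong') (auto simp: e intro!: finsum_closed)
  also have "\<dots> = (\<Oplus>i\<in>{..<n}. \<Oplus>k\<in>{..<m}. \<Oplus>j\<in>{..<n}. (c i)\<^sup>\<star> \<otimes> ip (x k i) (x k j) \<otimes> c j)"
    by (intro finsum_cong' finsum_swap) (auto intro!: finsum_closed)
  also have "\<dots> = (\<Oplus>k\<in>{..<m}. \<Oplus>i\<in>{..<n}. \<Oplus>j\<in>{..<n}. (c i)\<^sup>\<star> \<otimes> ip (x k i) (x k j) \<otimes> c j)"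
    by (intro finsum_swap) (auto intro!: finsum_closed)
  finally show "pos (\<Oplus>i\<in>{..<n}. \<Oplus>j\<in>{..<n}. (c i)\<^sup>\<star> \<otimes> (\<Oplus>k\<in>{..<m}. ip (x k i) (x k j)) \<otimes> c j)"
    using c by (auto intro!: pos_finsum pos_gram)
qed

end

lemma mat_positive_cong:
  assumes "\<And>i j. i < n \<Longrightarrow> j < n \<Longrightarrow> G i j = H i j" "mat_positive A n G"
  shows "mat_positive A n H"
  using assms unfolding mat_positive_def by auto

section \<open>Quadratic forms of positive matrices\<close>

context cstar_algebra
begin

lemma finsum_lessThan_shift:
  "(\<And>i. i < Suc n \<Longrightarrow> f i \<in> carrier A)
    \<Longrightarrow> (\<Oplus>i\<in>{..<Suc n}. f i) = f 0 \<oplus> (\<Oplus>i\<in>{..<n}. f (Suc i))"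
proof (induction n)
  case (Suc n)
  have "(\<Oplus>i\<in>{..<Suc (Suc n)}. f i) = f (Suc n) \<oplus> (\<Oplus>i\<in>{..<Suc n}. f i)"
    using Suc.prems by (subst lessThan_Suc) (auto intro!: finsum_insert)
  also have "\<dots> = f (Suc n) \<oplus> (f 0 \<oplus> (\<Oplus>i\<in>{..<n}. f (Suc i)))" using Suc by simp
  also have "\<dots> = f 0 \<oplus> (f (Suc n) \<oplus> (\<Oplus>i\<in>{..<n}. f (Suc i)))"
    using Suc.prems by (intro a_lcomm finsum_closed) auto
  also have "f (Suc n) \<oplus> (\<Oplus>i\<in>{..<n}. f (Suc i)) = (\<Oplus>i\<in>{..<Suc n}. f (Suc i))"
    using Suc.prems by (subst lessThan_Suc) (auto intro!: finsum_insert[symmetric])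
  finally show ?case .
qed (simp add: lessThan_Suc)

lemma mat_positive_hermitian:
  assumes "mat_positive A n G" and [simp]: "i < n" "j < n"
  shows "(G i j)\<^sup>\<star> = G j i"
proof -
  obtain T where [simp]: "\<forall>i<n. \<forall>j<n. T i j \<in> carrier A"
    and G: "\<forall>i<n. \<forall>j<n. G i j = (\<Oplus>k\<in>{..<n}. (T k i)\<^sup>\<star> \<otimes> T k j)"
    using assms(1) unfolding mat_positive_def mat_over_def by blast
  have "(G i j)\<^sup>\<star> = (\<Oplus>k\<in>{..<n}. ((T k i)\<^sup>\<star> \<otimes> T k j)\<^sup>\<star>)" by (simp add: G) (rule star_finsum, auto)
  also have "\<dots> = G j i" by (simp add: G) (intro finsum_cong', auto simp: star_mult)
  finally show ?thesis .
qed

text \<open>A converse to \<open>mat_positiveI\<close>: a matrix \<open>T* T\<close> is the Gram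
  matrix of the columns of \<open>T\<close>.\<close>

lemma mat_positive_pos:
  assumes G: "mat_positive A n G" and c: "\<And>i. i < n \<Longrightarrow> c i \<in> carrier A"
  shows "pos (\<Oplus>i\<in>{..<n}. \<Oplus>j\<in>{..<n}. (c i)\<^sup>\<star> \<otimes> G i j \<otimes> c j)"
proof -
  interpret V: semi_hilbert A "vecs n" "vadd n" "vzero n" "vact n" "vip n" by (rule semi_hilbert_vecs)
  obtain T where T [simp]: "\<forall>i<n. \<forall>j<n. T i j \<in> carrier A"
    and G: "\<forall>i<n. \<forall>j<n. G i j = (\<Oplus>k\<in>{..<n}. (T k i)\<^sup>\<star> \<otimes> T k j)"
    using G unfolding mat_positive_def mat_over_def by blast
  define x where "x i = (\<lambda>k\<in>{..<n}. T k i)" for i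
  define d where "d = restrict c {..<n}"
  have x: "x i \<in> vecs n" if "i < n" for i using that by (intro vecsI) (auto simp: x_def)
  have d: "d \<in> vecs n" using c by (intro vecsI) (auto simp: d_def)
  have Gx: "G i j = vip n (x i) (x j)" if "i < n" "j < n" for i j
    using that by (simp add: G vip_def) (intro finsum_cong', auto simp: x_def)
  have [simp]: "G i j \<in> carrier A" if "i < n" "j < n" for i j using that x by (simp add: Gx)
  have "(\<Oplus>i\<in>{..<n}. \<Oplus>j\<in>{..<n}. (c i)\<^sup>\<star> \<otimes> G i j \<otimes> c j) =
      (\<Oplus>i\<in>{..<n}. \<Oplus>j\<in>{..<n}. (d i)\<^sup>\<star> \<otimes> vip n (x i) (x j) \<otimes> d j)"
    using c x by (intro finsum_cong') (auto simp: d_def simp flip: Gx intro!: finsum_closed finsum_cong')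
  then show ?thesis using V.pos_gram[of n x d] x d by simp
qed

lemma mat_positive_rank_one:
  assumes s [simp]: "\<And>i. i < n \<Longrightarrow> s i \<in> carrier A"
  shows "mat_positive A n (\<lambda>i j. (s i)\<^sup>\<star> \<otimes> s j)"
  unfolding mat_positive_def
proof (intro exI conjI allI impI)
  \<comment> \<open>The matrix with \<open>s\<close> as row 0 and zeros elsewhere.\<close>
  let ?T = "\<lambda>k i. if 0 = k then s i else \<zero>"
  show "mat_over A n ?T" by (auto simp: mat_over_def)
  fix i j assume ij: "i < n" "j < n"
  have "(\<Oplus>k\<in>{..<n}. (?T k i)\<^sup>\<star> \<otimes> ?T k j) = (\<Oplus>k\<in>{..<n}. if 0 = k then (s i)\<^sup>\<star> \<otimes> s j else \<zero>)"
    using ij by (intro finsum_cong') auto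
  also have "\<dots> = (s i)\<^sup>\<star> \<otimes> s j" using ij by (subst finsum_singleton) auto
  finally show "(s i)\<^sup>\<star> \<otimes> s j = (\<Oplus>k\<in>{..<n}. (?T k i)\<^sup>\<star> \<otimes> ?T k j)" by simp
qed

end

section \<open>The Hilbert module of a completely positive map\<close>

text \<open>An element of \<open>dom\<close> is a pair of an element of \<open>B\<close> and a formal sum of elementary tensors
  \<open>s \<otimes> c\<close> of \<open>B \<otimes>\<^sub>\<theta> B\<close>.\<close>

locale completely_positive_map = cstar_algebra B
  for B :: "('b, 'm) cstar_scheme" (structure) +
  fixes \<theta> :: "'b \<Rightarrow> 'b"
  assumes cp: "completely_positive B B \<theta>"
begin

lemma \<theta>_closed [simp, intro]: "b \<in> carrier B \<Longrightarrow> \<theta> b \<in> carrier B"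
  and \<theta>_add: "\<lbrakk>b \<in> carrier B; c \<in> carrier B\<rbrakk> \<Longrightarrow> \<theta> (b \<oplus> c) = \<theta> b \<oplus> \<theta> c"
  and \<theta>_smult: "b \<in> carrier B \<Longrightarrow> \<theta> (z \<odot> b) = z \<odot> \<theta> b"
  using cp by (auto simp: completely_positive_def linear_map_def)

lemma \<theta>_gram:
  "(\<And>i. i < n \<Longrightarrow> s i \<in> carrier B) \<Longrightarrow> mat_positive B n (\<lambda>i j. \<theta> ((s i)\<^sup>\<star> \<otimes> s j))"
  using cp mat_positive_rank_one unfolding completely_positive_def by blast

text \<open>Compares the two off-diagonal entries of the positive 2 x 2 matrix that
  \<open>\<theta>_gram\<close> builds from the pair 1, b.\<close>

lemma \<theta>_star: assumes [simp]: "b \<in> carrier B" shows "\<theta> (b\<^sup>\<star>) = (\<theta> b)\<^sup>\<star>"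
  using mat_positive_hermitian[OF \<theta>_gram[of 2 "\<lambda>i. if i = 0 then \<one> else b"], of 0 1] by simp

text \<open>The inner product of \<open>s \<otimes> 1\<close> with the formal sum in the
  list.\<close>

fun val :: "('b \<times> 'b) list \<Rightarrow> 'b \<Rightarrow> 'b" where
  "val [] s = \<zero>"
| "val ((t, d) # L) s = \<theta> (s\<^sup>\<star> \<otimes> t) \<otimes> d \<oplus> val L s"

text \<open>Extends a function of \<open>s\<close>, thought of as an inner product with
  \<open>s \<otimes> 1\<close> on the left, to all formal sums. Thus
  \<open>pairing L (val L')\<close> is <L, L'>, and each induction runs over one list only.\<close>

fun pairing :: "('b \<times> 'b) list \<Rightarrow> ('b \<Rightarrow> 'b) \<Rightarrow> 'b" where
  "pairing [] g = \<zero>"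
| "pairing ((s, c) # L) g = c\<^sup>\<star> \<otimes> g s \<oplus> pairing L g"

definition tensors :: "('b \<times> 'b) list set" where
  "tensors = lists (carrier B \<times> carrier B)"

lemma tensors_Nil [simp]: "[] \<in> tensors"
  and tensors_Cons [simp]: "(s, c) # L \<in> tensors \<longleftrightarrow> s \<in> carrier B \<and> c \<in> carrier B \<and> L \<in> tensors"
  and tensors_append [simp]: "L \<in> tensors \<Longrightarrow> L' \<in> tensors \<Longrightarrow> L @ L' \<in> tensors"
  by (auto simp: tensors_def)

lemma tensors_induct [consumes 1, case_names Nil Cons]:
  assumes "L \<in> tensors" "P []"
    and "\<And>s c L. s \<in> carrier B \<Longrightarrow> c \<in> carrier B \<Longrightarrow> L \<in> tensors \<Longrightarrow> P L \<Longrightarrow> P ((s, c) # L)"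
  shows "P L"
  using assms(1)
proof (induction L)
  case (Cons p L)
  then show ?case using assms(3)[of "fst p" "snd p" L] by (cases p) simp
qed (use assms(2) in simp)

lemma val_closed [simp]: "L \<in> tensors \<Longrightarrow> s \<in> carrier B \<Longrightarrow> val L s \<in> carrier B"
  by (induction L rule: tensors_induct) auto

lemma pairing_closed [simp]:
  "L \<in> tensors \<Longrightarrow> (\<And>s. s \<in> carrier B \<Longrightarrow> g s \<in> carrier B) \<Longrightarrow> pairing L g \<in> carrier B"
  by (induction L rule: tensors_induct) auto

lemma pairing_cong:
  "L \<in> tensors \<Longrightarrow> (\<And>s. s \<in> carrier B \<Longrightarrow> g s = h s) \<Longrightarrow> pairing L g = pairing L h"
  by (induction L rule: tensors_induct) auto

lemma val_append:
  "L \<in> tensors \<Longrightarrow> L' \<in> tensors \<Longrightarrow> s \<in> carrier B \<Longrightarrow> val (L @ L') s = val L s \<oplus> val L' s"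
  by (induction L rule: tensors_induct) (auto simp: a_assoc)

lemma pairing_add:
  "L \<in> tensors \<Longrightarrow> (\<And>s. s \<in> carrier B \<Longrightarrow> g s \<in> carrier B) \<Longrightarrow> (\<And>s. s \<in> carrier B \<Longrightarrow> h s \<in> carrier B)
    \<Longrightarrow> pairing L (\<lambda>s. g s \<oplus> h s) = pairing L g \<oplus> pairing L h"
  by (induction L rule: tensors_induct) (auto simp: r_distr a_ac)

lemma pairing_zero: "L \<in> tensors \<Longrightarrow> pairing L (\<lambda>s. \<zero>) = \<zero>"
  by (induction L rule: tensors_induct) auto

definition tact :: "('b \<times> 'b) list \<Rightarrow> 'b \<Rightarrow> ('b \<times> 'b) list" where
  "tact L b = map (\<lambda>(s, c). (s, c \<otimes> b)) L"

definition tmul :: "'b \<Rightarrow> ('b \<times> 'b) list \<Rightarrow> ('b \<times> 'b) list" where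
  "tmul b L = map (\<lambda>(s, c). (b \<otimes> s, c)) L"

lemma tact_simps [simp]: "tact [] b = []" "tact ((s, c) # L) b = (s, c \<otimes> b) # tact L b"
  and tmul_simps [simp]: "tmul b [] = []" "tmul b ((s, c) # L) = (b \<otimes> s, c) # tmul b L"
  by (simp_all add: tact_def tmul_def)

lemma tact_closed [simp]: "L \<in> tensors \<Longrightarrow> b \<in> carrier B \<Longrightarrow> tact L b \<in> tensors"
  by (induction L rule: tensors_induct) auto

lemma tmul_closed [simp]: "L \<in> tensors \<Longrightarrow> b \<in> carrier B \<Longrightarrow> tmul b L \<in> tensors"
  by (induction L rule: tensors_induct) auto

lemma val_tact:
  "L \<in> tensors \<Longrightarrow> b \<in> carrier B \<Longrightarrow> s \<in> carrier B \<Longrightarrow> val (tact L b) s = val L s \<otimes> b"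
  by (induction L rule: tensors_induct) (auto simp: l_distr m_assoc)

lemma pairing_mult_right:
  "L \<in> tensors \<Longrightarrow> (\<And>s. s \<in> carrier B \<Longrightarrow> g s \<in> carrier B) \<Longrightarrow> b \<in> carrier B
    \<Longrightarrow> pairing L (\<lambda>s. g s \<otimes> b) = pairing L g \<otimes> b"
  by (induction L rule: tensors_induct) (auto simp: l_distr m_assoc)

lemma pairing_tmul:
  "L \<in> tensors \<Longrightarrow> b \<in> carrier B \<Longrightarrow> pairing (tmul b L) g = pairing L (\<lambda>s. g (b \<otimes> s))"
  by (induction L rule: tensors_induct) auto

lemma val_tmul:
  "L \<in> tensors \<Longrightarrow> b \<in> carrier B \<Longrightarrow> s \<in> carrier B \<Longrightarrow> val (tmul b L) s = val L (b\<^sup>\<star> \<otimes> s)"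
  by (induction L rule: tensors_induct) (auto simp: star_mult m_assoc)

lemma val_tmul_add:
  "L \<in> tensors \<Longrightarrow> b \<in> carrier B \<Longrightarrow> c \<in> carrier B \<Longrightarrow> s \<in> carrier B
    \<Longrightarrow> val (tmul (b \<oplus> c) L) s = val (tmul b L) s \<oplus> val (tmul c L) s"
  by (induction L rule: tensors_induct) (auto simp: l_distr r_distr \<theta>_add a_ac)

lemma val_tmul_smult:
  "L \<in> tensors \<Longrightarrow> b \<in> carrier B \<Longrightarrow> s \<in> carrier B
    \<Longrightarrow> val (tmul (z \<odot> b) L) s = z \<odot> val (tmul b L) s"
  by (induction L rule: tensors_induct)
    (auto simp: smult_mult_left smult_mult_right \<theta>_smult smult_add_right)

lemma star_val:
  "L \<in> tensors \<Longrightarrow> s \<in> carrier B \<Longrightarrow> c \<in> carrier B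
    \<Longrightarrow> (val L s)\<^sup>\<star> \<otimes> c = pairing L (\<lambda>t. \<theta> (t\<^sup>\<star> \<otimes> s) \<otimes> c)"
  by (induction L rule: tensors_induct)
    (auto simp: star_add star_mult l_distr m_assoc simp flip: \<theta>_star)

lemma star_pairing:
  "L \<in> tensors \<Longrightarrow> L' \<in> tensors \<Longrightarrow> (pairing L (val L'))\<^sup>\<star> = pairing L' (val L)"
proof (induction L rule: tensors_induct)
  case (Cons s c L)
  have "pairing L' (val ((s, c) # L)) = pairing L' (\<lambda>t. \<theta> (t\<^sup>\<star> \<otimes> s) \<otimes> c \<oplus> val L t)"
    using Cons by (intro pairing_cong) auto
  also have "\<dots> = pairing L' (\<lambda>t. \<theta> (t\<^sup>\<star> \<otimes> s) \<otimes> c) \<oplus> pairing L' (val L)"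
    using Cons by (intro pairing_add) auto
  finally show ?case using Cons by (simp add: star_add star_mult star_val del: val.simps)
qed (simp add: pairing_zero cong: pairing_cong)

lemma pairing_finsum:
  assumes "L \<in> tensors" "\<And>s. s \<in> carrier B \<Longrightarrow> g s \<in> carrier B"
  shows "pairing L g = (\<Oplus>i\<in>{..<length L}. (snd (L ! i))\<^sup>\<star> \<otimes> g (fst (L ! i)))"
  using assms(1)
proof (induction L rule: tensors_induct)
  case (Cons s c L)
  have L: "fst (L ! i) \<in> carrier B" "snd (L ! i) \<in> carrier B" if "i < length L" for i
    using nth_mem[OF that] Cons(3) by (auto simp: tensors_def mem_Times_iff)
  then show ?case using Cons assms(2)
    by (simp add: finsum_lessThan_shift nth_Cons split: nat.split del: finsum_Suc)
qed simp

lemma val_finsum: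
  assumes "L \<in> tensors" "s \<in> carrier B"
  shows "val L s = (\<Oplus>i\<in>{..<length L}. \<theta> (s\<^sup>\<star> \<otimes> fst (L ! i)) \<otimes> snd (L ! i))"
  using assms(1)
proof (induction L rule: tensors_induct)
  case (Cons t d L)
  have L: "fst (L ! i) \<in> carrier B" "snd (L ! i) \<in> carrier B" if "i < length L" for i
    using nth_mem[OF that] Cons(3) by (auto simp: tensors_def mem_Times_iff)
  then show ?case using Cons assms(2)
    by (simp add: finsum_lessThan_shift nth_Cons split: nat.split del: finsum_Suc)
qed simp

text \<open>Complete positivity at all matrix sizes enters here: the value is the quadratic form of
  the matrix with entries \<open>\<theta>\<close> of \<open>s_i* s_j\<close>, of the size of the
  list.\<close>

lemma pos_pairing: assumes L [simp]: "L \<in> tensors" shows "pos (pairing L (val L))"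
proof -
  let ?n = "length L" and ?s = "\<lambda>i. fst (L ! i)" and ?c = "\<lambda>i. snd (L ! i)"
  have c [simp]: "?s i \<in> carrier B" "?c i \<in> carrier B" if "i < ?n" for i
    using nth_mem[OF that] L by (auto simp: tensors_def mem_Times_iff)
  have "pairing L (val L) = (\<Oplus>i\<in>{..<?n}. (?c i)\<^sup>\<star> \<otimes> (\<Oplus>j\<in>{..<?n}. \<theta> ((?s i)\<^sup>\<star> \<otimes> ?s j) \<otimes> ?c j))"
    by (subst pairing_finsum) (auto intro!: finsum_cong' finsum_closed simp: val_finsum)
  also have "\<dots> = (\<Oplus>i\<in>{..<?n}. \<Oplus>j\<in>{..<?n}. (?c i)\<^sup>\<star> \<otimes> \<theta> ((?s i)\<^sup>\<star> \<otimes> ?s j) \<otimes> ?c j)"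
    by (intro finsum_cong') (auto simp: finsum_rdistr Pi_def m_assoc intro!: finsum_closed finsum_cong')
  finally show ?thesis
    using mat_positive_pos[OF \<theta>_gram, of ?n ?s ?c] by simp
qed

section \<open>The direct sum of \<open>B\<close> with the formal tensors, and its operators\<close>

definition dom :: "('b \<times> ('b \<times> 'b) list) set" where
  "dom = carrier B \<times> tensors"

fun xadd where "xadd (a, L) (a', L') = (a \<oplus> a', L @ (L' :: ('b \<times> 'b) list))"

fun xact where "xact (a, L) b = (a \<otimes> b, tact L b)"

fun xip where "xip (a, L) (a', L') = a\<^sup>\<star> \<otimes> a' \<oplus> pairing L (val L')"

fun lmul where "lmul b (a, L) = (b \<otimes> a, tmul b L)"

text \<open>The map that sends x to v <\<open>\<Omega>\<close>, x>: the pair is v a, with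
  \<open>(1 \<otimes> 1) a\<close> written as a one-term sum.\<close>

fun vmul :: "'b \<times> ('b \<times> 'b) list \<Rightarrow> 'b \<times> ('b \<times> 'b) list" where
  "vmul (a, L) = (a, [(\<one>, a)])"

text \<open>The adjoint of \<open>vmul\<close>, which sends x to \<open>\<Omega>\<close> <v,
  x>.\<close>

fun vadj :: "'b \<times> ('b \<times> 'b) list \<Rightarrow> 'b \<times> ('b \<times> 'b) list" where
  "vadj (a, L) = (a \<oplus> val L \<one>, [])"

text \<open>By linearity, the values recorded by \<open>coords\<close> determine an element of the completion, which
  is how the completion fits into the type prescribed by \<open>'b op\<close>.\<close>

definition coords :: "('b \<times> ('b \<times> 'b) list \<Rightarrow> 'b) \<Rightarrow> 'b \<times> ('b \<Rightarrow> 'b)" where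
  "coords F = (F (\<one>, []), \<lambda>b. F (\<zero>, [(b, \<one>)]))"

lemma in_dom [simp]: "(a, L) \<in> dom \<longleftrightarrow> a \<in> carrier B \<and> L \<in> tensors"
  by (simp add: dom_def)

lemma domE: assumes "x \<in> dom" obtains a L where "x = (a, L)" "a \<in> carrier B" "L \<in> tensors"
  using assms by (auto simp: dom_def)

lemma semi_hilbert_dom: "semi_hilbert B dom xadd (\<zero>, []) xact xip"
proof (intro semi_hilbert.intro semi_hilbert_axioms.intro cstar_algebra_axioms)
  fix x y z b assume "x \<in> dom" "y \<in> dom"
  then obtain a L a' L' where x [simp]: "x = (a, L)" "a \<in> carrier B" "L \<in> tensors"
    and y [simp]: "y = (a', L')" "a' \<in> carrier B" "L' \<in> tensors" by (metis domE)
  show "xadd x y \<in> dom" "xip x y \<in> carrier B" by simp_all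
  show "(xip x y)\<^sup>\<star> = xip y x" by (simp add: star_add star_mult star_pairing)
  show "xact x b \<in> dom" if "b \<in> carrier B" using that by simp
  show "xip x (xadd y z) = xip x y \<oplus> xip x z" if "z \<in> dom"
  proof -
    from that obtain c K where [simp]: "z = (c, K)" "c \<in> carrier B" "K \<in> tensors" by (metis domE)
    have "pairing L (val (L' @ K)) = pairing L (\<lambda>s. val L' s \<oplus> val K s)"
      by (intro pairing_cong) (auto simp: val_append)
    then show ?thesis by (simp add: pairing_add r_distr a_ac)
  qed
  show "xip x (xact y b) = xip x y \<otimes> b" if [simp]: "b \<in> carrier B"
  proof -
    have "pairing L (val (tact L' b)) = pairing L (\<lambda>s. val L' s \<otimes> b)"
      by (intro pairing_cong) (auto simp: val_tact)
    then show ?thesis by (simp add: pairing_mult_right l_distr m_assoc)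
  qed
next
  fix x assume "x \<in> dom"
  then obtain a L where [simp]: "x = (a, L)" "a \<in> carrier B" "L \<in> tensors" by (metis domE)
  have "pairing L (val []) = pairing L (\<lambda>s. \<zero>)" by (intro pairing_cong) auto
  then show "xip x (\<zero>, []) = \<zero>" by (simp add: pairing_zero)
  show "pos (xip x x)" by (simp add: pos_add pos_star_mult pos_pairing)
qed simp

sublocale X: semi_hilbert B dom xadd "(\<zero>, [])" xact xip
  by (rule semi_hilbert_dom)

text \<open>Every vector is built by addition and right multiplication from the unit vector and the
  tensors \<open>s \<otimes> 1\<close>; \<open>completion_add\<close> and
  \<open>completion_act\<close> carry the recorded values along.\<close>

lemma inj_coords: "inj_on coords X.completion"
proof (rule inj_onI, rule X.completion_eqI)
  fix F G x
  assume F: "F \<in> X.completion" and G: "G \<in> X.completion" and eq: "coords F = coords G" and "x \<in> dom"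
  then obtain a L where x: "x = (a, L)" and a [simp]: "a \<in> carrier B" and L: "L \<in> tensors" by (metis domE)
  have e1: "H (a, []) = a\<^sup>\<star> \<otimes> H (\<one>, [])" if "H \<in> X.completion" for H
    using X.completion_act[OF that, of "(\<one>, [])" a] by simp
  then have 1: "F (a, []) = G (a, [])" using e1[OF F] e1[OF G] eq by (simp add: coords_def)
  have 2: "F (\<zero>, [(s, c)]) = G (\<zero>, [(s, c)])" if [simp]: "s \<in> carrier B" "c \<in> carrier B" for s c
  proof -
    have e2: "H (\<zero>, [(s, c)]) = c\<^sup>\<star> \<otimes> H (\<zero>, [(s, \<one>)])" if "H \<in> X.completion" for H
      using X.completion_act[OF that, of "(\<zero>, [(s, \<one>)])" c] by simp
    then show ?thesis using e2[OF F] e2[OF G] eq by (simp add: coords_def fun_eq_iff)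
  qed
  have e0: "H (\<zero>, []) = \<zero>" if "H \<in> X.completion" for H
    using X.completion_act[OF that, of "(\<zero>, [])" \<zero>] X.completion_eval[OF that, of "(\<zero>, [])"] by simp
  from L have 3: "F (\<zero>, L) = G (\<zero>, L)"
  proof (induction L rule: tensors_induct)
    case (Cons s c L)
    have e3: "H (\<zero>, (s, c) # L) = H (\<zero>, [(s, c)]) \<oplus> H (\<zero>, L)" if "H \<in> X.completion" for H
      using X.completion_add[OF that, of "(\<zero>, [(s, c)])" "(\<zero>, L)"] Cons by simp
    then show ?case using e3[OF F] e3[OF G] Cons 2 by simp
  qed (simp add: e0[OF F] e0[OF G])
  have e4: "H (a, L) = H (a, []) \<oplus> H (\<zero>, L)" if "H \<in> X.completion" for H
    using X.completion_add[OF that, of "(a, [])" "(\<zero>, L)"] L by simp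
  then show "F x = G x" using e4[OF F] e4[OF G] 1 3 x by simp
qed

sublocale R: represented_completion B dom xadd "(\<zero>, [])" xact xip coords
  by (intro represented_completion.intro represented_completion_axioms.intro semi_hilbert_dom inj_coords)

lemma lmul_closed [simp]: "\<lbrakk>x \<in> dom; b \<in> carrier B\<rbrakk> \<Longrightarrow> lmul b x \<in> dom"
  by (cases x) simp

lemma lmul_adjoint:
  assumes "x \<in> dom" "y \<in> dom" and b [simp]: "b \<in> carrier B"
  shows "xip (lmul b x) y = xip x (lmul (b\<^sup>\<star>) y)"
proof -
  obtain a L a' L' where [simp]: "x = (a, L)" "a \<in> carrier B" "L \<in> tensors"
    "y = (a', L')" "a' \<in> carrier B" "L' \<in> tensors" using assms by (metis domE)
  have "pairing L (\<lambda>s. val L' (b \<otimes> s)) = pairing L (val (tmul (b\<^sup>\<star>) L'))"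
    by (intro pairing_cong) (auto simp: val_tmul)
  then show ?thesis by (simp add: pairing_tmul star_mult m_assoc)
qed

text \<open>An identity only under the inner product: the formal sum for b + c is not the
  concatenation of those for b and c.\<close>

lemma lmul_add:
  assumes "x \<in> dom" "y \<in> dom" and b [simp]: "b \<in> carrier B" "c \<in> carrier B"
  shows "xip x (lmul (b \<oplus> c) y) = xip x (lmul b y) \<oplus> xip x (lmul c y)"
proof -
  obtain a L a' L' where [simp]: "x = (a, L)" "a \<in> carrier B" "L \<in> tensors"
    "y = (a', L')" "a' \<in> carrier B" "L' \<in> tensors" using assms by (metis domE)
  have "pairing L (val (tmul (b \<oplus> c) L')) = pairing L (\<lambda>s. val (tmul b L') s \<oplus> val (tmul c L') s)"
    by (intro pairing_cong) (auto simp: val_tmul_add)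
  then show ?thesis by (simp add: pairing_add l_distr r_distr a_ac)
qed

lemma lmul_smult:
  assumes "x \<in> dom" "y \<in> dom" and b [simp]: "b \<in> carrier B"
  shows "xip x (lmul (z \<odot> b) y) = z \<odot> xip x (lmul b y)"
proof -
  obtain a L a' L' where [simp]: "x = (a, L)" "a \<in> carrier B" "L \<in> tensors"
    "y = (a', L')" "a' \<in> carrier B" "L' \<in> tensors" using assms by (metis domE)
  have "pairing L (val (tmul (z \<odot> b) L')) = pairing L (\<lambda>s. val (tmul b L') s \<otimes> (z \<odot> \<one>))"
    by (intro pairing_cong) (auto simp: val_tmul_smult smult_mult_right)
  then show ?thesis
    by (simp add: pairing_mult_right smult_mult_left smult_mult_right smult_add_right)
qed

lemma tmul_one: "L \<in> tensors \<Longrightarrow> tmul \<one> L = L"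
  by (induction L rule: tensors_induct) auto

lemma tmul_tmul: "L \<in> tensors \<Longrightarrow> b \<in> carrier B \<Longrightarrow> c \<in> carrier B \<Longrightarrow> tmul b (tmul c L) = tmul (b \<otimes> c) L"
  by (induction L rule: tensors_induct) (auto simp: m_assoc)

lemma lmul_one: "x \<in> dom \<Longrightarrow> lmul \<one> x = x"
  by (cases x) (simp add: tmul_one)

lemma lmul_lmul: "\<lbrakk>x \<in> dom; b \<in> carrier B; c \<in> carrier B\<rbrakk> \<Longrightarrow> lmul b (lmul c x) = lmul (b \<otimes> c) x"
  by (cases x) (simp add: tmul_tmul m_assoc)

text \<open>Write \<open>||b||\<^sup>2 - b* b\<close> as \<open>d\<^sup>2\<close> with d
  self-adjoint. Then <bx, bx> + <dx, dx> = \<open>||b||\<^sup>2\<close> <x, x>, and dropping a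
  positive summand bounds the action of b.\<close>

lemma adjointable_lmul: assumes b [simp]: "b \<in> carrier B" shows "R.adjointable (lmul b) (lmul (b\<^sup>\<star>))"
proof (rule R.adjointableI)
  have "pos (scal (\<parallel>b\<parallel>\<^sup>2) \<ominus> b\<^sup>\<star> \<otimes> b)"
    by (intro pos_scal_diff) (auto simp: star_mult cstar_identity)
  then obtain d where "pos d" and dd: "d \<otimes> d = scal (\<parallel>b\<parallel>\<^sup>2) \<ominus> b\<^sup>\<star> \<otimes> b" by (metis pos_sqrt)
  then have d [simp]: "d \<in> carrier B" and sd: "d\<^sup>\<star> = d" by (auto simp: pos_star)
  fix x assume x [simp]: "x \<in> dom"
  have c: "b\<^sup>\<star> \<otimes> b \<in> carrier B" "scal (\<parallel>b\<parallel>\<^sup>2) \<in> carrier B" by auto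
  have "xip (lmul b x) (lmul b x) \<oplus> xip (lmul d x) (lmul d x) = xip x (lmul (b\<^sup>\<star> \<otimes> b \<oplus> d \<otimes> d) x)"
    by (simp add: lmul_adjoint lmul_lmul lmul_add sd)
  also have "b\<^sup>\<star> \<otimes> b \<oplus> d \<otimes> d = scal (\<parallel>b\<parallel>\<^sup>2)" unfolding dd using c by algebra
  also have "xip x (lmul \<dots> x) = of_real (\<parallel>b\<parallel>\<^sup>2) \<odot> xip x x"
    by (simp add: scal_def lmul_smult lmul_one del: of_real_power)
  finally have e: "xip (lmul b x) (lmul b x) \<oplus> xip (lmul d x) (lmul d x) = of_real (\<parallel>b\<parallel>\<^sup>2) \<odot> xip x x" .
  have c': "xip (lmul b x) (lmul b x) \<in> carrier B" "xip (lmul d x) (lmul d x) \<in> carrier B" by auto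
  have "(xip (lmul b x) (lmul b x) \<oplus> xip (lmul d x) (lmul d x)) \<ominus> xip (lmul b x) (lmul b x) =
      xip (lmul d x) (lmul d x)" using c' by algebra
  then have "pos (of_real (\<parallel>b\<parallel>\<^sup>2) \<odot> xip x x \<ominus> xip (lmul b x) (lmul b x))"
    unfolding e by (simp add: X.ip_pos)
  then have "\<parallel>xip (lmul b x) (lmul b x)\<parallel> \<le> \<parallel>of_real (\<parallel>b\<parallel>\<^sup>2) \<odot> xip x x\<parallel>"
    by (intro pos_norm_mono X.ip_pos) auto
  then have "(X.nrm (lmul b x))\<^sup>2 \<le> (\<parallel>b\<parallel> * X.nrm x)\<^sup>2"
    by (simp add: X.nrm_square norm_smult power_mult_distrib del: of_real_power)
  then show "X.nrm (lmul b x) \<le> \<parallel>b\<parallel> * X.nrm x"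
    by (rule power2_le_imp_le) (simp add: norm_nonneg)
qed (auto simp: lmul_adjoint norm_nonneg)

text \<open>The bound is the norm of v, since \<open>1 + \<theta>(1)\<close> is <v, v>. It applies
  because a* a lies below <x, x>, the tensor part being positive.\<close>

lemma adjointable_vmul: "R.adjointable vmul vadj"
proof (rule R.adjointableI)
  fix x assume "x \<in> dom"
  then obtain a L where x [simp]: "x = (a, L)" "a \<in> carrier B" "L \<in> tensors" by (metis domE)
  show "vmul x \<in> dom" "vadj x \<in> dom" by simp_all
  have "xip (vmul x) (vmul x) = a\<^sup>\<star> \<otimes> (\<one> \<oplus> \<theta> \<one>) \<otimes> a"
    by (simp add: l_distr r_distr m_assoc)
  then have "\<parallel>xip (vmul x) (vmul x)\<parallel> \<le> \<parallel>a\<^sup>\<star> \<otimes> (\<one> \<oplus> \<theta> \<one>)\<parallel> * \<parallel>a\<parallel>" using norm_mult by simp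
  also have "\<dots> \<le> (\<parallel>a\<^sup>\<star>\<parallel> * \<parallel>\<one> \<oplus> \<theta> \<one>\<parallel>) * \<parallel>a\<parallel>" by (intro mult_right_mono norm_mult norm_nonneg) auto
  also have "\<dots> = \<parallel>\<one> \<oplus> \<theta> \<one>\<parallel> * \<parallel>a\<^sup>\<star> \<otimes> a\<parallel>" by (simp add: cstar_identity power2_eq_square)
  also have "\<dots> \<le> \<parallel>\<one> \<oplus> \<theta> \<one>\<parallel> * \<parallel>xip x x\<parallel>"
  proof (intro mult_left_mono pos_norm_mono pos_star_mult norm_nonneg)
    have c: "a\<^sup>\<star> \<otimes> a \<in> carrier B" "pairing L (val L) \<in> carrier B" by auto
    have "xip x x \<ominus> a\<^sup>\<star> \<otimes> a = pairing L (val L)" by simp (use c in algebra)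
    then show "pos (xip x x \<ominus> a\<^sup>\<star> \<otimes> a)" by (simp add: pos_pairing)
  qed auto
  finally have "(X.nrm (vmul x))\<^sup>2 \<le> (sqrt \<parallel>\<one> \<oplus> \<theta> \<one>\<parallel> * X.nrm x)\<^sup>2"
    using \<open>vmul x \<in> dom\<close> \<open>x \<in> dom\<close> by (simp add: X.nrm_square power_mult_distrib norm_nonneg del: x(1) vmul.simps)
  then show "X.nrm (vmul x) \<le> sqrt \<parallel>\<one> \<oplus> \<theta> \<one>\<parallel> * X.nrm x"
    by (rule power2_le_imp_le)
      (intro mult_nonneg_nonneg X.nrm_nonneg[OF \<open>x \<in> dom\<close>] real_sqrt_ge_zero norm_nonneg, simp)
  fix y assume "y \<in> dom"
  then obtain a' L' where y [simp]: "y = (a', L')" "a' \<in> carrier B" "L' \<in> tensors" by (metis domE)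
  have "pairing L (val []) = pairing L (\<lambda>s. \<zero>)" by (intro pairing_cong) auto
  then show "xip (vmul x) y = xip x (vadj y)" by (simp add: pairing_zero r_distr)
qed (simp add: norm_nonneg)

end

section \<open>The probability space\<close>

lemma (in represented_completion) op_eqI:
  assumes "\<And>F x. F \<in> completion \<Longrightarrow> x \<in> M \<Longrightarrow> F (s x) = F (s' x)"
  shows "op s = op s'"
proof -
  have "lift s F = lift s' F" if "F \<in> completion" for F
    using assms that by (auto simp: lift_def)
  then show ?thesis unfolding op_def by (intro restrict_ext) auto
qed

text \<open>Precomposition reverses the order: F is first composed with s', then with s.\<close>

lemma (in represented_completion) op_mult:
  assumes s: "adjointable t s" and s': "adjointable t' s'"
  shows "op s \<otimes>\<^bsub>K.op_alg\<^esub> op s' = op (\<lambda>x. s' (s x))"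
proof -
  have "op s (op s' (\<phi> F)) = op (\<lambda>x. s' (s x)) (\<phi> F)" if F: "F \<in> completion" for F
  proof -
    have "lift s (lift s' F) = lift (\<lambda>x. s' (s x)) F"
      using adjointableD(2)[OF s] by (auto simp: lift_def)
    then show ?thesis using F lift_closed[OF s' F] by (simp add: op_\<phi>)
  qed
  then show ?thesis by (intro K.ops_eqI) (auto simp: op_def[of "\<lambda>x. s' (s x)"])
qed

section \<open>The inclusion, the distinguished vector, the expectation and the operator
  \<open>V\<close>\<close>

context completely_positive_map
begin

abbreviation "L \<equiv> R.K.op_alg"

text \<open>The star appears because \<open>R.op s\<close> extends the adjoint of \<open>s\<close>;
  the operator is left multiplication by b. Likewise \<open>V\<close> below extends
  \<open>vmul\<close>.\<close>

definition \<iota> where "\<iota> b = R.op (lmul (b\<^sup>\<star>))"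

definition V where "V = R.op vadj"

definition \<Omega> where "\<Omega> = coords (X.embed (\<one>, []))"

definition E where "E T = R.kip \<Omega> (T \<Omega>)"

lemma adjointable_lmul_star: "b \<in> carrier B \<Longrightarrow> R.adjointable (lmul b) (lmul (b\<^sup>\<star>))"
  "b \<in> carrier B \<Longrightarrow> R.adjointable (lmul (b\<^sup>\<star>)) (lmul b)"
  using adjointable_lmul[of b] R.adjointable_sym by blast+

lemma vadj_adjointable: "R.adjointable vadj vmul"
  by (rule R.adjointable_sym[OF adjointable_vmul])

lemma \<iota>_ops [simp]: "b \<in> carrier B \<Longrightarrow> \<iota> b \<in> R.K.ops"
  unfolding \<iota>_def by (rule R.op_in_ops[OF adjointable_lmul_star(1)])

lemma V_ops [simp]: "V \<in> R.K.ops"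
  unfolding V_def by (rule R.op_in_ops[OF adjointable_vmul])

lemma \<iota>_star: "b \<in> carrier B \<Longrightarrow> R.K.adj (\<iota> b) = \<iota> (b\<^sup>\<star>)"
  unfolding \<iota>_def by (simp add: R.adj_op[OF adjointable_lmul_star(1)])

lemma V_star: "R.K.adj V = R.op vmul"
  unfolding V_def by (rule R.adj_op[OF adjointable_vmul])

lemma unit_in_dom: "(\<one>, []) \<in> dom"
  by simp

lemma \<Omega>_closed [simp]: "\<Omega> \<in> coords ` X.completion"
  unfolding \<Omega>_def by (intro imageI X.embed_closed unit_in_dom)

lemma \<iota>_embed: "\<lbrakk>b \<in> carrier B; y \<in> dom\<rbrakk> \<Longrightarrow> \<iota> b (coords (X.embed y)) = coords (X.embed (lmul b y))"
  unfolding \<iota>_def by (rule R.op_embed[OF adjointable_lmul_star(1)])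

lemma V_embed: "y \<in> dom \<Longrightarrow> V (coords (X.embed y)) = coords (X.embed (vmul y))"
  unfolding V_def by (rule R.op_embed[OF adjointable_vmul])

lemma V_star_embed: "y \<in> dom \<Longrightarrow> R.op vmul (coords (X.embed y)) = coords (X.embed (vadj y))"
  by (rule R.op_embed[OF vadj_adjointable])

lemma kip_embed_embed:
  "\<lbrakk>x \<in> dom; y \<in> dom\<rbrakk> \<Longrightarrow> R.kip (coords (X.embed x)) (coords (X.embed y)) = xip x y"
  by (simp add: R.kip_embed) (simp add: X.embed_def)

lemma xip_right: "\<lbrakk>x \<in> dom; y \<in> dom; b \<in> carrier B\<rbrakk> \<Longrightarrow> xip (lmul (b\<^sup>\<star>) x) y = xip x (lmul b y)"
  using lmul_adjoint[of x y "b\<^sup>\<star>"] by simp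

lemma linear_map_\<iota>: "linear_map B L \<iota>"
  unfolding linear_map_def
proof (intro conjI ballI allI)
  fix b assume b [simp]: "b \<in> carrier B"
  show "\<iota> (b \<oplus> c) = \<iota> b \<oplus>\<^bsub>L\<^esub> \<iota> c" if c [simp]: "c \<in> carrier B" for c
  proof (rule R.K.ops_eqI)
    fix x assume "x \<in> coords ` X.completion"
    then obtain F where x: "x = coords F" and F [simp]: "F \<in> X.completion" by blast
    have "R.lift (lmul ((b \<oplus> c)\<^sup>\<star>)) F = X.cadd (R.lift (lmul (b\<^sup>\<star>)) F) (R.lift (lmul (c\<^sup>\<star>)) F)"
    proof
      fix y
      have "F (lmul ((b \<oplus> c)\<^sup>\<star>) y) = F (xadd (lmul (b\<^sup>\<star>) y) (lmul (c\<^sup>\<star>) y))" if [simp]: "y \<in> dom"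
        by (rule X.completion_cong) (auto simp: xip_right lmul_add X.ip_add_left)
      then show "R.lift (lmul ((b \<oplus> c)\<^sup>\<star>)) F y = X.cadd (R.lift (lmul (b\<^sup>\<star>)) F) (R.lift (lmul (c\<^sup>\<star>)) F) y"
        by (simp add: R.lift_def X.cadd_def X.completion_add)
    qed
    then show "\<iota> (b \<oplus> c) x = (\<iota> b \<oplus>\<^bsub>L\<^esub> \<iota> c) x"
      using R.lift_closed[OF adjointable_lmul_star(1) F]
      by (simp add: x \<iota>_def R.op_\<phi> R.kadd_def)
  qed (simp_all add: R.K.ops_ext)
  show "\<iota> (z \<odot> b) = z \<odot>\<^bsub>L\<^esub> \<iota> b" for z
  proof (rule R.K.ops_eqI)
    fix x assume "x \<in> coords ` X.completion"
    then obtain F where x: "x = coords F" and F [simp]: "F \<in> X.completion" by blast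
    have "R.lift (lmul ((z \<odot> b)\<^sup>\<star>)) F = X.cact (R.lift (lmul (b\<^sup>\<star>)) F) (z \<odot> \<one>)"
    proof
      fix y
      \<comment> \<open>Two conjugations cancel: one from the involution, the other from the
        conjugate-linearity of elements of the completion.\<close>
      have "F (lmul ((z \<odot> b)\<^sup>\<star>) y) = F (xact (lmul (b\<^sup>\<star>) y) (cnj z \<odot> \<one>))" if [simp]: "y \<in> dom"
      proof (rule X.completion_cong)
        fix w assume "w \<in> dom"
        then show "xip (lmul ((z \<odot> b)\<^sup>\<star>) y) w = xip (xact (lmul (b\<^sup>\<star>) y) (cnj z \<odot> \<one>)) w"
          using xip_right[of y w "z \<odot> b"] xip_right[of y w b]
          by (simp add: lmul_smult X.ip_act_left star_smult smult_mult_left)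
      qed (simp_all del: lmul.simps)
      then show "R.lift (lmul ((z \<odot> b)\<^sup>\<star>)) F y = X.cact (R.lift (lmul (b\<^sup>\<star>)) F) (z \<odot> \<one>) y"
        by (simp add: R.lift_def X.cact_def X.completion_act star_smult smult_mult_left smult_mult_right)
    qed
    then show "\<iota> (z \<odot> b) x = (z \<odot>\<^bsub>L\<^esub> \<iota> b) x"
      using R.lift_closed[OF adjointable_lmul_star(1) F]
      by (simp add: x \<iota>_def R.op_\<phi> R.kact_def)
  qed (simp_all add: R.K.ops_ext)
qed simp

lemma \<iota>_mult:
  assumes [simp]: "b \<in> carrier B" "c \<in> carrier B" shows "\<iota> (b \<otimes> c) = \<iota> b \<otimes>\<^bsub>L\<^esub> \<iota> c"
  unfolding \<iota>_def R.op_mult[OF adjointable_lmul_star(1)[OF assms(1)] adjointable_lmul_star(1)[OF assms(2)]]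
  by (rule R.op_eqI) (simp add: lmul_lmul star_mult)

lemma \<iota>_one: "\<iota> \<one> = \<one>\<^bsub>L\<^esub>"
proof (rule R.K.ops_eqI)
  fix x assume "x \<in> coords ` X.completion"
  then obtain F where x: "x = coords F" and F [simp]: "F \<in> X.completion" by blast
  have "R.lift (lmul \<one>) F = F"
    by (rule extensionalityI[OF _ X.completion_ext[OF F]]) (auto simp: R.lift_def lmul_one)
  then show "\<iota> \<one> x = \<one>\<^bsub>L\<^esub> x" by (simp add: x \<iota>_def R.op_\<phi>)
qed (simp_all add: R.K.ops_ext)

text \<open>Left and right multiplication by \<open>B\<close> agree on \<open>\<Omega>\<close>, as
  both give the vector (b, 0). The bimodule property of \<open>E\<close> rests on this, elements of
  \<open>B\<close> on the left first being moved across by adjoints.\<close>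

lemma \<iota>_\<Omega>: assumes [simp]: "b \<in> carrier B" shows "\<iota> b \<Omega> = R.kact \<Omega> b"
proof -
  have "X.embed (b, []) = X.cact (X.embed (\<one>, [])) b"
  proof (rule X.completion_eqI)
    fix x assume x: "x \<in> dom"
    show "X.embed (b, []) x = X.cact (X.embed (\<one>, [])) b x"
      using X.ip_act[OF x unit_in_dom assms] x by (simp add: X.embed_def X.cact_def)
  qed simp_all
  then show ?thesis
    by (simp add: \<Omega>_def \<iota>_embed R.kact_def)
qed

lemma E_\<iota>: "b \<in> carrier B \<Longrightarrow> E (\<iota> b) = b"
  unfolding E_def \<Omega>_def by (simp add: \<iota>_embed kip_embed_embed)

lemma E_closed: "T \<in> R.K.ops \<Longrightarrow> E T \<in> carrier B"
  by (simp add: E_def)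

lemma linear_map_E: "linear_map L B E"
  unfolding linear_map_def
  by (auto simp: E_closed) (auto simp: E_def R.K.ip_add R.K.ip_act smult_mult_right)

lemma E_bimodule:
  assumes a [simp]: "a \<in> R.K.ops" and b [simp]: "b \<in> carrier B" "c \<in> carrier B"
  shows "E (\<iota> b \<otimes>\<^bsub>L\<^esub> a \<otimes>\<^bsub>L\<^esub> \<iota> c) = b \<otimes> E a \<otimes> c"
proof -
  have "R.kip \<Omega> (\<iota> b (a (\<iota> c \<Omega>))) = R.kip (\<iota> (b\<^sup>\<star>) \<Omega>) (a (\<iota> c \<Omega>))"
    using R.K.ip_adj'[of "\<iota> b" \<Omega> "a (\<iota> c \<Omega>)"] by (simp add: \<iota>_star)
  also have "\<dots> = b \<otimes> R.kip \<Omega> (a \<Omega>) \<otimes> c"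
    by (simp add: \<iota>_\<Omega> R.K.ops_act R.K.ip_act R.K.ip_act_left m_assoc)
  finally show ?thesis by (simp add: E_def)
qed

lemma E_finsum:
  assumes "\<And>i. i < n \<Longrightarrow> f i \<in> R.K.ops"
  shows "E (\<Oplus>\<^bsub>L\<^esub>i\<in>{..<n::nat}. f i) = (\<Oplus>i\<in>{..<n}. E (f i)) \<and> (\<Oplus>\<^bsub>L\<^esub>i\<in>{..<n}. f i) \<in> R.K.ops"
  using assms
proof (induction n)
  case 0
  interpret L: cstar_algebra L by (rule R.K.cstar_algebra_op_alg)
  have "(\<Oplus>\<^bsub>L\<^esub>i\<in>{..<0::nat}. f i) = \<zero>\<^bsub>L\<^esub>" by (simp del: R.K.op_alg_simps)
  moreover have "\<zero>\<^bsub>L\<^esub> \<in> R.K.ops" using L.zero_closed unfolding R.K.op_alg_simps(1) .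
  moreover have "E \<zero>\<^bsub>L\<^esub> = \<zero>" by (simp add: E_def R.K.ip_zero)
  ultimately show ?case by (simp del: R.K.op_alg_simps)
next
  case (Suc n)
  interpret L: cstar_algebra L by (rule R.K.cstar_algebra_op_alg)
  have IH: "E (\<Oplus>\<^bsub>L\<^esub>i\<in>{..<n}. f i) = (\<Oplus>i\<in>{..<n}. E (f i))" "(\<Oplus>\<^bsub>L\<^esub>i\<in>{..<n}. f i) \<in> R.K.ops"
    using Suc by simp_all
  have f: "f n \<in> R.K.ops" "E (f n) \<in> carrier B" using Suc.prems by (simp_all add: E_closed)
  have "(\<Oplus>\<^bsub>L\<^esub>i\<in>{..<Suc n}. f i) = f n \<oplus>\<^bsub>L\<^esub> (\<Oplus>\<^bsub>L\<^esub>i\<in>{..<n}. f i)"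
    using Suc.prems by (subst lessThan_Suc, intro L.finsum_insert) auto
  moreover have "(\<Oplus>i\<in>{..<Suc n}. E (f i)) = E (f n) \<oplus> (\<Oplus>i\<in>{..<n}. E (f i))"
    using Suc.prems by (subst lessThan_Suc, intro finsum_insert) (auto simp: E_closed)
  moreover have "E (f n \<oplus>\<^bsub>L\<^esub> (\<Oplus>\<^bsub>L\<^esub>i\<in>{..<n}. f i)) = E (f n) \<oplus> E (\<Oplus>\<^bsub>L\<^esub>i\<in>{..<n}. f i)"
    using linear_map_E f(1) IH(2) unfolding linear_map_def R.K.op_alg_simps(1) by blast
  moreover have "f n \<oplus>\<^bsub>L\<^esub> (\<Oplus>\<^bsub>L\<^esub>i\<in>{..<n}. f i) \<in> R.K.ops"
    using L.a_closed[of "f n" "\<Oplus>\<^bsub>L\<^esub>i\<in>{..<n}. f i"] f(1) IH(2) unfolding R.K.op_alg_simps(1) by blast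
  ultimately show ?case by (simp only: IH(1))
qed

text \<open>The (i, j) entry of the image of \<open>T* T\<close> is the sum over k of <T_ki
  \<open>\<Omega>\<close>, T_kj \<open>\<Omega>\<close>>, which \<open>mat_positive_gram\<close>
  turns into a positive matrix over \<open>B\<close>.\<close>

lemma completely_positive_E: "completely_positive L B E"
  unfolding completely_positive_def
proof (intro conjI allI impI linear_map_E)
  fix n G assume "mat_positive L n G"
  then obtain T where T: "\<forall>i<n. \<forall>j<n. T i j \<in> carrier L"
    and G: "\<forall>i<n. \<forall>j<n. G i j = (\<Oplus>\<^bsub>L\<^esub>k\<in>{..<n}. (T k i)\<^sup>\<star>\<^bsub>L\<^esub> \<otimes>\<^bsub>L\<^esub> T k j)"
    unfolding mat_positive_def mat_over_def by blast
  have T: "T i j \<in> R.K.ops" if "i < n" "j < n" for i j using T that by simp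
  show "mat_positive B n (\<lambda>i j. E (G i j))"
  proof (rule mat_positive_cong)
    show "mat_positive B n (\<lambda>i j. \<Oplus>k\<in>{..<n}. R.kip (T k i \<Omega>) (T k j \<Omega>))"
      using T by (intro R.K.mat_positive_gram) auto
    fix i j assume ij: "i < n" "j < n"
    have TT: "(T k i)\<^sup>\<star>\<^bsub>L\<^esub> \<otimes>\<^bsub>L\<^esub> T k j \<in> R.K.ops" if "k < n" for k
      using that ij T by (simp add: R.K.mult_in_ops)
    have "E (G i j) = (\<Oplus>k\<in>{..<n}. E ((T k i)\<^sup>\<star>\<^bsub>L\<^esub> \<otimes>\<^bsub>L\<^esub> T k j))"
      using E_finsum[of n "\<lambda>k. (T k i)\<^sup>\<star>\<^bsub>L\<^esub> \<otimes>\<^bsub>L\<^esub> T k j"] TT G ij by (simp del: R.K.op_alg_simps)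
    also have "\<dots> = (\<Oplus>k\<in>{..<n}. R.kip (T k i \<Omega>) (T k j \<Omega>))"
      using T ij by (intro finsum_cong') (auto simp: E_def R.K.ip_adj)
    finally show "(\<Oplus>k\<in>{..<n}. R.kip (T k i \<Omega>) (T k j \<Omega>)) = E (G i j)" by simp
  qed
qed

lemma valued_prob_space_L: "valued_prob_space B L \<iota> E"
proof (intro valued_prob_space.intro valued_prob_space_axioms.intro R.K.cstar_algebra_op_alg
    cstar_algebra_axioms completely_positive_E)
  show "unital_star_hom B L \<iota>"
    unfolding unital_star_hom_def
    using linear_map_\<iota> \<iota>_mult \<iota>_one \<iota>_star
    by (auto simp: linear_map_def intro!: ring_hom_memI simp del: R.K.op_alg_simps(2,3,5,6))
  show "inj_on \<iota> (carrier B)" by (metis E_\<iota> inj_onI)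
  show "E (\<iota> b) = b" if "b \<in> carrier B" for b using that by (rule E_\<iota>)
  show "E (\<iota> b \<otimes>\<^bsub>L\<^esub> a \<otimes>\<^bsub>L\<^esub> \<iota> c) = b \<otimes> E a \<otimes> c"
    if "a \<in> carrier L" "b \<in> carrier B" "c \<in> carrier B" for a b c
    using E_bimodule[of a b c] that by simp
qed

lemma V_relation:
  assumes [simp]: "b \<in> carrier B" "c \<in> carrier B"
  shows "V \<otimes>\<^bsub>L\<^esub> \<iota> b \<otimes>\<^bsub>L\<^esub> V\<^sup>\<star>\<^bsub>L\<^esub> \<otimes>\<^bsub>L\<^esub> \<iota> c \<otimes>\<^bsub>L\<^esub> V = V \<otimes>\<^bsub>L\<^esub> \<iota> b \<otimes>\<^bsub>L\<^esub> \<iota> (\<theta> c \<oplus> c)"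
proof (rule R.K.ops_eqI)
  fix x assume x: "x \<in> coords ` X.completion"
  then obtain F where F [simp]: "F \<in> X.completion" and xF: "x = coords F" by blast
  have ops: "V x \<in> coords ` X.completion" if "x \<in> coords ` X.completion" for x
    by (rule R.K.ops_closed[OF V_ops that])
  have op: "R.op s (coords G) = coords (R.lift s G)" "R.lift s G \<in> X.completion"
    if "R.adjointable t s" "G \<in> X.completion" for t s G
    using that by (auto simp: R.op_\<phi> intro: R.lift_closed)
  note l = op[OF adjointable_lmul_star(1)] and v = op[OF adjointable_vmul] and w = op[OF vadj_adjointable]
  \<comment> \<open>The factors act in reverse order because operators precompose. With u the
    \<open>B\<close>-component of b* \<open>vadj y\<close>, both sides have the entry
    \<open>(c + \<theta> c)* u\<close> and an empty list, so they agree already as formal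
    vectors.\<close>
  have eq: "F (vadj (lmul (c\<^sup>\<star>) (vmul (lmul (b\<^sup>\<star>) (vadj y))))) = F (lmul ((\<theta> c \<oplus> c)\<^sup>\<star>) (lmul (b\<^sup>\<star>) (vadj y)))"
    if y: "y \<in> dom" for y
  proof -
    obtain a K where [simp]: "y = (a, K)" by (cases y)
    have [simp]: "a \<in> carrier B" "K \<in> tensors" using y by simp_all
    have "vadj (lmul (c\<^sup>\<star>) (vmul (lmul (b\<^sup>\<star>) (vadj y)))) = lmul ((\<theta> c \<oplus> c)\<^sup>\<star>) (lmul (b\<^sup>\<star>) (vadj y))"
      by (simp add: star_add \<theta>_star l_distr a_comm m_assoc)
    then show ?thesis by simp
  qed
  have d: "vadj y \<in> dom" "vmul y \<in> dom" if "y \<in> dom" for y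
    using R.adjointableD[OF adjointable_vmul that] by auto
  have "R.lift vadj (R.lift (lmul (b\<^sup>\<star>)) (R.lift vmul (R.lift (lmul (c\<^sup>\<star>)) (R.lift vadj F)))) =
      R.lift vadj (R.lift (lmul (b\<^sup>\<star>)) (R.lift (lmul ((\<theta> c \<oplus> c)\<^sup>\<star>)) F))"
    unfolding R.lift_def by (rule restrict_ext) (simp add: eq d)
  then show "(V \<otimes>\<^bsub>L\<^esub> \<iota> b \<otimes>\<^bsub>L\<^esub> V\<^sup>\<star>\<^bsub>L\<^esub> \<otimes>\<^bsub>L\<^esub> \<iota> c \<otimes>\<^bsub>L\<^esub> V) x = (V \<otimes>\<^bsub>L\<^esub> \<iota> b \<otimes>\<^bsub>L\<^esub> \<iota> (\<theta> c \<oplus> c)) x"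
    by (simp add: xF V_star) (simp add: V_def \<iota>_def l v w)
qed simp_all

lemma E_V: assumes [simp]: "b \<in> carrier B" shows "E (V \<otimes>\<^bsub>L\<^esub> \<iota> b \<otimes>\<^bsub>L\<^esub> V\<^sup>\<star>\<^bsub>L\<^esub>) = b"
proof -
  have "(V \<otimes>\<^bsub>L\<^esub> \<iota> b \<otimes>\<^bsub>L\<^esub> V\<^sup>\<star>\<^bsub>L\<^esub>) \<Omega> = V (\<iota> b (R.op vmul \<Omega>))"
    using R.K.ops_closed[OF R.K.adj_closed[OF V_ops] \<Omega>_closed] by (simp add: V_star)
  \<comment> \<open>\<open>V* \<Omega> = \<Omega>\<close>, since <v, \<open>\<Omega>\<close>> = 1;
    then b maps it to (b, 0), and \<open>V\<close> maps that to v b, whose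
    \<open>B\<close>-component is b.\<close>
  also have "\<dots> = coords (X.embed (b, [(\<one>, b)]))"
    by (simp add: \<Omega>_def V_star_embed \<iota>_embed V_embed)
  finally show ?thesis unfolding E_def \<Omega>_def by (simp add: kip_embed_embed)
qed

end

theorem lemma3p2:
  fixes B :: "'b cstar" and \<eta> :: "'b \<Rightarrow> 'b"
  assumes "cstar_algebra B"
    and "linear_map B B \<eta>"
    and "completely_positive B B (\<lambda>b. \<eta> b \<ominus>\<^bsub>B\<^esub> b)"
  shows "\<exists>(A :: 'b op cstar) \<iota> E. valued_prob_space B A \<iota> E \<and>
    (\<exists>V\<in>carrier A.
      (\<forall>b\<^sub>1\<in>carrier B. \<forall>b\<^sub>2\<in>carrier B.
        V \<otimes>\<^bsub>A\<^esub> \<iota> b\<^sub>1 \<otimes>\<^bsub>A\<^esub> V\<^sup>\<star>\<^bsub>A\<^esub> \<otimes>\<^bsub>A\<^esub> \<iota> b\<^sub>2 \<otimes>\<^bsub>A\<^esub> V = V \<otimes>\<^bsub>A\<^esub> \<iota> b\<^sub>1 \<otimes>\<^bsub>A\<^esub> \<iota> (\<eta> b\<^sub>2)) \<and>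
      (\<forall>b\<in>carrier B. E (V \<otimes>\<^bsub>A\<^esub> \<iota> b \<otimes>\<^bsub>A\<^esub> V\<^sup>\<star>\<^bsub>A\<^esub>) = b))"
proof -
  interpret B: cstar_algebra B by (rule assms(1))
  interpret C: completely_positive_map B "\<lambda>b. \<eta> b \<ominus>\<^bsub>B\<^esub> b"
    by (intro completely_positive_map.intro completely_positive_map_axioms.intro assms)
  have \<eta>: "\<eta> b \<ominus>\<^bsub>B\<^esub> b \<oplus>\<^bsub>B\<^esub> b = \<eta> b" if b: "b \<in> carrier B" for b
  proof -
    have "\<eta> b \<in> carrier B" using assms(2) b by (auto simp: linear_map_def)
    then show ?thesis using b by algebra
  qed
  have "C.V \<in> carrier C.L" by simp
  moreover have "\<forall>b\<in>carrier B. \<forall>c\<in>carrier B.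
      C.V \<otimes>\<^bsub>C.L\<^esub> C.\<iota> b \<otimes>\<^bsub>C.L\<^esub> C.V\<^sup>\<star>\<^bsub>C.L\<^esub> \<otimes>\<^bsub>C.L\<^esub> C.\<iota> c \<otimes>\<^bsub>C.L\<^esub> C.V =
        C.V \<otimes>\<^bsub>C.L\<^esub> C.\<iota> b \<otimes>\<^bsub>C.L\<^esub> C.\<iota> (\<eta> c)"
  proof (intro ballI)
    fix b c assume b: "b \<in> carrier B" and c: "c \<in> carrier B"
    show "C.V \<otimes>\<^bsub>C.L\<^esub> C.\<iota> b \<otimes>\<^bsub>C.L\<^esub> C.V\<^sup>\<star>\<^bsub>C.L\<^esub> \<otimes>\<^bsub>C.L\<^esub> C.\<iota> c \<otimes>\<^bsub>C.L\<^esub> C.V =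
        C.V \<otimes>\<^bsub>C.L\<^esub> C.\<iota> b \<otimes>\<^bsub>C.L\<^esub> C.\<iota> (\<eta> c)"
      using C.V_relation[OF b c] unfolding \<eta>[OF c] .
  qed
  moreover have "\<forall>b\<in>carrier B. C.E (C.V \<otimes>\<^bsub>C.L\<^esub> C.\<iota> b \<otimes>\<^bsub>C.L\<^esub> C.V\<^sup>\<star>\<^bsub>C.L\<^esub>) = b"
    using C.E_V by blast
  ultimately show ?thesis using C.valued_prob_space_L by blast
qed

end
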